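(* Let $(V/\Lambda,\omega)$ be a rational symplectic torus. Then a systolic bound holds on the set $\mathcal{U}_{\mathrm{ag}}(V)\subset\mathcal{U}^+(V)$ of almost geometric forms: there is a constant $C>0$, depending only on $(V/\Lambda,\omega)$, such that $$\left(\mathrm{Sys}_\Omega(V/\Lambda)\right)^2\leq C\,\mathrm{Vol}_\Omega(V/\Lambda)\qquad\text{for all }\Omega\in\mathcal{U}_{\mathrm{ag}}(V).$$ In particular, if $\dim_{\mathbb R}V=4$, a systolic bound (the same inequality, with a constant $C>0$ depending only on $(V/\Lambda,\omega)$) holds for all $\Omega\in\mathcal{U}^+(V)$.
   Context: Rational symplectic torus: $V$ is a real vector space of dimension $2n>0$, $\Lambda\subset V$ a lattice, and $\omega$ a constant symplectic form on $V$ taking rational values on $\Lambda\times\Lambda$. An $n$-form $\Omega$ on $V$ is primitive if $\Omega\wedge\omega=0$; $\Lambda^n_{\mathrm{pr}}V^\vee\subset\Lambda^nV^\vee$ is the real vector space of primitive $n$-forms. $\mathcal{U}(V)\subset(\Lambda^n_{\mathrm{pr}}V^\vee)\otimes_{\mathbb R}\mathbb{C}$ is the set of those $\Omega$ whose restriction to every Lagrangian subspace $L\subset V$ is non-zero. For $\Omega\in\mathcal{U}(V)$ define $\phi_\Omega:\mathrm{LGr}(V)\to\mathbb{R}/\pi\mathbb{Z}$, $L\mapsto\mathrm{Arg}(\Omega|_L)$, on the Lagrangian Grassmannian (well defined modulo $\pi$). There is a canonical isomorphism $\pi_1(\mathrm{LGr}(V))\cong\mathbb{Z}$: for $V=\mathbb{C}^n$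 with $z_k=x_k+iy_k$, $\omega=\sum_k dx_k\wedge dy_k$, the canonical generator is the loop $\mathbb{R}/\pi\mathbb{Z}\ni\theta\mapsto e^{i\theta}\mathbb{R}\times\mathbb{R}^{n-1}$; in general it is transported by any linear symplectomorphism. $\mathcal{U}^+(V)$ is the set of $\Omega\in\mathcal{U}(V)$ such that $\phi_\Omega$ sends the canonical generator to the positive generator of $\pi_1(\mathbb{R}/\pi\mathbb{Z})$. A compatible complex structure on $V$ is a linear $J$ with $J^2=-1$, $\omega(Jv,Jw)=\omega(v,w)$, and $\omega(v,Jv)>0$ for $v\neq0$. $\mathcal{U}_{\mathrm{geom}}(V)\subset\mathcal{U}(V)$ is the set of forms in $\mathcal{U}(V)$ which are of type $(n,0)$ for some compatible complex structure. The group $\mathrm{GL}^+(2,\mathbb{R})$ acts on complex-valued forms through its action on $\mathbb{C}=\mathbb{R}^2$. $\mathcal{U}_{\mathrm{ag}}(V)\subset\mathcal{U}^+(V)$, the set of almost geometric forms, is the set of forms in the $\mathrm{GL}^+(2,\mathbb{R})$-orbit of $\mathcal{U}_{\mathrm{geom}}(V)$. An element $\Omega\in\mathcal{U}^+(V)$ is regarded as a constant differential form on $M=V/\Lambda$. A special Lagrangian submanifold is a Lagrangian submanifold $L\subset M$ such that $\mathrm{Arg}(\Omega|_L)=\phi$ for some constant $\phi\in\mathbb{R}/\pi\mathbb{Z}$. Set $$\mathrm{Sys}_\Omega(M):=\inf\left\{\int_L|\Omega| \;:\; L\subset M\text{ compact special Lagrangian}\right\},\qquad \mathrm{Vol}_\Omega(M):=\int_M(-1)^{\frac{n(n-1)}{2}}\left(\frac{i}{2}\right)^n\Omega\wedge\overline{\Omega},$$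 where $M$ is oriented by $\omega^n$. *)

theory Defs
  imports "HOL-Analysis.Analysis" "HOL-Library.Real_Mod"
begin

text \<open>
  The vector space \<open>V\<close> is a type \<open>'a::euclidean_space\<close>; its inner product is never used, only its
  structure of a finite-dimensional topological vector space.  Throughout, \<open>n\<close> is half of the
  dimension of \<open>V\<close>.
\<close>

section \<open>Exterior algebra\<close>

text \<open>
  A \<open>k\<close>-form takes a sequence of vectors and looks at its entries \<open>0, \<dots>, k - 1\<close> only; the first
  conjunct makes the representation unique.
\<close>

definition alternating_form :: "nat \<Rightarrow> ((nat \<Rightarrow> 'a::real_vector) \<Rightarrow> 'b::real_vector) \<Rightarrow> bool" where
  "alternating_form k \<alpha> \<longleftrightarrow>
     (\<forall>v w. (\<forall>i<k. v i = w i) \<longrightarrow> \<alpha> v = \<alpha> w) \<and>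
     (\<forall>v. \<forall>i<k. linear (\<lambda>x. \<alpha> (v(i := x)))) \<and>
     (\<forall>v. \<forall>i<k. \<forall>j<k. i \<noteq> j \<and> v i = v j \<longrightarrow> \<alpha> v = 0)"

text \<open>Normalised so that the wedge of \<open>k\<close> one-forms is the determinant of the pairings.\<close>

definition wedge ::
  "nat \<Rightarrow> nat \<Rightarrow> ((nat \<Rightarrow> 'a) \<Rightarrow> 'b::real_algebra_1) \<Rightarrow> ((nat \<Rightarrow> 'a) \<Rightarrow> 'b) \<Rightarrow> (nat \<Rightarrow> 'a) \<Rightarrow> 'b" where
  "wedge k l \<alpha> \<beta> v =
     (1 / (fact k * fact l)) *\<^sub>R
       (\<Sum>\<sigma> | \<sigma> permutes {..<k + l}.
          of_int (sign \<sigma>) * \<alpha> (\<lambda>i. v (\<sigma> i)) * \<beta> (\<lambda>i. v (\<sigma> (k + i))))"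

definition form_of_bilinear :: "('a \<Rightarrow> 'a \<Rightarrow> 'b) \<Rightarrow> (nat \<Rightarrow> 'a) \<Rightarrow> 'b" where
  "form_of_bilinear \<omega> v = \<omega> (v 0) (v 1)"

primrec wedge_power :: "nat \<Rightarrow> ('a \<Rightarrow> 'a \<Rightarrow> real) \<Rightarrow> (nat \<Rightarrow> 'a) \<Rightarrow> real" where
  "wedge_power 0 \<omega> = (\<lambda>v. 1)"
| "wedge_power (Suc k) \<omega> = wedge 2 (2 * k) (form_of_bilinear \<omega>) (wedge_power k \<omega>)"

section \<open>Linear symplectic geometry\<close>

definition symplectic_form :: "('a::euclidean_space \<Rightarrow> 'a \<Rightarrow> real) \<Rightarrow> bool" where
  "symplectic_form \<omega> \<longleftrightarrow>
     bilinear \<omega> \<and> (\<forall>v. \<omega> v v = 0) \<and> (\<forall>v. (\<forall>w. \<omega> v w = 0) \<longrightarrow> v = 0)"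

definition lagrangian_subspace :: "('a::euclidean_space \<Rightarrow> 'a \<Rightarrow> real) \<Rightarrow> 'a set \<Rightarrow> bool" where
  "lagrangian_subspace \<omega> L \<longleftrightarrow>
     subspace L \<and> 2 * dim L = DIM('a) \<and> (\<forall>v\<in>L. \<forall>w\<in>L. \<omega> v w = 0)"

definition primitive_forms ::
  "nat \<Rightarrow> ('a::euclidean_space \<Rightarrow> 'a \<Rightarrow> real) \<Rightarrow> ((nat \<Rightarrow> 'a) \<Rightarrow> real) set" where
  "primitive_forms n \<omega> =
     {\<alpha>. alternating_form n \<alpha> \<and> (\<forall>v. wedge n 2 \<alpha> (form_of_bilinear \<omega>) v = 0)}"

definition complex_primitive_forms ::
  "nat \<Rightarrow> ('a::euclidean_space \<Rightarrow> 'a \<Rightarrow> real) \<Rightarrow> ((nat \<Rightarrow> 'a) \<Rightarrow> complex) set" where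
  "complex_primitive_forms n \<omega> =
     {\<Omega>. (\<lambda>v. Re (\<Omega> v)) \<in> primitive_forms n \<omega> \<and> (\<lambda>v. Im (\<Omega> v)) \<in> primitive_forms n \<omega>}"

definition U_forms ::
  "nat \<Rightarrow> ('a::euclidean_space \<Rightarrow> 'a \<Rightarrow> real) \<Rightarrow> ((nat \<Rightarrow> 'a) \<Rightarrow> complex) set" where
  "U_forms n \<omega> =
     {\<Omega> \<in> complex_primitive_forms n \<omega>.
        \<forall>L. lagrangian_subspace \<omega> L \<longrightarrow> (\<exists>v. (\<forall>i<n. v i \<in> L) \<and> \<Omega> v \<noteq> 0)}"

text \<open>
  \<open>has_phase n \<Omega> L \<phi>\<close> says that the restriction of \<open>\<Omega>\<close> to the \<open>n\<close>-dimensional subspace \<open>L\<close> is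
  non-zero and that its argument, an element of \<open>\<real>/\<pi>\<int>\<close>, is the class of \<open>\<phi>\<close>.
\<close>

definition has_phase :: "nat \<Rightarrow> ((nat \<Rightarrow> 'a) \<Rightarrow> complex) \<Rightarrow> 'a set \<Rightarrow> real \<Rightarrow> bool" where
  "has_phase n \<Omega> L \<phi> \<longleftrightarrow>
     (\<exists>v. (\<forall>i<n. v i \<in> L) \<and> \<Omega> v \<noteq> 0) \<and>
     (\<forall>v. (\<forall>i<n. v i \<in> L) \<and> \<Omega> v \<noteq> 0 \<longrightarrow> [Arg (\<Omega> v) = \<phi>] (rmod pi))"

definition symplectic_basis ::
  "nat \<Rightarrow> ('a::euclidean_space \<Rightarrow> 'a \<Rightarrow> real) \<Rightarrow> (nat \<Rightarrow> 'a) \<Rightarrow> (nat \<Rightarrow> 'a) \<Rightarrow> bool" where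
  "symplectic_basis n \<omega> x y \<longleftrightarrow>
     (\<forall>j<n. \<forall>k<n. \<omega> (x j) (x k) = 0 \<and> \<omega> (y j) (y k) = 0 \<and>
        \<omega> (x j) (y k) = (if j = k then 1 else 0))"

text \<open>
  A symplectic basis is the same as a linear symplectomorphism from \<open>\<complex>\<^sup>n\<close> to \<open>V\<close>;
  this is the image of the Lagrangian \<open>e\<^sup>i\<^sup>\<theta>\<real> \<times> \<real>\<^sup>n\<^sup>-\<^sup>1\<close>.
\<close>

definition generator_loop ::
  "nat \<Rightarrow> (nat \<Rightarrow> 'a::euclidean_space) \<Rightarrow> (nat \<Rightarrow> 'a) \<Rightarrow> real \<Rightarrow> 'a set" where
  "generator_loop n x y \<theta> = span (insert (cos \<theta> *\<^sub>R x 0 + sin \<theta> *\<^sub>R y 0) (x ` {1..<n}))"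

text \<open>
  The loop \<open>\<theta> \<mapsto> \<phi>\<^sub>\<Omega>(L\<^sub>\<theta>)\<close>, \<open>0 \<le> \<theta> \<le> \<pi>\<close>, in \<open>\<real>/\<pi>\<int>\<close> represents the
  positive generator of the fundamental group iff a continuous lift \<open>f\<close> of it to \<open>\<real>\<close> increases by
  exactly \<open>\<pi>\<close>.  The symplectic group being connected, it does not matter which symplectic basis is
  used.
\<close>

definition U_plus ::
  "nat \<Rightarrow> ('a::euclidean_space \<Rightarrow> 'a \<Rightarrow> real) \<Rightarrow> ((nat \<Rightarrow> 'a) \<Rightarrow> complex) set" where
  "U_plus n \<omega> =
     {\<Omega> \<in> U_forms n \<omega>.
        \<exists>x y f. symplectic_basis n \<omega> x y \<and> continuous_on {0..pi} f \<and>
          (\<forall>\<theta>\<in>{0..pi}. has_phase n \<Omega> (generator_loop n x y \<theta>) (f \<theta>)) \<and>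
          f pi = f 0 + pi}"

definition compatible_complex_structure ::
  "('a::euclidean_space \<Rightarrow> 'a \<Rightarrow> real) \<Rightarrow> ('a \<Rightarrow> 'a) \<Rightarrow> bool" where
  "compatible_complex_structure \<omega> J \<longleftrightarrow>
     linear J \<and> (\<forall>v. J (J v) = - v) \<and> (\<forall>v w. \<omega> (J v) (J w) = \<omega> v w) \<and>
     (\<forall>v. v \<noteq> 0 \<longrightarrow> \<omega> v (J v) > 0)"

text \<open>
  An \<open>n\<close>-form has type \<open>(n, 0)\<close> iff (its complex multilinear extension) vanishes as soon as one
  argument is of type \<open>(0, 1)\<close>, i.e. equal to \<open>x + \<i> J x\<close> for some \<open>x\<close> in \<open>V\<close>.
\<close>

definition type_n_0 :: "nat \<Rightarrow> ('a \<Rightarrow> 'a) \<Rightarrow> ((nat \<Rightarrow> 'a) \<Rightarrow> complex) \<Rightarrow> bool" where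
  "type_n_0 n J \<Omega> \<longleftrightarrow> (\<forall>v x. \<forall>i<n. \<Omega> (v(i := x)) + \<i> * \<Omega> (v(i := J x)) = 0)"

definition U_geom ::
  "nat \<Rightarrow> ('a::euclidean_space \<Rightarrow> 'a \<Rightarrow> real) \<Rightarrow> ((nat \<Rightarrow> 'a) \<Rightarrow> complex) set" where
  "U_geom n \<omega> =
     {\<Omega> \<in> U_forms n \<omega>. \<exists>J. compatible_complex_structure \<omega> J \<and> type_n_0 n J \<Omega>}"

definition matrix_act :: "real^2^2 \<Rightarrow> complex \<Rightarrow> complex" where
  "matrix_act A z = Complex (A$1$1 * Re z + A$1$2 * Im z) (A$2$1 * Re z + A$2$2 * Im z)"

definition U_ag ::
  "nat \<Rightarrow> ('a::euclidean_space \<Rightarrow> 'a \<Rightarrow> real) \<Rightarrow> ((nat \<Rightarrow> 'a) \<Rightarrow> complex) set" where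
  "U_ag n \<omega> = {\<lambda>v. matrix_act A (\<Omega> v) | A \<Omega>. det A > 0 \<and> \<Omega> \<in> U_geom n \<omega>}"

section \<open>Lattices and tori\<close>

definition lattice_basis :: "'a::euclidean_space set \<Rightarrow> (nat \<Rightarrow> 'a) \<Rightarrow> bool" where
  "lattice_basis \<Lambda> b \<longleftrightarrow>
     inj_on b {..<DIM('a)} \<and> independent (b ` {..<DIM('a)}) \<and>
     \<Lambda> = range (\<lambda>c :: nat \<Rightarrow> int. \<Sum>i<DIM('a). of_int (c i) *\<^sub>R b i)"

definition is_lattice :: "'a::euclidean_space set \<Rightarrow> bool" where
  "is_lattice \<Lambda> \<longleftrightarrow> (\<exists>b. lattice_basis \<Lambda> b)"

definition rational_symplectic_torus ::
  "('a::euclidean_space \<Rightarrow> 'a \<Rightarrow> real) \<Rightarrow> 'a set \<Rightarrow> bool" where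
  "rational_symplectic_torus \<omega> \<Lambda> \<longleftrightarrow>
     symplectic_form \<omega> \<and> is_lattice \<Lambda> \<and> (\<forall>v\<in>\<Lambda>. \<forall>w\<in>\<Lambda>. \<omega> v w \<in> \<rat>)"

definition torus_proj :: "'a::euclidean_space set \<Rightarrow> 'a \<Rightarrow> 'a set" where
  "torus_proj \<Lambda> v = (\<lambda>l. v + l) ` \<Lambda>"

definition torus :: "'a::euclidean_space set \<Rightarrow> 'a set set" where
  "torus \<Lambda> = range (torus_proj \<Lambda>)"

definition torus_topology :: "'a::euclidean_space set \<Rightarrow> 'a set topology" where
  "torus_topology \<Lambda> = topology (\<lambda>U. U \<subseteq> torus \<Lambda> \<and> open (torus_proj \<Lambda> -` U))"

lemma openin_torus_topology:
  "openin (torus_topology \<Lambda>) U \<longleftrightarrow> U \<subseteq> torus \<Lambda> \<and> open (torus_proj \<Lambda> -` U)"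
proof -
  have "istopology (\<lambda>U. U \<subseteq> torus \<Lambda> \<and> open (torus_proj \<Lambda> -` U))"
    unfolding istopology_def by (auto simp: vimage_Int vimage_Union)
  then show ?thesis
    by (simp add: torus_topology_def topology_inverse')
qed

text \<open>
  The integral over \<open>V/\<Lambda>\<close>, oriented by \<open>\<omega>\<^sup>n\<close>, of a constant form \<open>\<eta>\<close> of top degree \<open>2n\<close>.  For a
  positively oriented basis \<open>b\<close> of \<open>\<Lambda>\<close> the map \<open>t \<mapsto> \<Sum>i. t\<^sub>i b\<^sub>i\<close> from the unit cube parametrises
  the torus and pulls \<open>\<eta>\<close> back to \<open>\<eta>(b\<^sub>0, \<dots>, b\<^sub>2\<^sub>n\<^sub>-\<^sub>1) dt\<close>, so the integral is this coefficient.
\<close>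

definition torus_integral ::
  "nat \<Rightarrow> ('a::euclidean_space \<Rightarrow> 'a \<Rightarrow> real) \<Rightarrow> 'a set \<Rightarrow> ((nat \<Rightarrow> 'a) \<Rightarrow> complex) \<Rightarrow> complex" where
  "torus_integral n \<omega> \<Lambda> \<eta> = \<eta> (SOME b. lattice_basis \<Lambda> b \<and> wedge_power n \<omega> b > 0)"

text \<open>The form integrated here is real-valued.\<close>

definition Vol ::
  "nat \<Rightarrow> ('a::euclidean_space \<Rightarrow> 'a \<Rightarrow> real) \<Rightarrow> 'a set \<Rightarrow> ((nat \<Rightarrow> 'a) \<Rightarrow> complex) \<Rightarrow> real" where
  "Vol n \<omega> \<Lambda> \<Omega> =
     Re (torus_integral n \<omega> \<Lambda>
           (\<lambda>v. (-1) ^ (n * (n - 1) div 2) * (\<i> / 2) ^ n * wedge n n \<Omega> (\<lambda>w. cnj (\<Omega> w)) v))"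

section \<open>Submanifolds\<close>

text \<open>\<open>C\<^sup>k\<close> functions on an open set.\<close>

primrec Ck_on :: "nat \<Rightarrow> ('b::real_normed_vector \<Rightarrow> 'c::real_normed_vector) \<Rightarrow> 'b set \<Rightarrow> bool" where
  "Ck_on 0 f U \<longleftrightarrow> continuous_on U f"
| "Ck_on (Suc k) f U \<longleftrightarrow>
     (\<forall>x\<in>U. f differentiable (at x)) \<and> (\<forall>h. Ck_on k (\<lambda>x. frechet_derivative f (at x) h) U)"

definition smooth_on :: "('b::real_normed_vector \<Rightarrow> 'c::real_normed_vector) \<Rightarrow> 'b set \<Rightarrow> bool" where
  "smooth_on f U \<longleftrightarrow> (\<forall>k. Ck_on k f U)"

definition local_parametrization ::
  "'a::euclidean_space set \<Rightarrow> (real^'n \<Rightarrow> 'a) \<Rightarrow> (real^'n) set \<Rightarrow> bool" where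
  "local_parametrization S \<psi> U \<longleftrightarrow>
     open U \<and> smooth_on \<psi> U \<and> (\<forall>x\<in>U. inj (frechet_derivative \<psi> (at x))) \<and>
     openin (top_of_set S) (\<psi> ` U) \<and> (\<exists>g. homeomorphism U (\<psi> ` U) \<psi> g)"

text \<open>
  Embedded submanifolds without boundary, of dimension \<open>CARD('n)\<close>.  The dimension is passed as a type
  because the parameter space is \<open>real^'n\<close>.
\<close>

definition embedded_submanifold :: "'n::finite itself \<Rightarrow> 'a::euclidean_space set \<Rightarrow> bool" where
  "embedded_submanifold _ S \<longleftrightarrow>
     (\<forall>p\<in>S. \<exists>(\<psi> :: real^'n \<Rightarrow> 'a) U. local_parametrization S \<psi> U \<and> p \<in> \<psi> ` U)"

definition tangent_space :: "'n::finite itself \<Rightarrow> 'a::euclidean_space set \<Rightarrow> 'a \<Rightarrow> 'a set" where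
  "tangent_space _ S p =
     {frechet_derivative \<psi> (at x) h | (\<psi> :: real^'n \<Rightarrow> 'a) U x h.
        local_parametrization S \<psi> U \<and> x \<in> U \<and> \<psi> x = p}"

text \<open>
  A subset \<open>L\<close> of \<open>V/\<Lambda>\<close> is a submanifold iff its preimage in \<open>V\<close> is, and the tangent spaces are the
  same, because the projection is a local diffeomorphism.  The empty set is excluded: otherwise every
  systole would be zero.
\<close>

definition compact_special_lagrangian ::
  "'n::finite itself \<Rightarrow> ('a::euclidean_space \<Rightarrow> 'a \<Rightarrow> real) \<Rightarrow> 'a set \<Rightarrow>
     ((nat \<Rightarrow> 'a) \<Rightarrow> complex) \<Rightarrow> 'a set set \<Rightarrow> bool" where
  "compact_special_lagrangian N \<omega> \<Lambda> \<Omega> L \<longleftrightarrow>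
     L \<noteq> {} \<and> L \<subseteq> torus \<Lambda> \<and> compactin (torus_topology \<Lambda>) L \<and>
     (let S = torus_proj \<Lambda> -` L in
        embedded_submanifold N S \<and>
        (\<forall>p\<in>S. lagrangian_subspace \<omega> (tangent_space N S p)) \<and>
        (\<exists>\<phi>. \<forall>p\<in>S. has_phase CARD('n) \<Omega> (tangent_space N S p) \<phi>))"

text \<open>
  The absolute value of \<open>\<Omega>\<close> evaluated on the coordinate vector fields of a parametrisation, i.e. the
  coefficient of the density \<open>|\<Omega>|\<close>; it does not depend on how the index type is enumerated.
\<close>

definition density_coeff ::
  "((nat \<Rightarrow> 'a::euclidean_space) \<Rightarrow> complex) \<Rightarrow> (real^'n \<Rightarrow> 'a) \<Rightarrow> real^'n \<Rightarrow> real" where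
  "density_coeff \<Omega> \<psi> x =
     cmod (\<Omega> (\<lambda>k. frechet_derivative \<psi> (at x) (axis (from_nat_into (UNIV :: 'n set) k) 1)))"

text \<open>
  A decomposition of the submanifold \<open>L\<close> of \<open>V/\<Lambda>\<close> into countably many disjoint pieces, the \<open>i\<close>-th
  of which is parametrised, bijectively, by the Borel set \<open>A i\<close>.
\<close>

definition parametrized_partition ::
  "'a::euclidean_space set \<Rightarrow> 'a set set \<Rightarrow>
     (nat \<Rightarrow> real^'n \<Rightarrow> 'a) \<Rightarrow> (nat \<Rightarrow> (real^'n) set) \<Rightarrow> bool" where
  "parametrized_partition \<Lambda> L \<psi> A \<longleftrightarrow>
     (\<forall>i. A i \<in> sets borel \<and> inj_on (\<lambda>x. torus_proj \<Lambda> (\<psi> i x)) (A i) \<and>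
        (\<exists>U. A i \<subseteq> U \<and> local_parametrization (torus_proj \<Lambda> -` L) (\<psi> i) U)) \<and>
     disjoint_family (\<lambda>i. (\<lambda>x. torus_proj \<Lambda> (\<psi> i x)) ` A i) \<and>
     (\<Union>i. (\<lambda>x. torus_proj \<Lambda> (\<psi> i x)) ` A i) = L"

text \<open>
  The integral of the density \<open>|\<Omega>|\<close> over \<open>L\<close>.  By the change of variables formula the sum is the same
  for all partitions, so the infimum merely picks the common value.
\<close>

definition density_integral ::
  "'n::finite itself \<Rightarrow> 'a::euclidean_space set \<Rightarrow> ((nat \<Rightarrow> 'a) \<Rightarrow> complex) \<Rightarrow> 'a set set \<Rightarrow> ennreal" where
  "density_integral _ \<Lambda> \<Omega> L =
     (INF (\<psi>, A) \<in> {(\<psi> :: nat \<Rightarrow> real^'n \<Rightarrow> 'a, A). parametrized_partition \<Lambda> L \<psi> A}.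
        \<Sum>i. \<integral>\<^sup>+ x \<in> A i. ennreal (density_coeff \<Omega> (\<psi> i) x) \<partial>lborel)"

definition Sys ::
  "'n::finite itself \<Rightarrow> ('a::euclidean_space \<Rightarrow> 'a \<Rightarrow> real) \<Rightarrow> 'a set \<Rightarrow> ((nat \<Rightarrow> 'a) \<Rightarrow> complex) \<Rightarrow> ereal" where
  "Sys N \<omega> \<Lambda> \<Omega> =
     (INF L \<in> {L. compact_special_lagrangian N \<omega> \<Lambda> \<Omega> L}. enn2ereal (density_integral N \<Lambda> \<Omega> L))"

end

theory Submission
  imports Defs
begin

text \<open>
  Write \<open>\<Omega> = A \<circ> \<Omega>\<^sub>0\<close> with \<open>A\<close> an invertible real \<open>2 \<times> 2\<close> matrix and \<open>\<Omega>\<^sub>0\<close> of type \<open>(n, 0)\<close> for a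
  compatible complex structure \<open>J\<close>, and let \<open>g = \<omega>(\<cdot>, J \<cdot>)\<close>.  A primitive isotropic sublattice of rank
  \<open>n\<close> with basis \<open>e\<close> spans a rational Lagrangian subspace, whose image in \<open>V/\<Lambda>\<close> is a special
  Lagrangian torus with \<open>\<integral> |\<Omega>| = |\<Omega>(e)|\<close> (\<open>Sys_squared_le\<close>).  The whole point is to find \<open>e\<close> with
  \<open>|\<Omega>(e)|\<^sup>2 \<le> C |det A| |c|\<^sup>2\<close>, where \<open>c\<close> is the value of \<open>\<Omega>\<^sub>0\<close> on a unitary frame, since
  \<open>|det A| |c|\<^sup>2\<close> is bounded by a multiple of the volume (\<open>Vol_lower_bound\<close>).

  Such a frame comes from reduction theory (\<open>short_lagrangian_frame_bound\<close>).  Choose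
  \<open>e\<^sub>0, e\<^sub>1, \<dots>\<close> greedily: \<open>e\<^sub>k\<close> is a lattice vector that is \<open>\<omega>\<close>-orthogonal to \<open>e\<^sub>0, \<dots>, e\<^sub>k\<^sub>-\<^sub>1\<close>, outside
  their span, and as close to that span as possible.  With \<open>h\<^sub>k\<close> the square of that distance, the
  classical argument of Hermite gives \<open>h\<^sub>k \<le> (4/3) h\<^sub>k\<^sub>+\<^sub>1\<close> (\<open>height_step\<close>).  The last step
  takes place in a two-dimensional symplectic quotient whose lattice has bounded area: there is a
  constant \<open>M\<close>, depending only on \<open>\<Lambda>\<close> and \<open>\<omega>\<close>, such that \<open>M\<close> times the \<open>\<omega>\<close>-dual basis of
  every basis of \<open>\<Lambda>\<close> lies in \<open>\<Lambda>\<close> (\<open>symplectic_dual_lattice_vectors\<close>, the only place where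
  rationality enters).  So all \<open>h\<^sub>k\<close> are bounded independently of \<open>J\<close> (\<open>height_bound\<close>).

  The matrix \<open>A\<close> may be far from conformal, so the last vector must be adapted to it.  With
  \<open>e\<^sub>0, \<dots>, e\<^sub>n\<^sub>-\<^sub>2\<close> fixed, \<open>v \<mapsto> \<Omega>(e\<^sub>0, \<dots>, e\<^sub>n\<^sub>-\<^sub>2, v)\<close> maps the lattice of the two-dimensional quotient to a
  lattice in \<open>\<complex>\<close> of area \<open>|det A| |c|\<^sup>2 h\<^sub>0 \<cdots> h\<^sub>n\<^sub>-\<^sub>2\<close> up to the constant \<open>M\<close>, and a shortest non-zero
  vector of a plane lattice is bounded by the square root of the area
  (\<open>planar_lattice_short_vector\<close>).

  For the volume write \<open>A z = a z + b z\<^sup>*\<close>.  Since \<open>\<Omega>\<^sub>0 \<and> \<Omega>\<^sub>0 = 0\<close>, the volume of \<open>\<Omega>\<close> is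
  \<open>|a|\<^sup>2 + (-1)\<^sup>n |b|\<^sup>2\<close> times that of \<open>\<Omega>\<^sub>0\<close>, while \<open>det A = |a|\<^sup>2 - |b|\<^sup>2\<close>.  This argument also covers
  negative determinants when \<open>n\<close> is even.  In dimension four that is enough: every form
  in \<open>\<U>(V)\<close> lies in the \<open>GL(2, \<real>)\<close>-orbit of a geometric one (\<open>U_forms_dim4_geometric\<close>), because the
  operators attached to primitive two-forms by \<open>\<omega>\<close> satisfy the Clifford relations and the complex
  structure can be recovered from the commutator of those of the real and imaginary part.

  That almost geometric forms lie in \<open>\<U>\<^sup>+(V)\<close> is seen on the loop \<open>e\<^sup>i\<^sup>\<theta>\<real> \<times> \<real>\<^sup>n\<^sup>-\<^sup>1\<close> of a unitary frame, on
  which \<open>\<Omega>\<close> takes the value \<open>a c e\<^sup>i\<^sup>\<theta> (1 + w)\<close> with \<open>|w| < 1\<close> (\<open>U_ag_subset_U_plus\<close>).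
\<close>

section \<open>Alternating forms and the wedge product\<close>

text \<open>
  The set \<open>S\<close> is a parameter because the wedge computations involve functions that are
  antisymmetric in some of their arguments only.
\<close>

lemma antisymmetric_permute:
  fixes f :: "(nat \<Rightarrow> 'a) \<Rightarrow> 'b::real_vector"
  assumes "finite S" and swap: "\<And>v a b. a \<in> S \<Longrightarrow> b \<in> S \<Longrightarrow> a \<noteq> b \<Longrightarrow> f (v \<circ> Transposition.transpose a b) = - f v"
    and "\<sigma> permutes S"
  shows "f (v \<circ> \<sigma>) = of_int (sign \<sigma>) *\<^sub>R f v"
  using \<open>finite S\<close> \<open>\<sigma> permutes S\<close>
proof (induction arbitrary: v rule: permutes_rev_induct)
  case id
  then show ?case by simp
next
  case (swap a b p)
  show ?case
  proof (cases "a = b")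
    case True
    then show ?thesis using swap.IH[of v] by (simp add: comp_def)
  next
    case False
    have "f (v \<circ> (p \<circ> Transposition.transpose a b)) = - f (v \<circ> p)"
      using assms(2)[OF swap.hyps(1,2) False, of "v \<circ> p"] by (simp add: comp_assoc)
    also have "\<dots> = - (of_int (sign p) *\<^sub>R f v)"
      by (simp only: swap.IH)
    moreover have "sign (p \<circ> Transposition.transpose a b) = - sign p"
      using False permutes_imp_permutation[OF \<open>finite S\<close> swap.hyps(4)]
      by (simp add: sign_compose sign_swap_id permutation_swap_id)
    ultimately show ?thesis by (simp only:) simp
  qed
qed

lemma alternating_formD:
  assumes "alternating_form k \<alpha>"
  shows alternating_form_cong: "\<And>v w. (\<And>i. i < k \<Longrightarrow> v i = w i) \<Longrightarrow> \<alpha> v = \<alpha> w"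
    and alternating_form_linear: "\<And>v i. i < k \<Longrightarrow> linear (\<lambda>x. \<alpha> (v(i := x)))"
    and alternating_form_repeat: "\<And>v i j. i < k \<Longrightarrow> j < k \<Longrightarrow> i \<noteq> j \<Longrightarrow> v i = v j \<Longrightarrow> \<alpha> v = 0"
proof -
  have 1: "\<forall>v w. (\<forall>i<k. v i = w i) \<longrightarrow> \<alpha> v = \<alpha> w"
    and 2: "\<forall>v. \<forall>i<k. linear (\<lambda>x. \<alpha> (v(i := x)))"
    and 3: "\<forall>v. \<forall>i<k. \<forall>j<k. i \<noteq> j \<and> v i = v j \<longrightarrow> \<alpha> v = 0"
    using assms unfolding alternating_form_def by - (erule conjE, (erule conjE)?, assumption)+
  show "\<And>v w. (\<And>i. i < k \<Longrightarrow> v i = w i) \<Longrightarrow> \<alpha> v = \<alpha> w" using 1 by simp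
  show "\<And>v i. i < k \<Longrightarrow> linear (\<lambda>x. \<alpha> (v(i := x)))" using 2 by simp
  show "\<And>v i j. i < k \<Longrightarrow> j < k \<Longrightarrow> i \<noteq> j \<Longrightarrow> v i = v j \<Longrightarrow> \<alpha> v = 0" using 3 by simp
qed

lemma alternating_form_transpose:
  assumes \<alpha>: "alternating_form k \<alpha>" and ij: "i < k" "j < k" "i \<noteq> j"
  shows "\<alpha> (v \<circ> Transposition.transpose i j) = - \<alpha> v"
proof -
  let ?F = "\<lambda>x y. \<alpha> (v(i := x, j := y))"
  have lin_i: "linear (\<lambda>x. ?F x y)" for y
    using alternating_form_linear[OF \<alpha> ij(1), of "v(j := y)"] ij by (simp add: fun_upd_twist)
  have lin_j: "linear (\<lambda>y. ?F x y)" for x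
    using alternating_form_linear[OF \<alpha> ij(2), of "v(i := x)"] by simp
  have diag: "?F x x = 0" for x
    using alternating_form_repeat[OF \<alpha> ij, of "v(i := x, j := x)"] ij by simp
  have "?F (v i) (v j) + ?F (v j) (v i) = ?F (v i + v j) (v i + v j)"
    using linear_add[OF lin_i[of "v i + v j"], of "v i" "v j"]
      linear_add[OF lin_j[of "v i"], of "v i" "v j"] linear_add[OF lin_j[of "v j"], of "v i" "v j"]
    by (simp only: diag add_0_left add_0_right)
  also have "\<dots> = 0" by (rule diag)
  finally have "?F (v j) (v i) = - ?F (v i) (v j)"
    by (metis add_eq_0_iff)
  moreover have "?F (v i) (v j) = \<alpha> v"
    by (rule arg_cong[of _ _ \<alpha>]) auto
  moreover have "?F (v j) (v i) = \<alpha> (v \<circ> Transposition.transpose i j)"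
    by (rule arg_cong[of _ _ \<alpha>]) (use ij in \<open>auto simp: Transposition.transpose_def\<close>)
  ultimately show ?thesis by simp
qed

lemma alternating_form_permute:
  assumes "alternating_form k \<alpha>" and "\<sigma> permutes {..<k}"
  shows "\<alpha> (v \<circ> \<sigma>) = of_int (sign \<sigma>) *\<^sub>R \<alpha> v"
  by (rule antisymmetric_permute[OF _ _ assms(2)]) (use alternating_form_transpose[OF assms(1)] in \<open>simp_all only: finite_lessThan lessThan_iff\<close>)

text \<open>
  By multilinearity the arguments can be replaced, one position at a time, by entries of \<open>u\<close>; on
  such a tuple the form is zero because of a repetition, or equal to \<open>\<plusminus> \<alpha> u\<close>.
\<close>

lemma alternating_form_eq_0_on_span:
  assumes \<alpha>: "alternating_form k \<alpha>" and u: "\<alpha> u = 0"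
    and v: "\<And>i. i < k \<Longrightarrow> v i \<in> span (u ` {..<k})"
  shows "\<alpha> v = 0"
proof -
  have "\<alpha> v = 0" if "\<And>i. i < k \<Longrightarrow> v i \<in> span (u ` {..<k})"
      and "\<And>i. m \<le> i \<Longrightarrow> i < k \<Longrightarrow> v i \<in> u ` {..<k}" for m v
    using that
  proof (induction m arbitrary: v)
    case 0
    then have "\<forall>i\<in>{..<k}. \<exists>t. t < k \<and> v i = u t" by auto
    then obtain t where t: "\<And>i. i < k \<Longrightarrow> t i < k \<and> v i = u (t i)"
      by (auto dest!: bchoice)
    show ?case
    proof (cases "inj_on t {..<k}")
      case True
      define \<tau> where "\<tau> i = (if i < k then t i else i)" for i
      have "inj_on \<tau> {..<k}" using True by (auto simp: \<tau>_def inj_on_def)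
      moreover have "\<tau> ` {..<k} \<subseteq> {..<k}" using t by (auto simp: \<tau>_def)
      ultimately have "bij_betw \<tau> {..<k} {..<k}"
        by (simp add: bij_betw_def endo_inj_surj)
      then have "\<tau> permutes {..<k}"
        by (rule bij_imp_permutes) (simp add: \<tau>_def)
      then have "\<alpha> (u \<circ> \<tau>) = 0"
        using alternating_form_permute[OF \<alpha>] u by simp
      moreover have "\<alpha> v = \<alpha> (u \<circ> \<tau>)"
        by (rule alternating_form_cong[OF \<alpha>]) (simp add: \<tau>_def t)
      ultimately show ?thesis by simp
    next
      case False
      then obtain i j where "i < k" "j < k" "i \<noteq> j" "t i = t j" by (auto simp: inj_on_def)
      then show ?thesis using alternating_form_repeat[OF \<alpha>, of i j v] t by simp
    qed
  next
    case (Suc m)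
    show ?case
    proof (cases "m < k")
      case False
      then show ?thesis using Suc.IH[of v] Suc.prems by auto
    next
      case True
      have "\<alpha> (v(m := x)) = 0" if "x \<in> u ` {..<k}" for x
        by (rule Suc.IH) (use that Suc.prems in \<open>auto simp: span_base\<close>)
      then have "\<alpha> (v(m := x)) = 0" if "x \<in> span (u ` {..<k})" for x
        using linear_eq_0_on_span[OF alternating_form_linear[OF \<alpha> True]] that by blast
      from this[of "v m"] show ?thesis using Suc.prems(1)[OF True] by simp
    qed
  qed
  from this[of v k] show ?thesis using v by auto
qed

lemma alternating_form_compose_linear:
  assumes \<alpha>: "alternating_form k \<alpha>" and f: "linear f"
  shows "alternating_form k (\<lambda>v. f (\<alpha> v))"
  unfolding alternating_form_def
proof (intro conjI allI impI)
  fix v w :: "nat \<Rightarrow> 'a" assume "\<forall>i<k. v i = w i"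
  then show "f (\<alpha> v) = f (\<alpha> w)" using alternating_form_cong[OF \<alpha>, of v w] by simp
next
  fix v :: "nat \<Rightarrow> 'a" and i assume "i < k"
  from linear_compose[OF alternating_form_linear[OF \<alpha> this] f]
  show "linear (\<lambda>x. f (\<alpha> (v(i := x))))" by (simp add: o_def)
next
  fix v :: "nat \<Rightarrow> 'a" and i j assume "i < k" "j < k" "i \<noteq> j \<and> v i = v j"
  then show "f (\<alpha> v) = 0" using alternating_form_repeat[OF \<alpha>, of i j v] linear_0[OF f] by simp
qed

text \<open>
  The imaginary part of \<open>\<Omega> v * cnj (\<Omega> u)\<close> is an alternating form in \<open>v\<close> which vanishes at \<open>u\<close>.  This is
  why the restriction of a form to an \<open>n\<close>-dimensional subspace has a phase modulo \<open>\<pi>\<close>.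
\<close>

lemma alternating_form_real_ratio:
  fixes \<Omega> :: "(nat \<Rightarrow> 'a::real_vector) \<Rightarrow> complex"
  assumes \<Omega>: "alternating_form k \<Omega>" and u: "\<Omega> u \<noteq> 0"
    and v: "\<And>i. i < k \<Longrightarrow> v i \<in> span (u ` {..<k})"
  obtains r :: real where "\<Omega> v = of_real r * \<Omega> u"
proof -
  have "linear (\<lambda>z. Im (z * cnj (\<Omega> u)))"
    by (rule linearI) (simp_all add: algebra_simps)
  from alternating_form_compose_linear[OF \<Omega> this]
  have "alternating_form k (\<lambda>v. Im (\<Omega> v * cnj (\<Omega> u)))" .
  then have "Im (\<Omega> v * cnj (\<Omega> u)) = 0"
    by (rule alternating_form_eq_0_on_span[of k _ u]) (simp_all add: v)
  then have "\<Omega> v * cnj (\<Omega> u) = of_real (Re (\<Omega> v * cnj (\<Omega> u)))"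
    by (simp add: complex_eq_iff)
  then have "\<Omega> v * (\<Omega> u * cnj (\<Omega> u)) = of_real (Re (\<Omega> v * cnj (\<Omega> u))) * \<Omega> u"
    by (simp add: mult_ac)
  then have "\<Omega> v * of_real ((cmod (\<Omega> u))\<^sup>2) = of_real (Re (\<Omega> v * cnj (\<Omega> u))) * \<Omega> u"
    by (simp add: complex_mult_cnj cmod_power2)
  then have "\<Omega> v = of_real (Re (\<Omega> v * cnj (\<Omega> u)) / (cmod (\<Omega> u))\<^sup>2) * \<Omega> u"
    using u by (simp add: field_simps)
  then show thesis by (rule that)
qed



text \<open>
  Left multiplication by \<open>\<tau>\<close> is a bijection of the permutations over which the wedge sums.
\<close>

lemma wedge_permute:
  fixes \<alpha> \<beta> :: "(nat \<Rightarrow> 'a) \<Rightarrow> 'b::real_algebra_1"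
  assumes \<tau>: "\<tau> permutes {..<k + l}"
  shows "wedge k l \<alpha> \<beta> (v \<circ> \<tau>) = of_int (sign \<tau>) *\<^sub>R wedge k l \<alpha> \<beta> v"
proof -
  let ?S = "{\<sigma>. \<sigma> permutes {..<k + l}}"
  let ?t = "\<lambda>\<sigma>. of_int (sign \<sigma>) * \<alpha> (\<lambda>i. v (\<sigma> i)) * \<beta> (\<lambda>i. v (\<sigma> (k + i)))"
  let ?t' = "\<lambda>\<sigma>. of_int (sign \<sigma>) * \<alpha> (\<lambda>i. v (\<tau> (\<sigma> i))) * \<beta> (\<lambda>i. v (\<tau> (\<sigma> (k + i))))"
  have perm: "permutation \<sigma>" if "\<sigma> permutes {..<k + l}" for \<sigma>
    using that permutes_imp_permutation by blast
  have "(\<Sum>\<sigma>\<in>?S. ?t \<sigma>) = (\<Sum>\<sigma>\<in>?S. ?t (\<tau> \<circ> \<sigma>))"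
    by (rule setum_permutations_compose_left[OF \<tau>])
  also have "\<dots> = (\<Sum>\<sigma>\<in>?S. of_int (sign \<tau>) *\<^sub>R ?t' \<sigma>)"
    by (rule sum.cong)
      (simp_all add: sign_compose perm \<tau> mult.assoc, cases \<tau> rule: sign_cases, simp_all)
  finally have "(\<Sum>\<sigma>\<in>?S. ?t' \<sigma>) = of_int (sign \<tau>) *\<^sub>R (\<Sum>\<sigma>\<in>?S. ?t \<sigma>)"
    by (cases \<tau> rule: sign_cases) (simp_all add: sum_negf)
  then show ?thesis by (simp add: wedge_def scaleR_scaleR mult.commute)
qed


lemma linear_mult_both:
  fixes f :: "'a::real_vector \<Rightarrow> 'b::real_algebra_1"
  assumes "linear f"
  shows "linear (\<lambda>x. c * f x * d)"
  by (rule linearI) (simp_all add: linear_add[OF assms] linear_scale[OF assms] distrib_left distrib_right)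

lemma alternating_form_wedge:
  fixes \<alpha> \<beta> :: "(nat \<Rightarrow> 'a::real_vector) \<Rightarrow> 'b::{real_algebra_1}"
  assumes \<alpha>: "alternating_form k \<alpha>" and \<beta>: "alternating_form l \<beta>"
  shows "alternating_form (k + l) (wedge k l \<alpha> \<beta>)"
  unfolding alternating_form_def
proof (intro conjI allI impI)
  fix v w :: "nat \<Rightarrow> 'a" assume vw: "\<forall>i<k + l. v i = w i"
  have "\<alpha> (\<lambda>i. v (\<sigma> i)) = \<alpha> (\<lambda>i. w (\<sigma> i)) \<and> \<beta> (\<lambda>i. v (\<sigma> (k + i))) = \<beta> (\<lambda>i. w (\<sigma> (k + i)))"
    if "\<sigma> permutes {..<k + l}" for \<sigma>
    using permutes_in_image[OF that] vw
    by (intro conjI alternating_form_cong[OF \<alpha>] alternating_form_cong[OF \<beta>]) auto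
  then show "wedge k l \<alpha> \<beta> v = wedge k l \<alpha> \<beta> w"
    unfolding wedge_def by (intro arg_cong[of _ _ "scaleR _"] sum.cong refl) simp
next
  fix v :: "nat \<Rightarrow> 'a" and i assume i: "i < k + l"
  have "linear (\<lambda>x. of_int (sign \<sigma>) * \<alpha> (\<lambda>j. (v(i := x)) (\<sigma> j)) * \<beta> (\<lambda>j. (v(i := x)) (\<sigma> (k + j))))"
    if \<sigma>: "\<sigma> permutes {..<k + l}" for \<sigma>
  proof -
    define m where "m = inv \<sigma> i"
    have m: "m < k + l" "\<sigma> m = i"
      using permutes_in_image[OF permutes_inv[OF \<sigma>], of i] i permutes_inverses(1)[OF \<sigma>]
      by (auto simp: m_def)
    have upd: "(v(i := x)) (\<sigma> j) = (if j = m then x else v (\<sigma> j))" for x j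
      using permutes_inj[OF \<sigma>] m by (auto dest: injD)
    show ?thesis
    proof (cases "m < k")
      case True
      have "(\<lambda>j. (v(i := x)) (\<sigma> j)) = (\<lambda>j. v (\<sigma> j))(m := x)" for x
        using upd by auto
      moreover have "\<beta> (\<lambda>j. (v(i := x)) (\<sigma> (k + j))) = \<beta> (\<lambda>j. v (\<sigma> (k + j)))" for x
        by (rule alternating_form_cong[OF \<beta>]) (use True upd in auto)
      ultimately show ?thesis
        using alternating_form_linear[OF \<alpha> True, of "\<lambda>j. v (\<sigma> j)"]
        by (simp only: linear_mult_both)
    next
      case False
      have "\<alpha> (\<lambda>j. (v(i := x)) (\<sigma> j)) = \<alpha> (\<lambda>j. v (\<sigma> j))" for x
        by (rule alternating_form_cong[OF \<alpha>]) (use False upd in auto)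
      moreover have "(\<lambda>j. (v(i := x)) (\<sigma> (k + j))) = (\<lambda>j. v (\<sigma> (k + j)))(m - k := x)" for x
        using upd False by (auto simp: fun_eq_iff)
      moreover have "m - k < l" using m False by simp
      ultimately show ?thesis
        using linear_mult_both[OF alternating_form_linear[OF \<beta> \<open>m - k < l\<close>, of "\<lambda>j. v (\<sigma> (k + j))"],
            of "of_int (sign \<sigma>) * \<alpha> (\<lambda>j. v (\<sigma> j))" 1]
        by simp
    qed
  qed
  then have "linear (\<lambda>x. \<Sum>\<sigma> | \<sigma> permutes {..<k + l}.
      of_int (sign \<sigma>) * \<alpha> (\<lambda>j. (v(i := x)) (\<sigma> j)) * \<beta> (\<lambda>j. (v(i := x)) (\<sigma> (k + j))))"
    by (intro linear_compose_sum) auto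
  from linear_compose_scale_right[OF this]
  show "linear (\<lambda>x. wedge k l \<alpha> \<beta> (v(i := x)))"
    unfolding wedge_def .
next
  fix v :: "nat \<Rightarrow> 'a" and i j assume "i < k + l" "j < k + l" "i \<noteq> j \<and> v i = v j"
  then have "wedge k l \<alpha> \<beta> (v \<circ> Transposition.transpose i j) = - wedge k l \<alpha> \<beta> v"
    using wedge_permute[of "Transposition.transpose i j" k l \<alpha> \<beta> v]
    by (simp add: permutes_swap_id sign_swap_id)
  moreover have "v \<circ> Transposition.transpose i j = v"
    using \<open>i \<noteq> j \<and> v i = v j\<close> by (auto simp: fun_eq_iff Transposition.transpose_def)
  ultimately have "wedge k l \<alpha> \<beta> v = - wedge k l \<alpha> \<beta> v" by simp
  then have "(2::real) *\<^sub>R wedge k l \<alpha> \<beta> v = 0"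
    by (simp add: scaleR_2 eq_neg_iff_add_eq_0)
  then show "wedge k l \<alpha> \<beta> v = 0" by simp
qed


lemma alternating_form_of_bilinear:
  assumes "bilinear \<omega>" "\<And>v. \<omega> v v = 0"
  shows "alternating_form 2 (form_of_bilinear \<omega>)"
  unfolding alternating_form_def form_of_bilinear_def
proof (intro conjI allI impI)
  fix v and i :: nat assume "i < 2"
  then have "i = 0 \<or> i = 1" by auto
  then show "linear (\<lambda>x. \<omega> ((v(i := x)) 0) ((v(i := x)) 1))"
    using assms(1) by (auto simp: bilinear_def)
qed (auto simp: less_2_cases_iff assms(2))

lemma alternating_form_wedge_power:
  assumes "bilinear \<omega>" "\<And>v. \<omega> v v = 0"
  shows "alternating_form (2 * k) (wedge_power k \<omega>)"
proof (induction k)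
  case 0
  show ?case by (simp add: alternating_form_def)
next
  case (Suc k)
  show ?case
    using alternating_form_wedge[OF alternating_form_of_bilinear[OF assms] Suc] by simp
qed

text \<open>
  The combination \<open>\<eta> * \<theta> u - \<eta> u * \<theta>\<close> is an alternating form which vanishes at \<open>u\<close>.
\<close>

lemma top_forms_proportional:
  fixes \<eta> :: "(nat \<Rightarrow> 'a::real_vector) \<Rightarrow> complex" and \<theta> :: "(nat \<Rightarrow> 'a) \<Rightarrow> real"
  assumes \<eta>: "alternating_form k \<eta>" and \<theta>: "alternating_form k \<theta>"
    and v: "\<And>i. i < k \<Longrightarrow> v i \<in> span (u ` {..<k})"
  shows "\<eta> v * of_real (\<theta> u) = \<eta> u * of_real (\<theta> v)"
proof -
  let ?D = "\<lambda>v. \<eta> v * of_real (\<theta> u) - \<eta> u * of_real (\<theta> v)"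
  have "alternating_form k ?D"
    unfolding alternating_form_def
  proof (intro conjI allI impI)
    fix v :: "nat \<Rightarrow> 'a" and i assume "i < k"
    show "linear (\<lambda>x. ?D (v(i := x)))"
      using alternating_form_linear[OF \<eta> \<open>i < k\<close>, of v] alternating_form_linear[OF \<theta> \<open>i < k\<close>, of v]
      by (simp add: linear_iff algebra_simps) (simp add: scaleR_conv_of_real algebra_simps)
  next
    fix v w :: "nat \<Rightarrow> 'a" assume "\<forall>i<k. v i = w i"
    then show "?D v = ?D w"
      using alternating_form_cong[OF \<eta>, of v w] alternating_form_cong[OF \<theta>, of v w] by simp
  next
    fix v :: "nat \<Rightarrow> 'a" and i j assume "i < k" "j < k" "i \<noteq> j \<and> v i = v j"
    then show "?D v = 0"
      using alternating_form_repeat[OF \<eta>, of i j v] alternating_form_repeat[OF \<theta>, of i j v] by simp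
  qed
  then have "?D v = 0"
    by (rule alternating_form_eq_0_on_span[of k _ u]) (simp_all add: v)
  then show ?thesis by simp
qed

lemma alternating_form_complexI:
  fixes \<Omega> :: "(nat \<Rightarrow> 'a::real_vector) \<Rightarrow> complex"
  assumes re: "alternating_form k (\<lambda>v. Re (\<Omega> v))" and im: "alternating_form k (\<lambda>v. Im (\<Omega> v))"
  shows "alternating_form k \<Omega>"
  unfolding alternating_form_def
proof (intro conjI allI impI)
  fix v w :: "nat \<Rightarrow> 'a" assume "\<forall>i<k. v i = w i"
  then show "\<Omega> v = \<Omega> w"
    using alternating_form_cong[OF re, of v w] alternating_form_cong[OF im, of v w]
    by (simp add: complex_eq_iff)
next
  fix v :: "nat \<Rightarrow> 'a" and i assume "i < k"
  then show "linear (\<lambda>x. \<Omega> (v(i := x)))"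
    using alternating_form_linear[OF re, of i v] alternating_form_linear[OF im, of i v]
    unfolding linear_iff complex_eq_iff by simp
next
  fix v :: "nat \<Rightarrow> 'a" and i j assume "i < k" "j < k" "i \<noteq> j \<and> v i = v j"
  then show "\<Omega> v = 0"
    using alternating_form_repeat[OF re, of i j v] alternating_form_repeat[OF im, of i j v]
    by (simp add: complex_eq_iff)
qed

section \<open>Lattices and primitive frames\<close>

lemma span_image_lessThan:
  fixes e :: "nat \<Rightarrow> 'a::real_vector"
  shows "x \<in> span (e ` {..<k}) \<longleftrightarrow> (\<exists>c. x = (\<Sum>j<k. c j *\<^sub>R e j))"
proof
  assume "x \<in> span (e ` {..<k})"
  then show "\<exists>c. x = (\<Sum>j<k. c j *\<^sub>R e j)"
  proof (induction k arbitrary: x)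
    case (Suc k)
    then obtain r where "x - r *\<^sub>R e k \<in> span (e ` {..<k})"
      by (auto simp: lessThan_Suc span_insert)
    then obtain c where "x - r *\<^sub>R e k = (\<Sum>j<k. c j *\<^sub>R e j)"
      using Suc.IH by blast
    then have "x = (\<Sum>j<Suc k. (c(k := r)) j *\<^sub>R e j)"
      by (simp add: algebra_simps)
    then show ?case by blast
  qed simp
next
  assume "\<exists>c. x = (\<Sum>j<k. c j *\<^sub>R e j)"
  then show "x \<in> span (e ` {..<k})"
    by (auto intro!: span_sum span_scale intro: span_base)
qed

lemma triangular_independent:
  fixes e :: "nat \<Rightarrow> 'a::real_vector"
  assumes "\<And>j. j < k \<Longrightarrow> e j \<notin> span (e ` {..<j})"
  shows "inj_on e {..<k} \<and> independent (e ` {..<k})"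
  using assms
proof (induction k)
  case (Suc k)
  then have IH: "inj_on e {..<k}" "independent (e ` {..<k})" and new: "e k \<notin> span (e ` {..<k})"
    by auto
  have "e k \<notin> e ` {..<k}" using new by (metis span_base)
  then show ?case
    using IH new by (simp add: lessThan_Suc independent_insert)
qed (simp add: independent_empty)

text \<open>
  The point is determined by the values of the functionals, which are bounded integers.
\<close>

lemma finite_integral_points:
  fixes \<phi> :: "nat \<Rightarrow> 'a::euclidean_space \<Rightarrow> real"
  assumes lin: "\<And>i. i < m \<Longrightarrow> linear (\<phi> i)"
    and inj: "\<And>v. (\<And>i. i < m \<Longrightarrow> \<phi> i v = 0) \<Longrightarrow> v = 0"
  shows "finite {v. norm v \<le> r \<and> (\<forall>i<m. \<phi> i v \<in> \<int>)}" (is "finite ?S")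
proof -
  have "\<forall>i\<in>{..<m}. \<exists>B. \<forall>x. norm (\<phi> i x) \<le> B * norm x"
    using lin linear_bounded by blast
  then obtain B where B: "\<And>i x. i < m \<Longrightarrow> \<bar>\<phi> i x\<bar> \<le> B i * norm x"
    by (auto dest!: bchoice)
  let ?G = "\<lambda>v. restrict (\<lambda>i. \<phi> i v) {..<m}"
  have "\<bar>\<phi> i v\<bar> \<le> \<bar>B i\<bar> * r" if "i < m" "norm v \<le> r" for i v
  proof -
    have "B i * norm v \<le> \<bar>B i\<bar> * r" by (rule mult_mono) (use that(2) in auto)
    then show ?thesis using B[OF that(1), of v] by simp
  qed
  then have "?G ` ?S \<subseteq> PiE {..<m} (\<lambda>i. {k \<in> \<int>. \<bar>k\<bar> \<le> \<bar>B i\<bar> * r})"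
    by (intro image_subsetI) (simp add: restrict_PiE_iff)
  moreover have "finite (PiE {..<m} (\<lambda>i. {k \<in> \<int>. \<bar>k\<bar> \<le> \<bar>B i\<bar> * r}))"
    by (intro finite_PiE finite_lessThan finite_abs_int_segment)
  ultimately have "finite (?G ` ?S)" by (rule finite_subset)
  moreover have "inj_on ?G ?S"
  proof (rule inj_onI)
    fix v w assume "?G v = ?G w"
    then have "\<phi> i (v - w) = 0" if "i < m" for i
      using that by (simp add: linear_diff[OF lin] fun_eq_iff restrict_def) metis
    then show "v = w" using inj[of "v - w"] by simp
  qed
  ultimately show ?thesis by (rule finite_imageD)
qed

lemma lattice_basis_span: "lattice_basis \<Lambda> b \<Longrightarrow> span (b ` {..<DIM('a::euclidean_space)}) = (UNIV :: 'a set)"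
  unfolding lattice_basis_def
  by (metis card_image card_lessThan dim_UNIV independent_imp_finite dim_eq_full dim_eq_card_independent dim_span)

lemma lattice_basis_mem:
  fixes \<Lambda> :: "'a::euclidean_space set"
  assumes b: "lattice_basis \<Lambda> b" and "i < DIM('a)"
  shows "b i \<in> \<Lambda>"
proof -
  have "\<Lambda> = range (\<lambda>c :: nat \<Rightarrow> int. \<Sum>i<DIM('a). of_int (c i) *\<^sub>R b i)"
    using b by (simp add: lattice_basis_def)
  moreover have "(\<Sum>j<DIM('a). of_int (if j = i then 1 else 0) *\<^sub>R b j) = b i"
  proof -
    have "(\<Sum>j<DIM('a). of_int (if j = i then 1 else 0) *\<^sub>R b j) = (\<Sum>j<DIM('a). if j = i then b j else 0)"
      by (rule sum.cong) auto
    then show ?thesis using assms(2) by simp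
  qed
  ultimately show ?thesis
    by (auto simp del: of_int_sum intro!: image_eqI[where x = "\<lambda>j. if j = i then 1 else 0"])
qed

lemma lattice_sum:
  assumes "is_lattice \<Lambda>" "\<And>j. j \<in> A \<Longrightarrow> x j \<in> \<Lambda>"
  shows "(\<Sum>j\<in>A. of_int (c j) *\<^sub>R x j) \<in> \<Lambda>"
proof -
  obtain b where \<Lambda>: "\<Lambda> = range (\<lambda>c :: nat \<Rightarrow> int. \<Sum>i<DIM('a). of_int (c i) *\<^sub>R b i)"
    using assms(1) by (auto simp: is_lattice_def lattice_basis_def)
  have "\<exists>d. \<forall>j\<in>A. x j = (\<Sum>i<DIM('a). of_int (d j i :: int) *\<^sub>R b i)"
    using assms(2) unfolding \<Lambda> image_iff by (intro bchoice) auto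
  then obtain d where d: "\<And>j. j \<in> A \<Longrightarrow> x j = (\<Sum>i<DIM('a). of_int (d j i :: int) *\<^sub>R b i)"
    by blast
  have "(\<Sum>j\<in>A. of_int (c j) *\<^sub>R x j) = (\<Sum>j\<in>A. \<Sum>i<DIM('a). of_int (c j * d j i) *\<^sub>R b i)"
    by (rule sum.cong) (simp_all add: d scaleR_sum_right)
  also have "\<dots> = (\<Sum>i<DIM('a). of_int (\<Sum>j\<in>A. c j * d j i) *\<^sub>R b i)"
    by (subst sum.swap) (simp add: scaleR_sum_left)
  finally show ?thesis
    unfolding \<Lambda> by (rule image_eqI[where x = "\<lambda>i. \<Sum>j\<in>A. c j * d j i"]) (rule UNIV_I)
qed

lemma lattice_closed:
  assumes "is_lattice \<Lambda>"
  shows lattice_0: "0 \<in> \<Lambda>"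
    and lattice_diff_scale: "\<And>x y r. x \<in> \<Lambda> \<Longrightarrow> y \<in> \<Lambda> \<Longrightarrow> x - of_int r *\<^sub>R y \<in> \<Lambda>"
    and lattice_add: "\<And>x y. x \<in> \<Lambda> \<Longrightarrow> y \<in> \<Lambda> \<Longrightarrow> x + y \<in> \<Lambda>"
    and lattice_diff: "\<And>x y. x \<in> \<Lambda> \<Longrightarrow> y \<in> \<Lambda> \<Longrightarrow> x - y \<in> \<Lambda>"
    and lattice_scale: "\<And>x r. x \<in> \<Lambda> \<Longrightarrow> of_int r *\<^sub>R x \<in> \<Lambda>"
proof -
  have *: "of_int p *\<^sub>R x + of_int q *\<^sub>R y \<in> \<Lambda>" if "x \<in> \<Lambda>" "y \<in> \<Lambda>" for p q x y
    using lattice_sum[OF assms, of "UNIV :: bool set" "\<lambda>t. if t then x else y" "\<lambda>t. if t then p else q"] that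
    by (simp add: UNIV_bool add.commute split: if_splits)
  show "0 \<in> \<Lambda>" using lattice_sum[OF assms, of "{}"] by simp
  show "x - of_int r *\<^sub>R y \<in> \<Lambda>" if "x \<in> \<Lambda>" "y \<in> \<Lambda>" for x y r
    using *[OF that, of 1 "-r"] by simp
  show "x + y \<in> \<Lambda>" if "x \<in> \<Lambda>" "y \<in> \<Lambda>" for x y
    using *[OF that, of 1 1] by simp
  show "x - y \<in> \<Lambda>" if "x \<in> \<Lambda>" "y \<in> \<Lambda>" for x y
    using *[OF that, of 1 "-1"] by simp
  show "of_int r *\<^sub>R x \<in> \<Lambda>" if "x \<in> \<Lambda>" for x r
    using *[OF that that, of r 0] by simp
qed

lemma coordinate_functionals:
  fixes e :: "nat \<Rightarrow> 'a::euclidean_space"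
  assumes "inj_on e {..<k}" "independent (e ` {..<k})"
  obtains \<xi> :: "nat \<Rightarrow> 'a \<Rightarrow> real"
  where "\<And>i. linear (\<xi> i)" "\<And>i j. j < k \<Longrightarrow> \<xi> i (e j) = (if j = i then 1 else 0)"
proof -
  have "\<exists>f. linear f \<and> (\<forall>j<k. f (e j) = (if j = i then 1 else 0 :: real))" for i
  proof -
    obtain f where "linear f" "\<forall>x\<in>e ` {..<k}. f x = (if the_inv_into {..<k} e x = i then 1 else 0 :: real)"
      using linear_independent_extend[OF assms(2), of "\<lambda>x. if the_inv_into {..<k} e x = i then 1 else 0"] by blast
    then show ?thesis
      by (intro exI[of _ f]) (auto simp: the_inv_into_f_f[OF assms(1)])
  qed
  then show thesis using that by metis
qed

lemma coordinate_functionals_expand: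
  fixes \<xi> :: "nat \<Rightarrow> 'a::euclidean_space \<Rightarrow> real"
  assumes lin: "\<And>i. linear (\<xi> i)" and dual: "\<And>i j. j < k \<Longrightarrow> \<xi> i (e j) = (if j = i then 1 else 0)"
    and x: "x \<in> span (e ` {..<k})"
  shows "x = (\<Sum>j<k. \<xi> j x *\<^sub>R e j)"
proof -
  obtain c where c: "x = (\<Sum>j<k. c j *\<^sub>R e j)"
    using x span_image_lessThan by blast
  have "\<xi> i x = c i" if "i < k" for i
    using that by (simp add: c linear_sum[OF lin] linear_scale[OF lin] dual if_distrib cong: if_cong)
  then have "(\<Sum>j<k. \<xi> j x *\<^sub>R e j) = (\<Sum>j<k. c j *\<^sub>R e j)"
    by (intro sum.cong) auto
  then show ?thesis using c by simp
qed

lemma finite_lattice_ball: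
  fixes \<Lambda> :: "'a::euclidean_space set"
  assumes "is_lattice \<Lambda>"
  shows "finite {v \<in> \<Lambda>. norm v \<le> r}"
proof -
  obtain b where b: "lattice_basis \<Lambda> b" using assms by (auto simp: is_lattice_def)
  then have \<Lambda>: "\<Lambda> = range (\<lambda>c :: nat \<Rightarrow> int. \<Sum>i<DIM('a). of_int (c i) *\<^sub>R b i)"
    and ind: "inj_on b {..<DIM('a)}" "independent (b ` {..<DIM('a)})"
    by (auto simp: lattice_basis_def)
  obtain \<xi> :: "nat \<Rightarrow> 'a \<Rightarrow> real" where
    \<xi>: "\<And>i. linear (\<xi> i)" "\<And>i j. j < DIM('a) \<Longrightarrow> \<xi> i (b j) = (if j = i then 1 else 0)"
    by (rule coordinate_functionals[OF ind]) (rule that)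
  have fin: "finite {v. norm v \<le> r \<and> (\<forall>i<DIM('a). \<xi> i v \<in> \<int>)}"
  proof (rule finite_integral_points)
    fix v assume "\<And>i. i < DIM('a) \<Longrightarrow> \<xi> i v = 0"
    then show "v = 0"
      using coordinate_functionals_expand[OF \<xi>, where x = v] lattice_basis_span[OF b] by simp
  qed (rule \<xi>)
  have coord: "\<xi> i v \<in> \<int>" if v: "v \<in> \<Lambda>" and i: "i < DIM('a)" for i v
  proof -
    obtain c :: "nat \<Rightarrow> int" where c: "v = (\<Sum>i<DIM('a). of_int (c i) *\<^sub>R b i)"
      using v \<Lambda> by blast
    have "\<xi> i v = of_int (c i)"
      using i by (simp add: c linear_sum[OF \<xi>(1)] linear_scale[OF \<xi>(1)] \<xi>(2) if_distrib cong: if_cong)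
    then show ?thesis by simp
  qed
  have sub: "{v \<in> \<Lambda>. norm v \<le> r} \<subseteq> {v. norm v \<le> r \<and> (\<forall>i<DIM('a). \<xi> i v \<in> \<int>)}"
    by (intro Collect_mono impI conjI allI) (simp_all add: coord)
  show ?thesis by (rule finite_subset[OF sub fin])
qed

text \<open>
  Says that \<open>e 0, \<dots>, e (k - 1)\<close> is a basis over the integers of the lattice points in its span.
  Linear independence is put in triangular form since frames are built one vector at a time.
\<close>

definition primitive_frame :: "'a::euclidean_space set \<Rightarrow> (nat \<Rightarrow> 'a) \<Rightarrow> nat \<Rightarrow> bool" where
  "primitive_frame \<Lambda> e k \<longleftrightarrow>
     (\<forall>j<k. e j \<in> \<Lambda> \<and> e j \<notin> span (e ` {..<j})) \<and>
     (\<forall>v\<in>\<Lambda> \<inter> span (e ` {..<k}). \<exists>c :: nat \<Rightarrow> int. v = (\<Sum>j<k. of_int (c j) *\<^sub>R e j))"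

definition seminorm :: "('a::real_vector \<Rightarrow> real) \<Rightarrow> bool" where
  "seminorm N \<longleftrightarrow> (\<forall>x y. N (x + y) \<le> N x + N y) \<and> (\<forall>r x. N (r *\<^sub>R x) = \<bar>r\<bar> * N x)"

lemma seminormD:
  assumes "seminorm N"
  shows "N (x + y) \<le> N x + N y" "N (r *\<^sub>R x) = \<bar>r\<bar> * N x" "N x \<ge> 0"
proof -
  show *: "N (x + y) \<le> N x + N y" "N (r *\<^sub>R x) = \<bar>r\<bar> * N x" for x y r
    using assms by (auto simp: seminorm_def)
  show "N x \<ge> 0" using *(1)[of x "-1 *\<^sub>R x"] *(2)[of "-1" x] *(2)[of 0 x] by simp
qed

text \<open>
  A seminorm is convex, hence continuous, and attains a positive minimum on the unit sphere.
\<close>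

lemma definite_seminorm_lower_bound:
  fixes N :: "'a::euclidean_space \<Rightarrow> real"
  assumes N: "seminorm N" and P: "subspace P" and def: "\<And>v. v \<in> P \<Longrightarrow> N v = 0 \<Longrightarrow> v = 0"
  obtains \<delta> where "\<delta> > 0" "\<And>v. v \<in> P \<Longrightarrow> \<delta> * norm v \<le> N v"
proof (cases "P \<inter> sphere 0 1 = {}")
  case True
  have "v = 0" if "v \<in> P" for v
    using True subspace_scale[OF P that, of "1 / norm v"] by (cases "v = 0") auto
  then show thesis using that[of 1] seminormD(3)[OF N] by fastforce
next
  case False
  have "convex_on UNIV N"
    by (intro convex_onI) (use seminormD[OF N] in \<open>auto intro: order.trans[OF seminormD(1)[OF N]]\<close>)
  then have cont: "continuous_on UNIV N" by (intro convex_on_continuous) auto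
  have "compact (P \<inter> sphere 0 1)"
    by (intro closed_Int_compact closed_subspace P compact_sphere)
  then obtain m where m: "m \<in> P \<inter> sphere 0 1" "\<And>v. v \<in> P \<inter> sphere 0 1 \<Longrightarrow> N m \<le> N v"
    using continuous_attains_inf[OF _ False continuous_on_subset[OF cont]] by blast
  have "N m > 0" using def[of m] m(1) seminormD(3)[OF N, of m] by (cases "N m = 0") auto
  moreover have "N m * norm v \<le> N v" if "v \<in> P" for v
  proof (cases "v = 0")
    case False
    have "N m \<le> N ((1 / norm v) *\<^sub>R v)"
      using False that by (intro m(2)) (auto intro: subspace_scale[OF P])
    then show ?thesis using False by (simp add: seminormD(2)[OF N] field_simps)
  qed (use seminormD(3)[OF N] in simp)
  ultimately show thesis by (rule that)
qed

text \<open>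
  The seminorm is a norm on the quotient of \<open>P\<close> by the span, but in \<open>P\<close> itself its balls contain
  infinitely many lattice points.  Subtracting integral combinations of the frame brings the component
  in the span, measured by some linear projection \<open>pr\<close>, into a bounded region; only finitely
  many candidates remain.
\<close>

lemma shortest_lattice_vector_modulo:
  fixes \<Lambda> :: "'a::euclidean_space set"
  assumes \<Lambda>: "is_lattice \<Lambda>" and e: "primitive_frame \<Lambda> e k" and P: "subspace P"
    and WP: "span (e ` {..<k}) \<subseteq> P" and N: "seminorm N"
    and ker: "\<And>v. v \<in> P \<Longrightarrow> N v = 0 \<longleftrightarrow> v \<in> span (e ` {..<k})"
    and ex: "\<exists>v\<in>\<Lambda> \<inter> P. v \<notin> span (e ` {..<k})"
  obtains x where "x \<in> \<Lambda> \<inter> P" "x \<notin> span (e ` {..<k})"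
    "\<And>v. v \<in> \<Lambda> \<inter> P \<Longrightarrow> v \<notin> span (e ` {..<k}) \<Longrightarrow> N x \<le> N v"
proof -
  define W where "W = span (e ` {..<k})"
  have W: "subspace W" and eW: "\<And>j. j < k \<Longrightarrow> e j \<in> W" by (auto simp: W_def span_base)
  obtain pr where pr: "linear pr" "\<And>v. pr v \<in> W" "\<And>v. v \<in> W \<Longrightarrow> pr v = v"
    using linear_exists_left_inverse_on[OF linear_id W] by (auto simp: image_subset_iff)
  have "seminorm (\<lambda>v. N v + norm (pr v))"
    unfolding seminorm_def
  proof (intro conjI allI)
    show "N (x + y) + norm (pr (x + y)) \<le> N x + norm (pr x) + (N y + norm (pr y))" for x y
      using seminormD(1)[OF N, of x y] norm_triangle_ineq[of "pr x" "pr y"]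
      by (simp add: linear_add[OF pr(1)])
    show "N (r *\<^sub>R x) + norm (pr (r *\<^sub>R x)) = \<bar>r\<bar> * (N x + norm (pr x))" for r x
      by (simp add: linear_scale[OF pr(1)] seminormD(2)[OF N] distrib_left)
  qed
  moreover have definite: "v = 0" if "v \<in> P" "N v + norm (pr v) = 0" for v
  proof -
    have "N v = 0" "pr v = 0" using that(2) seminormD(3)[OF N, of v] by (auto simp: add_nonneg_eq_0_iff)
    then show ?thesis using ker[OF that(1)] pr(3)[of v] by (auto simp: W_def)
  qed
  ultimately obtain \<delta> where \<delta>: "\<delta> > 0" "\<And>v. v \<in> P \<Longrightarrow> \<delta> * norm v \<le> N v + norm (pr v)"
    by (rule definite_seminorm_lower_bound[OF _ P]) (use that in \<open>assumption | blast\<close>)+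
  define B where "B = (\<Sum>j<k. norm (e j))"
  \<comment> \<open>\<open>B\<close> bounds the component in \<open>W\<close> once its coefficients are in the unit interval.\<close>
  have reduce: "\<exists>v'. v' \<in> \<Lambda> \<inter> P \<and> v' \<notin> W \<and> N v' \<le> N v \<and> norm v' \<le> (N v + B) / \<delta>"
    if v: "v \<in> \<Lambda> \<inter> P" "v \<notin> W" for v
  proof -
    obtain c where c: "pr v = (\<Sum>j<k. c j *\<^sub>R e j)"
      using pr(2)[of v] unfolding W_def span_image_lessThan by blast
    define w where "w = (\<Sum>j<k. of_int \<lfloor>c j\<rfloor> *\<^sub>R e j)"
    have w\<Lambda>: "w \<in> \<Lambda>"
      unfolding w_def by (rule lattice_sum[OF \<Lambda>]) (use e in \<open>auto simp: primitive_frame_def\<close>)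
    have wW: "w \<in> W" unfolding w_def by (intro subspace_sum[OF W] subspace_scale[OF W] eW) auto
    have "N w = 0" using ker[of w] WP wW by (auto simp: W_def)
    then have "N (-1 *\<^sub>R w) = 0" by (simp only: seminormD(2)[OF N] mult_zero_right)
    then have "N (v - w) \<le> N v"
      using seminormD(1)[OF N, of v "-1 *\<^sub>R w"] by simp
    moreover have "v - w \<in> \<Lambda> \<inter> P"
      using v w\<Lambda> wW WP by (auto simp: W_def intro: lattice_diff[OF \<Lambda>] subspace_diff[OF P])
    moreover have "v - w \<notin> W" using v wW subspace_add[OF W, of "v - w" w] by auto
    moreover have "norm (v - w) \<le> (N v + B) / \<delta>"
    proof -
      have "pr (v - w) = (\<Sum>j<k. frac (c j) *\<^sub>R e j)"
        by (simp add: linear_diff[OF pr(1)] pr(3)[OF wW] c)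
          (simp add: w_def frac_def scaleR_diff_left sum_subtractf)
      also have "norm \<dots> \<le> B"
        unfolding B_def
        by (intro order.trans[OF norm_sum] sum_mono)
          (simp add: frac_lt_1 less_imp_le mult_left_le_one_le)
      finally have "\<delta> * norm (v - w) \<le> N v + B"
        using \<delta>(2)[of "v - w"] \<open>v - w \<in> \<Lambda> \<inter> P\<close> \<open>N (v - w) \<le> N v\<close> by simp
      then show ?thesis using \<delta>(1) by (simp add: field_simps)
    qed
    ultimately show ?thesis by blast
  qed
  obtain v0 where v0: "v0 \<in> \<Lambda> \<inter> P" "v0 \<notin> W" using ex by (auto simp: W_def)
  define F where "F = {v \<in> \<Lambda> \<inter> P. v \<notin> W \<and> norm v \<le> (N v0 + B) / \<delta>}"
  have "finite F"
    by (rule finite_subset[OF _ finite_lattice_ball[OF \<Lambda>]]) (auto simp: F_def)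
  moreover have "F \<noteq> {}" using reduce[OF v0] by (auto simp: F_def)
  ultimately obtain x where "is_arg_min N (\<lambda>v. v \<in> F) x"
    using ex_is_arg_min_if_finite by blast
  then have x: "x \<in> F" "\<And>v. v \<in> F \<Longrightarrow> N x \<le> N v"
    by (auto simp: is_arg_min_linorder)
  show thesis
  proof (rule that)
    show "x \<in> \<Lambda> \<inter> P" "x \<notin> span (e ` {..<k})" using x(1) by (auto simp: F_def W_def)
    fix v assume "v \<in> \<Lambda> \<inter> P" "v \<notin> span (e ` {..<k})"
    then have v: "v \<in> \<Lambda> \<inter> P" "v \<notin> W" by (auto simp: W_def)
    obtain v0' where "v0' \<in> \<Lambda> \<inter> P" "v0' \<notin> W" "N v0' \<le> N v0" "norm v0' \<le> (N v0 + B) / \<delta>"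
      using reduce[OF v0] by blast
    then have "N x \<le> N v0" using x(2)[of v0'] by (simp add: F_def)
    obtain v' where v': "v' \<in> \<Lambda> \<inter> P" "v' \<notin> W" "N v' \<le> N v" "norm v' \<le> (N v + B) / \<delta>"
      using reduce[OF v] by blast
    show "N x \<le> N v"
    proof (cases "N v \<le> N v0")
      case True
      then have "(N v + B) / \<delta> \<le> (N v0 + B) / \<delta>" using \<delta>(1) by (intro divide_right_mono) auto
      then have "v' \<in> F" using v' by (simp add: F_def)
      then show ?thesis using x(2)[of v'] v'(3) by simp
    qed (use \<open>N x \<le> N v0\<close> in simp)
  qed
qed

text \<open>
  A lattice point \<open>w + t x\<close>, with \<open>w\<close> in the old span, can be moved to one with \<open>\<bar>t\<bar> \<le> 1/2\<close>; by
  minimality of \<open>x\<close> that one lies in the old span.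
\<close>

lemma primitive_frame_extend_shortest:
  fixes \<Lambda> :: "'a::euclidean_space set"
  assumes \<Lambda>: "is_lattice \<Lambda>" and e: "primitive_frame \<Lambda> e k" and P: "subspace P"
    and WP: "span (e ` {..<k}) \<subseteq> P" and N: "seminorm N"
    and ker: "\<And>v. v \<in> P \<Longrightarrow> N v = 0 \<longleftrightarrow> v \<in> span (e ` {..<k})"
    and x: "x \<in> \<Lambda> \<inter> P" "x \<notin> span (e ` {..<k})"
    and min: "\<And>v. v \<in> \<Lambda> \<inter> P \<Longrightarrow> v \<notin> span (e ` {..<k}) \<Longrightarrow> N x \<le> N v"
  shows "primitive_frame \<Lambda> (e(k := x)) (Suc k)"
proof -
  have img: "(e(k := x)) ` {..<j} = e ` {..<j}" if "j \<le> k" for j using that by auto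
  have "\<exists>c :: nat \<Rightarrow> int. v = (\<Sum>j<Suc k. of_int (c j) *\<^sub>R (e(k := x)) j)"
    if v: "v \<in> \<Lambda>" "v \<in> span ((e(k := x)) ` {..<Suc k})" for v
  proof -
    have "(e(k := x)) ` {..<Suc k} = insert x (e ` {..<k})" by (auto simp: lessThan_Suc)
    then obtain t where t: "v - t *\<^sub>R x \<in> span (e ` {..<k})"
      using v(2) by (auto simp: span_insert)
    let ?v = "v - of_int (round t) *\<^sub>R x"
    have v\<Lambda>: "?v \<in> \<Lambda>" using v x by (auto intro: lattice_diff_scale[OF \<Lambda>])
    have split: "?v = (v - t *\<^sub>R x) + (t - of_int (round t)) *\<^sub>R x" by (simp add: algebra_simps)
    have vP: "?v \<in> P"
      unfolding split using t WP x by (intro subspace_add[OF P] subspace_scale[OF P]) auto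
    have "?v \<in> span (e ` {..<k})"
    proof (rule ccontr)
      assume "?v \<notin> span (e ` {..<k})"
      then have "N x \<le> N ?v" using min v\<Lambda> vP by blast
      also have "\<dots> \<le> N (v - t *\<^sub>R x) + \<bar>t - of_int (round t)\<bar> * N x"
        unfolding split by (metis seminormD(1,2)[OF N])
      also have "N (v - t *\<^sub>R x) = 0" using ker[of "v - t *\<^sub>R x"] t WP by blast
      also have "\<bar>t - of_int (round t)\<bar> * N x \<le> (1 / 2) * N x"
        using of_int_round_abs_le[of t] seminormD(3)[OF N, of x]
        by (intro mult_right_mono) (auto simp: abs_minus_commute)
      finally have "N x = 0" using seminormD(3)[OF N, of x] by simp
      then show False using ker x by blast
    qed
    then obtain c :: "nat \<Rightarrow> int" where "?v = (\<Sum>j<k. of_int (c j) *\<^sub>R e j)"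
      using e v\<Lambda> unfolding primitive_frame_def by blast
    then have "v = (\<Sum>j<Suc k. of_int ((c(k := round t)) j) *\<^sub>R (e(k := x)) j)"
      by (simp add: algebra_simps)
    then show ?thesis by blast
  qed
  moreover have "(e(k := x)) j \<in> \<Lambda> \<and> (e(k := x)) j \<notin> span ((e(k := x)) ` {..<j})" if "j < Suc k" for j
  proof (cases "j = k")
    case True
    then show ?thesis using x img[of k] by simp
  next
    case False
    then show ?thesis using e that img[of j] by (simp add: primitive_frame_def)
  qed
  ultimately show ?thesis by (auto simp: primitive_frame_def simp del: sum.lessThan_Suc fun_upd_apply)
qed

lemma primitive_frame_independent:
  "primitive_frame \<Lambda> e k \<Longrightarrow> inj_on e {..<k} \<and> independent (e ` {..<k})"
  by (rule triangular_independent) (auto simp: primitive_frame_def)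

lemma primitive_frame_dim:
  "primitive_frame \<Lambda> e k \<Longrightarrow> dim (span (e ` {..<k})) = k"
  using primitive_frame_independent[of \<Lambda> e k]
  by (metis card_image card_lessThan dim_eq_card_independent dim_span)

text \<open>
  Adds vectors closest to the span of the previous ones.
\<close>

lemma primitive_frame_extends_to_basis:
  fixes \<Lambda> :: "'a::euclidean_space set"
  assumes \<Lambda>: "is_lattice \<Lambda>" and "primitive_frame \<Lambda> e k" "k \<le> DIM('a)"
  obtains e' where "\<And>j. j < k \<Longrightarrow> e' j = e j" "primitive_frame \<Lambda> e' DIM('a)"
proof -
  have "\<exists>e'. (\<forall>j<k. e' j = e j) \<and> primitive_frame \<Lambda> e' m" if "k \<le> m" "m \<le> DIM('a)" for m
    using that
  proof (induction m rule: dec_induct)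
    case base
    then show ?case using assms(2) by blast
  next
    case (step m)
    then obtain e' where e': "\<And>j. j < k \<Longrightarrow> e' j = e j" "primitive_frame \<Lambda> e' m" by auto
    define W where "W = span (e' ` {..<m})"
    have W: "subspace W" by (simp add: W_def)
    obtain pr where pr: "linear pr" "\<And>v. pr v \<in> W" "\<And>v. v \<in> W \<Longrightarrow> pr v = v"
      using linear_exists_left_inverse_on[OF linear_id W] by (auto simp: image_subset_iff)
    let ?N = "\<lambda>v. norm (v - pr v)"
    have N: "seminorm ?N"
      unfolding seminorm_def linear_add[OF pr(1)] linear_scale[OF pr(1)]
      by (auto simp flip: scaleR_diff_right simp: add_diff_add norm_triangle_ineq)
    have ker: "?N v = 0 \<longleftrightarrow> v \<in> span (e' ` {..<m})" for v
      using pr(2,3)[of v] by (auto simp: W_def)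
    have "\<exists>v\<in>\<Lambda> \<inter> UNIV. v \<notin> span (e' ` {..<m})"
    proof (rule ccontr)
      assume "\<not> ?thesis"
      then have sub: "\<Lambda> \<subseteq> W" by (auto simp: W_def)
      obtain b where b: "lattice_basis \<Lambda> b" using \<Lambda> by (auto simp: is_lattice_def)
      have "span (b ` {..<DIM('a)}) \<subseteq> W" 
        using sub lattice_basis_mem[OF b] by (intro span_minimal W) auto
      then have "W = UNIV" using lattice_basis_span[OF b] by auto
      then show False using primitive_frame_dim[OF e'(2)] step by (simp add: W_def dim_UNIV)
    qed
    then obtain x where x: "x \<in> \<Lambda> \<inter> UNIV" "x \<notin> span (e' ` {..<m})"
      "\<And>v. v \<in> \<Lambda> \<inter> UNIV \<Longrightarrow> v \<notin> span (e' ` {..<m}) \<Longrightarrow> ?N x \<le> ?N v"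
      by (rule shortest_lattice_vector_modulo[OF \<Lambda> e'(2) subspace_UNIV _ N ker, rotated]) auto
    have "primitive_frame \<Lambda> (e'(m := x)) (Suc m)"
      by (rule primitive_frame_extend_shortest[OF \<Lambda> e'(2) subspace_UNIV _ N ker x]) auto
    moreover have "\<forall>j<k. (e'(m := x)) j = e j" using e'(1) step by auto
    ultimately show ?case by blast
  qed
  from this[OF assms(3) order_refl] show thesis using that by blast
qed

lemma primitive_frame_full:
  fixes \<Lambda> :: "'a::euclidean_space set"
  assumes "primitive_frame \<Lambda> e DIM('a)"
  shows primitive_frame_span_UNIV: "span (e ` {..<DIM('a)}) = UNIV"
    and primitive_frame_combination: "v \<in> \<Lambda> \<Longrightarrow> \<exists>c :: nat \<Rightarrow> int. v = (\<Sum>j<DIM('a). of_int (c j) *\<^sub>R e j)"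
proof -
  show "span (e ` {..<DIM('a)}) = UNIV"
    using primitive_frame_dim[OF assms] by (metis dim_eq_full dim_span)
  then show "v \<in> \<Lambda> \<Longrightarrow> \<exists>c :: nat \<Rightarrow> int. v = (\<Sum>j<DIM('a). of_int (c j) *\<^sub>R e j)"
    using assms unfolding primitive_frame_def by blast
qed


lemma common_denominator:
  fixes S :: "real set"
  assumes "finite S" "S \<subseteq> \<rat>"
  shows "\<exists>d::nat. d > 0 \<and> (\<forall>q\<in>S. of_nat d * q \<in> \<int>)"
  using assms
proof (induction S rule: finite_induct)
  case (insert q S)
  then obtain d :: nat where d: "d > 0" "\<forall>q\<in>S. of_nat d * q \<in> \<int>" by auto
  obtain a b :: int where ab: "b > 0" "q = of_int a / of_int b"
    using insert.prems by (auto elim: Rats_cases')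
  have "of_nat (d * nat b) * x \<in> \<int>" if "x \<in> S" for x
  proof -
    have "of_nat (d * nat b) * x = of_int b * (of_nat d * x)" using ab(1) by simp
    then show ?thesis using d(2) that by (metis Ints_mult Ints_of_int)
  qed
  moreover have "of_nat (d * nat b) * q = (of_nat d * of_int a :: real)"
    using ab by simp
  ultimately have "\<forall>x\<in>insert q S. of_nat (d * nat b) * x \<in> \<int>"
    by (metis Ints_mult Ints_of_nat Ints_of_int insert_iff)
  moreover have "d * nat b > 0" using d(1) ab(1) by simp
  ultimately show ?case by blast
qed auto

lemma symplectic_formD:
  assumes "symplectic_form \<omega>"
  shows symplectic_linear: "linear (\<omega> v)" "linear (\<lambda>w. \<omega> w v)"
    and symplectic_self: "\<omega> v v = 0"
    and symplectic_nondegenerate: "(\<And>w. \<omega> v w = 0) \<Longrightarrow> v = 0"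
    and symplectic_flip: "\<omega> v w = - \<omega> w v"
proof -
  have \<omega>: "bilinear \<omega>" "\<And>v. \<omega> v v = 0" using assms by (auto simp: symplectic_form_def)
  show "linear (\<omega> v)" "linear (\<lambda>w. \<omega> w v)" "\<omega> v v = 0" using \<omega> by (auto simp: bilinear_def)
  show "(\<And>w. \<omega> v w = 0) \<Longrightarrow> v = 0" using assms by (auto simp: symplectic_form_def)
  show "\<omega> v w = - \<omega> w v"
  proof -
    have "\<omega> (v + w) (v + w) = (\<omega> v v + \<omega> v w) + (\<omega> w v + \<omega> w w)"
      by (simp only: bilinear_ladd[OF \<omega>(1)] bilinear_radd[OF \<omega>(1)])
    then show ?thesis using \<omega>(2)[of "v + w"] \<omega>(2)[of v] \<omega>(2)[of w] by linarith
  qed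
qed

text \<open>
  The map \<open>T\<close> that turns \<open>\<omega> x d\<close> into the inner product of \<open>x\<close> and \<open>T d\<close> is injective, hence
  surjective.
\<close>

lemma symplectic_dual_vector:
  fixes \<omega> :: "'a::euclidean_space \<Rightarrow> 'a \<Rightarrow> real"
  assumes \<omega>: "symplectic_form \<omega>" and \<xi>: "linear (\<xi> :: 'a \<Rightarrow> real)"
  obtains d where "\<And>x. \<omega> x d = \<xi> x"
proof -
  define T where "T d = (\<Sum>b\<in>Basis. \<omega> b d *\<^sub>R b)" for d
  have rep: "f x = x \<bullet> (\<Sum>b\<in>Basis. f b *\<^sub>R b)" if "linear f" for f :: "'a \<Rightarrow> real" and x
  proof -
    have "f x = f (\<Sum>b\<in>Basis. (x \<bullet> b) *\<^sub>R b)" by (simp add: euclidean_representation)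
    also have "\<dots> = (\<Sum>b\<in>Basis. (x \<bullet> b) * f b)"
      by (simp add: linear_sum[OF that] linear_scale[OF that])
    finally show ?thesis by (simp add: inner_sum_right mult.commute)
  qed
  have T: "\<omega> x d = x \<bullet> T d" for x d
    unfolding T_def by (rule rep[OF symplectic_linear(2)[OF \<omega>]])
  have "linear T"
    by (rule linearI)
      (simp_all add: T_def linear_add[OF symplectic_linear(1)[OF \<omega>]]
        linear_scale[OF symplectic_linear(1)[OF \<omega>]] scaleR_add_left sum.distrib scaleR_sum_right)
  moreover have "inj T"
  proof -
    have "d = 0" if "T d = 0" for d
    proof (rule symplectic_nondegenerate[OF \<omega>])
      show "\<omega> d w = 0" for w
        using T[of w d] that symplectic_flip[OF \<omega>, of d w] by simp
    qed
    then show ?thesis unfolding linear_injective_0[OF \<open>linear T\<close>] by blast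
  qed
  ultimately have "surj T" by (intro linear_injective_imp_surjective) simp_all
  from surjD[OF this] obtain d where d: "T d = (\<Sum>b\<in>Basis. \<xi> b *\<^sub>R b)" by metis
  have "\<omega> x d = \<xi> x" for x unfolding T[of x d] d rep[OF \<xi>, of x] by (rule refl)
  then show thesis by (rule that)
qed

lemma lattice_bounded_representative:
  fixes \<Lambda> :: "'a::euclidean_space set"
  assumes "is_lattice \<Lambda>"
  obtains R where "\<And>v. \<exists>l\<in>\<Lambda>. norm (v - l) \<le> R"
proof -
  obtain b where b: "lattice_basis \<Lambda> b" using assms by (auto simp: is_lattice_def)
  have "\<exists>l\<in>\<Lambda>. norm (v - l) \<le> (\<Sum>i<DIM('a). norm (b i))" for v
  proof -
    obtain c where c: "v = (\<Sum>j<DIM('a). c j *\<^sub>R b j)"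
      using lattice_basis_span[OF b] span_image_lessThan by (metis UNIV_I)
    let ?l = "\<Sum>j<DIM('a). of_int \<lfloor>c j\<rfloor> *\<^sub>R b j"
    have "?l \<in> \<Lambda>" using lattice_basis_mem[OF b] by (intro lattice_sum[OF assms]) auto
    moreover have "v - ?l = (\<Sum>j<DIM('a). frac (c j) *\<^sub>R b j)"
      by (simp add: c frac_def scaleR_diff_left sum_subtractf)
    moreover have "norm (\<Sum>j<DIM('a). frac (c j) *\<^sub>R b j) \<le> (\<Sum>i<DIM('a). norm (b i))"
      by (intro order.trans[OF norm_sum] sum_mono) (simp add: frac_lt_1 less_imp_le mult_left_le_one_le)
    ultimately show ?thesis by metis
  qed
  then show thesis by (rule that)
qed

text \<open>
  Pigeonhole: modulo the lattice, the multiples of a point of \<open>D\<close> have representatives in a finite set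
  of size \<open>N\<close>, so two of the first \<open>N + 1\<close> multiples agree and a multiple by some \<open>k \<le> N\<close> is in the
  lattice; \<open>N!\<close> is divisible by \<open>k\<close>.
\<close>

lemma dual_lattice_index:
  fixes \<Lambda> :: "'a::euclidean_space set"
  assumes \<Lambda>: "is_lattice \<Lambda>" and add: "\<And>x y. x \<in> D \<Longrightarrow> y \<in> D \<Longrightarrow> x - y \<in> D" and sub: "\<Lambda> \<subseteq> D"
    and fin: "\<And>r. finite {v \<in> D. norm v \<le> r}"
  obtains m :: nat where "m > 0" "\<And>v. v \<in> D \<Longrightarrow> of_nat m *\<^sub>R v \<in> \<Lambda>"
proof -
  obtain R where R: "\<And>v. \<exists>l\<in>\<Lambda>. norm (v - l) \<le> R" by (rule lattice_bounded_representative[OF \<Lambda>]) blast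
  define F where "F = {v \<in> D. norm v \<le> R}"
  have "0 \<in> D" using lattice_0[OF \<Lambda>] sub by auto
  then have neg: "- x \<in> D" if "x \<in> D" for x using add[of 0 x] that by simp
  have plus: "x + y \<in> D" if "x \<in> D" "y \<in> D" for x y
    using add[OF that(1) neg[OF that(2)]] by simp
  have mult: "of_nat k *\<^sub>R v \<in> D" if "v \<in> D" for v and k :: nat
    by (induction k) (simp_all add: \<open>0 \<in> D\<close> plus that scaleR_add_left)
  have "of_nat (fact (card F)) *\<^sub>R v \<in> \<Lambda>" if v: "v \<in> D" for v
  proof -
    have "\<forall>k. \<exists>l\<in>\<Lambda>. norm (of_nat k *\<^sub>R v - l) \<le> R" using R by blast
    then obtain l where l: "\<And>k::nat. l k \<in> \<Lambda>" "\<And>k::nat. norm (of_nat k *\<^sub>R v - l k) \<le> R"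
      by metis
    let ?g = "\<lambda>k::nat. of_nat k *\<^sub>R v - l k"
    have "?g ` {..card F} \<subseteq> F"
      using l sub by (auto simp: F_def intro!: add mult v)
    moreover have "finite F" unfolding F_def by (rule fin)
    ultimately have "\<not> inj_on ?g {..card F}"
      using card_inj_on_le[of ?g "{..card F}" F] by auto
    then obtain i j where ij: "i \<le> card F" "j \<le> card F" "i < j" "?g i = ?g j"
      by (metis (no_types, lifting) atMost_iff linorder_inj_onI' )
    have "of_nat (j - i) *\<^sub>R v = l j - l i"
      using ij(3,4) by (simp add: of_nat_diff scaleR_diff_left algebra_simps)
    then have k: "of_nat (j - i) *\<^sub>R v \<in> \<Lambda>" using lattice_diff[OF \<Lambda>] l(1) by simp
    have "j - i dvd fact (card F)" using ij by (intro dvd_fact) auto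
    then obtain q where "fact (card F) = (j - i) * q" by (metis dvdE)
    then have "of_nat (fact (card F)) *\<^sub>R v = of_int (int q) *\<^sub>R (of_nat (j - i) *\<^sub>R v)"
      by (simp only: of_nat_mult) (simp add: mult.commute)
    then show ?thesis using lattice_scale[OF \<Lambda> k, of "int q"] by metis
  qed
  then show thesis by (intro that[of "fact (card F)"]) auto
qed

text \<open>
  The points whose products with the lattice have bounded denominator form a discrete group
  \<open>D\<close> which contains the lattice, and the \<open>\<omega>\<close>-dual of every basis lies in a multiple of \<open>D\<close>.  What
  matters is that \<open>M\<close> does not depend on the basis.
\<close>

lemma symplectic_dual_lattice_vectors:
  fixes \<omega> :: "'a::euclidean_space \<Rightarrow> 'a \<Rightarrow> real"
  assumes "rational_symplectic_torus \<omega> \<Lambda>"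
  obtains M where "M > 0" "\<And>e i. primitive_frame \<Lambda> e DIM('a) \<Longrightarrow> i < DIM('a) \<Longrightarrow>
      \<exists>f\<in>\<Lambda>. \<forall>j<DIM('a). \<omega> (e j) f = (if j = i then M else 0)"
proof -
  have \<omega>: "symplectic_form \<omega>" and \<Lambda>: "is_lattice \<Lambda>" and rat: "\<And>v w. v \<in> \<Lambda> \<Longrightarrow> w \<in> \<Lambda> \<Longrightarrow> \<omega> v w \<in> \<rat>"
    using assms by (auto simp: rational_symplectic_torus_def)
  note lin = symplectic_linear[OF \<omega>]
  obtain b where b: "lattice_basis \<Lambda> b" using \<Lambda> by (auto simp: is_lattice_def)
  then have \<Lambda>_eq: "\<Lambda> = range (\<lambda>c :: nat \<Rightarrow> int. \<Sum>i<DIM('a). of_int (c i) *\<^sub>R b i)"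
    by (auto simp: lattice_basis_def)
  let ?S = "(\<lambda>(i, j). \<omega> (b i) (b j)) ` ({..<DIM('a)} \<times> {..<DIM('a)})"
  have "?S \<subseteq> \<rat>" using rat lattice_basis_mem[OF b] by auto
  then obtain d :: nat where d: "d > 0" "\<forall>q\<in>?S. of_nat d * q \<in> \<int>"
    using common_denominator[of ?S] by blast
  \<comment> \<open>The denominator \<open>d\<close> is common to all products of lattice vectors, which gives \<open>\<Lambda> \<subseteq> D\<close>.\<close>
  define D where "D = {v. \<forall>i<DIM('a). of_nat d * \<omega> v (b i) \<in> \<int>}"
  have D_\<Lambda>: "of_nat d * \<omega> v w \<in> \<int>" if v: "v \<in> D" and w: "w \<in> \<Lambda>" for v w
  proof -
    obtain c :: "nat \<Rightarrow> int" where c: "w = (\<Sum>i<DIM('a). of_int (c i) *\<^sub>R b i)"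
      using w \<Lambda>_eq by blast
    have "of_nat d * \<omega> v w = (\<Sum>i<DIM('a). of_int (c i) * (of_nat d * \<omega> v (b i)))"
      by (simp add: c linear_sum[OF lin(1)] linear_scale[OF lin(1)] sum_distrib_left mult_ac)
    also have "\<dots> \<in> \<int>" by (rule Ints_sum, rule Ints_mult[OF Ints_of_int]) (use v in \<open>simp add: D_def\<close>)
    finally show ?thesis .
  qed
  have b_D: "b j \<in> D" if "j < DIM('a)" for j using d that by (auto simp: D_def)
  have \<Lambda>_D: "\<Lambda> \<subseteq> D"
  proof
    fix v assume v: "v \<in> \<Lambda>"
    have "of_nat d * \<omega> v (b i) \<in> \<int>" if "i < DIM('a)" for i
    proof -
      have "of_nat d * \<omega> v (b i) = - (of_nat d * \<omega> (b i) v)"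
        using symplectic_flip[OF \<omega>, of v "b i"] by simp
      then show ?thesis using D_\<Lambda>[OF b_D[OF that] v] by simp
    qed
    then show "v \<in> D" by (simp add: D_def)
  qed
  have fin: "finite {v \<in> D. norm v \<le> r}" for r
  proof -
    have "finite {v. norm v \<le> r \<and> (\<forall>i<DIM('a). of_nat d * \<omega> v (b i) \<in> \<int>)}"
    proof (rule finite_integral_points)
      show "linear (\<lambda>v. of_nat d * \<omega> v (b i))" for i
        using linear_compose_scale_right[OF lin(2), of "of_nat d"] by simp
      fix v assume "\<And>i. i < DIM('a) \<Longrightarrow> of_nat d * \<omega> v (b i) = 0"
      then have "\<omega> v x = 0" if "x \<in> b ` {..<DIM('a)}" for x using d(1) that by auto
      then have "\<omega> v x = 0" for x
        using linear_eq_0_on_span[OF lin(1), of "b ` {..<DIM('a)}"] lattice_basis_span[OF b] by auto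
      then show "v = 0" by (rule symplectic_nondegenerate[OF \<omega>])
    qed
    then show ?thesis by (rule finite_subset[rotated]) (auto simp: D_def)
  qed
  have diff: "x - y \<in> D" if "x \<in> D" "y \<in> D" for x y
    using that by (simp add: D_def linear_diff[OF lin(2)] right_diff_distrib)
  obtain m :: nat where m: "m > 0" "\<And>v. v \<in> D \<Longrightarrow> of_nat m *\<^sub>R v \<in> \<Lambda>"
    using dual_lattice_index[OF \<Lambda> diff \<Lambda>_D fin] by blast
  show thesis
  proof (rule that)
    show "of_nat m / of_nat d > (0::real)" using m(1) d(1) by simp
    fix e and i assume e: "primitive_frame \<Lambda> e DIM('a)" and i: "i < DIM('a)"
    have ind: "inj_on e {..<DIM('a)}" "independent (e ` {..<DIM('a)})"
      using primitive_frame_independent[OF e] by auto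
    obtain \<xi> :: "nat \<Rightarrow> 'a \<Rightarrow> real" where
      \<xi>: "\<And>i. linear (\<xi> i)" "\<And>i j. j < DIM('a) \<Longrightarrow> \<xi> i (e j) = (if j = i then 1 else 0)"
      by (rule coordinate_functionals[OF ind]) (rule that)
    obtain f where f: "\<And>x. \<omega> x f = \<xi> i x / of_nat d"
      using symplectic_dual_vector[OF \<omega> linear_compose_scale_right[OF \<xi>(1), of "1 / of_nat d" i]]
      by (metis (no_types, lifting) divide_inverse_commute inverse_eq_divide real_scaleR_def)
    have "f \<in> D"
      unfolding D_def
    proof (intro CollectI allI impI)
      fix j assume "j < DIM('a)"
      obtain c :: "nat \<Rightarrow> int" where c: "b j = (\<Sum>j<DIM('a). of_int (c j) *\<^sub>R e j)"
        using primitive_frame_combination[OF e lattice_basis_mem[OF b \<open>j < DIM('a)\<close>]] by blast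
      have "\<xi> i (b j) = of_int (c i)"
        using i by (simp add: c linear_sum[OF \<xi>(1)] linear_scale[OF \<xi>(1)] \<xi>(2) if_distrib cong: if_cong)
      then have "of_nat d * \<omega> f (b j) = - of_int (c i)"
        using symplectic_flip[OF \<omega>, of f "b j"] d(1) by (simp add: f)
      then show "of_nat d * \<omega> f (b j) \<in> \<int>" by simp
    qed
    then have "of_nat m *\<^sub>R f \<in> \<Lambda>" by (rule m(2))
    moreover have "\<forall>j<DIM('a). \<omega> (e j) (of_nat m *\<^sub>R f) = (if j = i then of_nat m / of_nat d else 0)"
      by (simp add: linear_scale[OF lin(1)] f \<xi>(2))
    ultimately show "\<exists>f\<in>\<Lambda>. \<forall>j<DIM('a). \<omega> (e j) f = (if j = i then of_nat m / of_nat d else 0)"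
      by blast
  qed
qed

section \<open>Reduced isotropic frames for a compatible complex structure\<close>

lemma alternating_form_update_in_span:
  assumes \<alpha>: "alternating_form k \<alpha>" and m: "m < k" and S: "S \<subseteq> {..<k} - {m}"
    and x: "x \<in> span (v ` S)"
  shows "\<alpha> (v(m := x)) = 0"
proof -
  have "\<alpha> (v(m := y)) = 0" if y: "y \<in> v ` S" for y
  proof -
    obtain j where j: "j \<in> S" "y = v j" using y by blast
    with S show ?thesis
      by (intro alternating_form_repeat[OF \<alpha> m, of j]) auto
  qed
  then show ?thesis
    using linear_eq_0_on_span[OF alternating_form_linear[OF \<alpha> m]] x by blast
qed

lemma alternating_form_scale_args:
  fixes \<alpha> :: "(nat \<Rightarrow> 'a::real_vector) \<Rightarrow> 'b::real_vector"
  assumes \<alpha>: "alternating_form k \<alpha>"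
  shows "\<alpha> (\<lambda>i. r i *\<^sub>R v i) = (\<Prod>i<k. r i) *\<^sub>R \<alpha> v"
proof -
  have "\<alpha> (\<lambda>i. if i < m then r i *\<^sub>R v i else v i) = (\<Prod>i<m. r i) *\<^sub>R \<alpha> v" if "m \<le> k" for m
    using that
  proof (induction m)
    case (Suc m)
    let ?w = "\<lambda>i. if i < m then r i *\<^sub>R v i else v i"
    have "(\<lambda>i. if i < Suc m then r i *\<^sub>R v i else v i) = ?w(m := r m *\<^sub>R v m)"
      by (auto simp: fun_eq_iff less_Suc_eq)
    moreover have "?w(m := v m) = ?w" by auto
    ultimately have "\<alpha> (\<lambda>i. if i < Suc m then r i *\<^sub>R v i else v i) = r m *\<^sub>R \<alpha> ?w"
      using linear_scale[OF alternating_form_linear[OF \<alpha>, of m ?w], of "r m" "v m"] Suc.prems by simp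
    then show ?case using Suc by (simp add: mult.commute)
  qed simp
  from this[of k] show ?thesis
    using alternating_form_cong[OF \<alpha>, of "\<lambda>i. r i *\<^sub>R v i" "\<lambda>i. if i < k then r i *\<^sub>R v i else v i"]
    by simp
qed

text \<open>
  Replaces the arguments one at a time; each error term has an argument in the span of others.
\<close>

lemma alternating_form_triangular_change:
  assumes \<alpha>: "alternating_form k \<alpha>"
    and tri: "\<And>j. j < k \<Longrightarrow> u j - v j \<in> span (u ` {..<j})"
  shows "\<alpha> u = \<alpha> v"
proof -
  have "\<alpha> (\<lambda>i. if i < m then u i else v i) = \<alpha> v" if "m \<le> k" for m
    using that
  proof (induction m)
    case (Suc m)
    let ?w = "\<lambda>i. if i < m then u i else v i"
    have lin: "linear (\<lambda>x. \<alpha> (?w(m := x)))"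
      using Suc.prems by (intro alternating_form_linear[OF \<alpha>]) auto
    have "?w ` {..<m} = u ` {..<m}" by auto
    then have "\<alpha> (?w(m := u m - v m)) = 0"
      using Suc.prems tri[of m] by (intro alternating_form_update_in_span[OF \<alpha>, of m "{..<m}"]) auto
    then have "\<alpha> (?w(m := u m)) = \<alpha> (?w(m := v m))"
      using linear_diff[OF lin, of "u m" "v m"] by simp
    moreover have "?w(m := v m) = ?w" by auto
    moreover have "(\<lambda>i. if i < Suc m then u i else v i) = ?w(m := u m)"
      by (auto simp: fun_eq_iff less_Suc_eq)
    ultimately show ?case using Suc by simp
  qed simp
  from this[of k] show ?thesis
    using alternating_form_cong[OF \<alpha>, of u "\<lambda>i. if i < k then u i else v i"] by simp
qed

definition symplectic_perp :: "('a \<Rightarrow> 'a \<Rightarrow> real) \<Rightarrow> (nat \<Rightarrow> 'a) \<Rightarrow> nat \<Rightarrow> 'a set" where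
  "symplectic_perp \<omega> e k = {v. \<forall>j<k. \<omega> (e j) v = 0}"

definition isotropic :: "('a \<Rightarrow> 'a \<Rightarrow> real) \<Rightarrow> (nat \<Rightarrow> 'a) \<Rightarrow> nat \<Rightarrow> bool" where
  "isotropic \<omega> e k \<longleftrightarrow> (\<forall>i<k. \<forall>j<k. \<omega> (e i) (e j) = 0)"

lemma symplectic_eq_0_on_span:
  assumes \<omega>: "symplectic_form \<omega>" and "\<And>x y. x \<in> S \<Longrightarrow> y \<in> T \<Longrightarrow> \<omega> x y = 0" "v \<in> span S" "w \<in> span T"
  shows "\<omega> v w = 0"
proof -
  have "\<omega> x w = 0" if "x \<in> S" for x
    using linear_eq_0_on_span[OF symplectic_linear(1)[OF \<omega>], of T] assms(2,4) that by blast
  then show ?thesis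
    using linear_eq_0_on_span[OF symplectic_linear(2)[OF \<omega>], of S] assms(3) by blast
qed

lemma subspace_symplectic_perp:
  assumes "symplectic_form \<omega>"
  shows "subspace (symplectic_perp \<omega> e k)"
  unfolding subspace_def symplectic_perp_def
  by (simp add: linear_add[OF symplectic_linear(1)[OF assms]] linear_scale[OF symplectic_linear(1)[OF assms]]
      linear_0[OF symplectic_linear(1)[OF assms]])

lemma isotropic_span_perp:
  assumes "symplectic_form \<omega>" "isotropic \<omega> e k"
  shows "span (e ` {..<k}) \<subseteq> symplectic_perp \<omega> e k"
  using assms(2) by (intro span_minimal subspace_symplectic_perp assms(1))
    (auto simp: symplectic_perp_def isotropic_def)

text \<open>
  Extend the frame to a basis of the lattice.  Those of the dual vectors which belong to the new
  basis vectors are lattice points orthogonal to the frame, and they are too many to lie in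
  its span.
\<close>

lemma lattice_perp_not_in_span:
  fixes \<omega> :: "'a::euclidean_space \<Rightarrow> 'a \<Rightarrow> real"
  assumes torus: "rational_symplectic_torus \<omega> \<Lambda>" and e: "primitive_frame \<Lambda> e k" and k: "2 * k < DIM('a)"
  shows "\<exists>v\<in>\<Lambda> \<inter> symplectic_perp \<omega> e k. v \<notin> span (e ` {..<k})"
proof (rule ccontr)
  assume neg: "\<not> ?thesis"
  have \<omega>: "symplectic_form \<omega>" and \<Lambda>: "is_lattice \<Lambda>"
    using torus by (auto simp: rational_symplectic_torus_def)
  obtain M where M: "M > 0" "\<And>e i. primitive_frame \<Lambda> e DIM('a) \<Longrightarrow> i < DIM('a) \<Longrightarrow>
      \<exists>f\<in>\<Lambda>. \<forall>j<DIM('a). \<omega> (e j) f = (if j = i then M else 0)"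
    by (rule symplectic_dual_lattice_vectors[OF torus]) (rule that)
  obtain e' where e': "\<And>j. j < k \<Longrightarrow> e' j = e j" "primitive_frame \<Lambda> e' DIM('a)"
    using primitive_frame_extends_to_basis[OF \<Lambda> e] k by (metis add_leD1 less_imp_le mult_2)
  have "\<forall>i. \<exists>f. i < DIM('a) \<longrightarrow> f \<in> \<Lambda> \<and> (\<forall>j<DIM('a). \<omega> (e' j) f = (if j = i then M else 0))"
    using M(2)[OF e'(2)] by blast
  then obtain f where f: "\<And>i. i < DIM('a) \<Longrightarrow> f i \<in> \<Lambda>"
    "\<And>i j. i < DIM('a) \<Longrightarrow> j < DIM('a) \<Longrightarrow> \<omega> (e' j) (f i) = (if j = i then M else 0)"
    by metis
  define h where "h i = f (k + i)" for i
  have in_W: "h i \<in> span (e ` {..<k})" if "i < DIM('a) - k" for i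
  proof -
    have "h i \<in> \<Lambda> \<inter> symplectic_perp \<omega> e k"
      using that f(1)[of "k + i"] f(2)[of "k + i"] by (auto simp: h_def symplectic_perp_def simp flip: e'(1))
    then show ?thesis using neg by blast
  qed
  have "inj_on h {..<DIM('a) - k} \<and> independent (h ` {..<DIM('a) - k})"
  proof (rule triangular_independent)
    fix j assume j: "j < DIM('a) - k"
    show "h j \<notin> span (h ` {..<j})"
    proof
      assume "h j \<in> span (h ` {..<j})"
      moreover have "\<omega> (e' (k + j)) x = 0" if "x \<in> h ` {..<j}" for x
        using that j f(2) by (auto simp: h_def)
      ultimately have "\<omega> (e' (k + j)) (h j) = 0"
        using linear_eq_0_on_span[OF symplectic_linear(1)[OF \<omega>]] by blast
      then show False using f(2)[of "k + j" "k + j"] j M(1) by (simp add: h_def)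
    qed
  qed
  then have "DIM('a) - k \<le> dim (span (e ` {..<k}))"
    using independent_card_le_dim[of "h ` {..<DIM('a) - k}" "span (e ` {..<k})"] in_W
    by (auto simp: card_image)
  then show False using primitive_frame_dim[OF e] k by simp
qed

locale compatible_structure =
  fixes \<omega> :: "'a::euclidean_space \<Rightarrow> 'a \<Rightarrow> real" and J :: "'a \<Rightarrow> 'a"
  assumes symp: "symplectic_form \<omega>" and compat: "compatible_complex_structure \<omega> J"

context compatible_structure
begin

definition g :: "'a \<Rightarrow> 'a \<Rightarrow> real" where "g v w = \<omega> v (J w)"

lemma J_props: "linear J" "J (J v) = - v" "\<omega> (J v) (J w) = \<omega> v w" "v \<noteq> 0 \<Longrightarrow> \<omega> v (J v) > 0"
  using compat by (auto simp: compatible_complex_structure_def)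

lemmas omega_lin = symplectic_linear[OF symp]

lemma g_linear: "linear (g v)" "linear (\<lambda>w. g w v)"
  unfolding g_def using linear_compose[OF J_props(1) omega_lin(1)] omega_lin(2) by (auto simp: o_def)

lemmas omega_simps = linear_add[OF omega_lin(1)] linear_add[OF omega_lin(2)] linear_diff[OF omega_lin(1)]
  linear_diff[OF omega_lin(2)] linear_scale[OF omega_lin(1)] linear_scale[OF omega_lin(2)]

lemma g_J: "g v (J w) = \<omega> w v" "g (J v) w = \<omega> v w" "g (J v) (J w) = g v w"
proof -
  show "g v (J w) = \<omega> w v"
    using symplectic_flip[OF symp, of w v] by (simp add: g_def J_props(2) linear_neg[OF omega_lin(1)])
qed (simp_all only: g_def J_props(3))

lemma g_sym: "g v w = g w v"
  by (metis g_J(2) g_def J_props(2) g_J(1) linear_neg[OF omega_lin(1)] symplectic_flip[OF symp])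

lemma g_pos: "v \<noteq> 0 \<Longrightarrow> g v v > 0"
  by (simp add: g_def J_props)

lemma g_nonneg: "g v v \<ge> 0" and g_zero: "g v v = 0 \<longleftrightarrow> v = 0"
  using g_pos[of v] linear_0[OF g_linear(1)] by (cases "v = 0"; force)+

lemmas g_simps = linear_add[OF g_linear(1)] linear_add[OF g_linear(2)] linear_diff[OF g_linear(1)]
  linear_diff[OF g_linear(2)] linear_scale[OF g_linear(1)] linear_scale[OF g_linear(2)]
  linear_0[OF g_linear(1)] linear_0[OF g_linear(2)] linear_neg[OF g_linear(1)] linear_neg[OF g_linear(2)]

text \<open>
  Positivity of \<open>g\<close> at \<open>g w w *\<^sub>R v - g v w *\<^sub>R w\<close>.
\<close>

lemma g_Cauchy_Schwarz: "(g v w)\<^sup>2 \<le> g v v * g w w"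
proof (cases "w = 0")
  case False
  have "0 \<le> g (g w w *\<^sub>R v - g v w *\<^sub>R w) (g w w *\<^sub>R v - g v w *\<^sub>R w)" by (rule g_nonneg)
  also have "\<dots> = g w w * (g v v * g w w - (g v w)\<^sup>2)"
    by (simp add: g_simps g_sym[of w v] power2_eq_square algebra_simps)
  finally show ?thesis using g_pos[OF False] by (simp add: zero_le_mult_iff)
qed (simp add: g_simps)

lemma seminorm_g: "seminorm (\<lambda>v. sqrt (g v v))"
  unfolding seminorm_def
proof (intro conjI allI)
  fix v w
  have "g v w \<le> sqrt (g v v) * sqrt (g w w)"
    using g_Cauchy_Schwarz[of v w] by (metis real_le_rsqrt real_sqrt_mult)
  then have "g (v + w) (v + w) \<le> (sqrt (g v v) + sqrt (g w w))\<^sup>2"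
    by (simp add: g_simps g_sym[of w v] power2_sum g_nonneg)
  then show "sqrt (g (v + w) (v + w)) \<le> sqrt (g v v) + sqrt (g w w)"
    by (intro real_le_lsqrt) (auto simp: g_nonneg)
next
  show "sqrt (g (r *\<^sub>R v) (r *\<^sub>R v)) = \<bar>r\<bar> * sqrt (g v v)" for r v
    by (simp add: g_simps real_sqrt_mult flip: mult.assoc)
qed

text \<open>
  The Gram--Schmidt vectors of \<open>e\<close> with respect to \<open>g\<close>, without normalisation.
\<close>

function gs :: "(nat \<Rightarrow> 'a) \<Rightarrow> nat \<Rightarrow> 'a" where
  "gs e k = e k - (\<Sum>j<k. (g (e k) (gs e j) / g (gs e j) (gs e j)) *\<^sub>R gs e j)"
  by auto
termination by (relation "Wellfounded.measure snd") auto

declare gs.simps[simp del]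

definition resid :: "(nat \<Rightarrow> 'a) \<Rightarrow> nat \<Rightarrow> 'a \<Rightarrow> 'a" where
  "resid e k v = v - (\<Sum>j<k. (g v (gs e j) / g (gs e j) (gs e j)) *\<^sub>R gs e j)"

definition height :: "(nat \<Rightarrow> 'a) \<Rightarrow> nat \<Rightarrow> real" where
  "height e k = g (gs e k) (gs e k)"

lemma gs_eq_resid: "gs e k = resid e k (e k)"
  unfolding resid_def by (rule gs.simps)

lemma gs_cong: "(\<And>i. i \<le> k \<Longrightarrow> e i = e' i) \<Longrightarrow> gs e k = gs e' k"
proof (induction k rule: less_induct)
  case (less k)
  then have "gs e j = gs e' j" if "j < k" for j using that by simp
  then show ?case using less.prems[of k] by (subst (1 2) gs.simps) (auto intro!: sum.cong)
qed

lemma resid_cong: "(\<And>i. i < k \<Longrightarrow> e i = e' i) \<Longrightarrow> resid e k = resid e' k"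
proof
  fix v assume "\<And>i. i < k \<Longrightarrow> e i = e' i"
  then have "gs e j = gs e' j" if "j < k" for j using that by (intro gs_cong) auto
  then show "resid e k v = resid e' k v" by (auto simp: resid_def intro!: sum.cong)
qed

lemma linear_resid: "linear (resid e k)"
  by (rule linearI)
    (simp_all add: resid_def g_simps add_divide_distrib scaleR_add_left sum.distrib scaleR_sum_right
      scaleR_diff_right)

lemma gram_schmidt:
  assumes "\<And>j. j < k \<Longrightarrow> e j \<notin> span (e ` {..<j})"
  shows gs_span: "span (gs e ` {..<k}) = span (e ` {..<k})"
    and gs_orthogonal: "\<And>i j. i < k \<Longrightarrow> j < k \<Longrightarrow> i \<noteq> j \<Longrightarrow> g (gs e i) (gs e j) = 0"
    and height_pos: "\<And>j. j < k \<Longrightarrow> height e j > 0"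
    and resid_diff: "\<And>v. resid e k v - v \<in> span (e ` {..<k})"
    and resid_orthogonal: "\<And>v j. j < k \<Longrightarrow> g (resid e k v) (gs e j) = 0"
proof -
  have *: "span (gs e ` {..<k}) = span (e ` {..<k}) \<and>
      (\<forall>i<k. \<forall>j<k. i \<noteq> j \<longrightarrow> g (gs e i) (gs e j) = 0) \<and> (\<forall>j<k. height e j > 0) \<and>
      (\<forall>v. resid e k v - v \<in> span (e ` {..<k})) \<and> (\<forall>v. \<forall>j<k. g (resid e k v) (gs e j) = 0)"
    using assms
  proof (induction k)
    case 0
    show ?case by (simp add: resid_def)
  next
    case (Suc k)
    then have span: "span (gs e ` {..<k}) = span (e ` {..<k})"
      and orth: "\<And>i j. i < k \<Longrightarrow> j < k \<Longrightarrow> i \<noteq> j \<Longrightarrow> g (gs e i) (gs e j) = 0"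
      and pos: "\<And>j. j < k \<Longrightarrow> height e j > 0"
      and res: "\<And>v. resid e k v - v \<in> span (e ` {..<k})"
      and resorth: "\<And>v j. j < k \<Longrightarrow> g (resid e k v) (gs e j) = 0"
      by auto
    have diff: "gs e k - e k \<in> span (e ` {..<k})" using res[of "e k"] by (simp add: gs_eq_resid)
    have "gs e k \<noteq> 0"
    proof
      assume "gs e k = 0"
      then have "e k \<in> span (e ` {..<k})" using diff span_neg by fastforce
      then show False using Suc.prems[of k] by simp
    qed
    then have pos': "height e j > 0" if "j < Suc k" for j
      using that pos g_pos by (auto simp: less_Suc_eq height_def)
    have new: "g (gs e k) (gs e j) = 0" "g (gs e j) (gs e k) = 0" if "j < k" for j
      using resorth[OF that, of "e k"] g_sym by (simp_all add: gs_eq_resid[of e k])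
    have orth': "g (gs e i) (gs e j) = 0" if "i < Suc k" "j < Suc k" "i \<noteq> j" for i j
      using that orth new by (auto simp: less_Suc_eq)
    have span': "span (gs e ` {..<Suc k}) = span (e ` {..<Suc k})"
    proof -
      have "span (gs e ` {..<Suc k}) = span (insert (gs e k) (e ` {..<k}))"
        by (simp add: lessThan_Suc span_insert span)
      also have "\<dots> = span (e ` {..<Suc k})"
        using eq_span_insert_eq[OF diff] by (simp add: lessThan_Suc)
      finally show ?thesis .
    qed
    have res': "resid e (Suc k) v - v \<in> span (e ` {..<Suc k})" for v
    proof -
      have "(\<Sum>j<Suc k. (g v (gs e j) / g (gs e j) (gs e j)) *\<^sub>R gs e j) \<in> span (e ` {..<Suc k})"
        unfolding span'[symmetric] by (intro span_sum span_scale span_base) auto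
      then show ?thesis unfolding resid_def using span_neg by fastforce
    qed
    have resorth': "g (resid e (Suc k) v) (gs e j) = 0" if j: "j < Suc k" for v j
    proof -
      have "(\<Sum>i<Suc k. (g v (gs e i) / g (gs e i) (gs e i)) * g (gs e i) (gs e j)) =
          (\<Sum>i<Suc k. if i = j then g v (gs e j) else 0)"
        using pos'[OF j] orth'[OF _ j] by (intro sum.cong) (auto simp: height_def)
      also have "\<dots> = g v (gs e j)" using j by simp
      finally show ?thesis
        by (simp only: resid_def linear_diff[OF g_linear(2)] linear_sum[OF g_linear(2)] linear_scale[OF g_linear(2)]
            real_scaleR_def diff_self)
    qed
    show ?case using span' orth' pos' res' resorth' by blast
  qed
  show "span (gs e ` {..<k}) = span (e ` {..<k})" using * by blast
  show "g (gs e i) (gs e j) = 0" if "i < k" "j < k" "i \<noteq> j" for i j using * that by blast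
  show "height e j > 0" if "j < k" for j using * that by blast
  show "resid e k v - v \<in> span (e ` {..<k})" for v using * by blast
  show "g (resid e k v) (gs e j) = 0" if "j < k" for v j using * that by blast
qed

lemma resid_eq_0_iff:
  assumes "\<And>j. j < k \<Longrightarrow> e j \<notin> span (e ` {..<j})"
  shows "resid e k v = 0 \<longleftrightarrow> v \<in> span (e ` {..<k})"
proof
  assume "resid e k v = 0"
  then show "v \<in> span (e ` {..<k})" using resid_diff[OF assms, where v = v] span_neg by fastforce
next
  assume "v \<in> span (e ` {..<k})"
  then have "resid e k v \<in> span (gs e ` {..<k})"
    using resid_diff[OF assms, where v = v] span_add[of "resid e k v - v" _ v] gs_span[OF assms] by simp
  moreover have "g (resid e k v) x = 0" if "x \<in> gs e ` {..<k}" for x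
    using that resid_orthogonal[OF assms] by auto
  ultimately have "g (resid e k v) (resid e k v) = 0"
    using linear_eq_0_on_span[OF g_linear(1)] by blast
  then show "resid e k v = 0" by (simp add: g_zero)
qed

definition resid_norm :: "(nat \<Rightarrow> 'a) \<Rightarrow> nat \<Rightarrow> 'a \<Rightarrow> real" where
  "resid_norm e k v = sqrt (g (resid e k v) (resid e k v))"

lemma seminorm_resid: "seminorm (resid_norm e k)"
  using seminormD(1,2)[OF seminorm_g]
  unfolding seminorm_def resid_norm_def linear_add[OF linear_resid] linear_scale[OF linear_resid] by blast


text \<open>
  The greedy frame: each vector is as close as possible to the span of its predecessors, among the
  lattice vectors that are \<open>\<omega>\<close>-orthogonal to them.
\<close>

definition reduced_frame :: "'a set \<Rightarrow> (nat \<Rightarrow> 'a) \<Rightarrow> nat \<Rightarrow> bool" where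
  "reduced_frame \<Lambda> e k \<longleftrightarrow> primitive_frame \<Lambda> e k \<and> isotropic \<omega> e k \<and>
     (\<forall>j<k. \<forall>v\<in>\<Lambda> \<inter> symplectic_perp \<omega> e j. v \<notin> span (e ` {..<j}) \<longrightarrow> resid_norm e j (e j) \<le> resid_norm e j v)"

lemma resid_norm_ker:
  assumes "\<And>j. j < k \<Longrightarrow> e j \<notin> span (e ` {..<j})"
  shows "resid_norm e k v = 0 \<longleftrightarrow> v \<in> span (e ` {..<k})"
  unfolding resid_norm_def by (simp add: g_zero resid_eq_0_iff[OF assms])

lemma isotropic_extend:
  assumes e: "isotropic \<omega> e k" and x: "x \<in> symplectic_perp \<omega> e k"
  shows "isotropic \<omega> (e(k := x)) (Suc k)"
proof -
  have "\<omega> x (e j) = 0" "\<omega> (e j) x = 0" if "j < k" for j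
    using that x symplectic_flip[OF symp, of x "e j"] by (auto simp: symplectic_perp_def)
  then show ?thesis
    using e symplectic_self[OF symp] by (auto simp: isotropic_def less_Suc_eq)
qed

lemma reduced_frame_exists:
  assumes torus: "rational_symplectic_torus \<omega> \<Lambda>" and "2 * k \<le> DIM('a)"
  shows "\<exists>e. reduced_frame \<Lambda> e k"
  using assms(2)
proof (induction k)
  case 0
  have "reduced_frame \<Lambda> (\<lambda>_. 0) 0"
    by (simp add: reduced_frame_def primitive_frame_def isotropic_def)
  then show ?case by blast
next
  case (Suc k)
  then obtain e where e: "reduced_frame \<Lambda> e k" by auto
  then have prim: "primitive_frame \<Lambda> e k" and iso: "isotropic \<omega> e k"
    and min: "\<And>j v. j < k \<Longrightarrow> v \<in> \<Lambda> \<inter> symplectic_perp \<omega> e j \<Longrightarrow> v \<notin> span (e ` {..<j}) \<Longrightarrow>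
        resid_norm e j (e j) \<le> resid_norm e j v"
    by (auto simp: reduced_frame_def)
  have \<Lambda>: "is_lattice \<Lambda>" using torus by (simp add: rational_symplectic_torus_def)
  have tri: "\<And>j. j < k \<Longrightarrow> e j \<notin> span (e ` {..<j})" using prim by (simp add: primitive_frame_def)
  note P = subspace_symplectic_perp[OF symp, of e k] and WP = isotropic_span_perp[OF symp iso]
  have ker: "resid_norm e k v = 0 \<longleftrightarrow> v \<in> span (e ` {..<k})" for v
    by (rule resid_norm_ker[OF tri])
  have ex: "\<exists>v\<in>\<Lambda> \<inter> symplectic_perp \<omega> e k. v \<notin> span (e ` {..<k})"
    using Suc.prems by (intro lattice_perp_not_in_span[OF torus prim]) auto
  obtain x where x: "x \<in> \<Lambda> \<inter> symplectic_perp \<omega> e k" "x \<notin> span (e ` {..<k})"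
      "\<And>v. v \<in> \<Lambda> \<inter> symplectic_perp \<omega> e k \<Longrightarrow> v \<notin> span (e ` {..<k}) \<Longrightarrow> resid_norm e k x \<le> resid_norm e k v"
    by (rule shortest_lattice_vector_modulo[OF \<Lambda> prim P WP seminorm_resid ker ex]) (rule that)
  let ?e = "e(k := x)"
  have prim': "primitive_frame \<Lambda> ?e (Suc k)"
    by (rule primitive_frame_extend_shortest[OF \<Lambda> prim P WP seminorm_resid ker x])
  have img: "?e ` {..<j} = e ` {..<j}" if "j \<le> k" for j using that by auto
  have perp: "symplectic_perp \<omega> ?e j = symplectic_perp \<omega> e j" if "j \<le> k" for j
    using that by (auto simp: symplectic_perp_def)
  have norm: "resid_norm ?e j = resid_norm e j" if "j \<le> k" for j
    using resid_cong[of j ?e e] that by (auto simp: resid_norm_def fun_eq_iff)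
  have "resid_norm ?e j (?e j) \<le> resid_norm ?e j v"
    if "j < Suc k" "v \<in> \<Lambda> \<inter> symplectic_perp \<omega> ?e j" "v \<notin> span (?e ` {..<j})" for j v
  proof (cases "j = k")
    case True
    then show ?thesis using that x(3)[of v] img[of k] perp[of k] norm[of k] by simp
  next
    case False
    then show ?thesis using that min[of j v] img[of j] perp[of j] norm[of j] by simp
  qed
  then have "reduced_frame \<Lambda> ?e (Suc k)"
    using prim' isotropic_extend[OF iso] x(1) by (simp add: reduced_frame_def)
  then show ?case by blast
qed

text \<open>
  The vector \<open>e (Suc j)\<close>, corrected by a multiple of \<open>e j\<close>, competed with \<open>e j\<close> for the position \<open>j\<close>.
\<close>

lemma height_step:
  assumes \<Lambda>: "is_lattice \<Lambda>" and e: "reduced_frame \<Lambda> e k" and j: "Suc j < k"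
  shows "height e j \<le> (4/3) * height e (Suc j)"
proof -
  have prim: "primitive_frame \<Lambda> e k" and iso: "isotropic \<omega> e k"
    and min: "\<And>v. v \<in> \<Lambda> \<inter> symplectic_perp \<omega> e j \<Longrightarrow> v \<notin> span (e ` {..<j}) \<Longrightarrow>
        resid_norm e j (e j) \<le> resid_norm e j v"
    using e j by (auto simp: reduced_frame_def)
  have tri: "\<And>j. j < k \<Longrightarrow> e j \<notin> span (e ` {..<j})" using prim by (simp add: primitive_frame_def)
  define \<mu> where "\<mu> = g (e (Suc j)) (gs e j) / height e j"
  define r where "r = round \<mu>"
  let ?v = "e (Suc j) - of_int r *\<^sub>R e j"
  have gs_Suc: "resid e j (e (Suc j)) = gs e (Suc j) + \<mu> *\<^sub>R gs e j"
    unfolding gs_eq_resid[of e "Suc j"] by (simp add: resid_def \<mu>_def height_def)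
  have "?v \<in> \<Lambda> \<inter> symplectic_perp \<omega> e j"
  proof
    show "?v \<in> \<Lambda>" using prim j by (intro lattice_diff_scale[OF \<Lambda>]) (auto simp: primitive_frame_def)
    show "?v \<in> symplectic_perp \<omega> e j"
      using iso j by (intro subspace_diff subspace_scale subspace_symplectic_perp symp)
        (auto simp: symplectic_perp_def isotropic_def)
  qed
  moreover have "?v \<notin> span (e ` {..<j})"
  proof
    assume "?v \<in> span (e ` {..<j})"
    then have "e (Suc j) \<in> span (insert (e j) (e ` {..<j}))" by (auto simp: span_insert)
    then show False using tri[OF j] by (simp add: lessThan_Suc)
  qed
  ultimately have "resid_norm e j (e j) \<le> resid_norm e j ?v" by (rule min)
  then have "height e j \<le> g (resid e j ?v) (resid e j ?v)"
    by (simp add: resid_norm_def height_def gs_eq_resid)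
  also have "resid e j ?v = gs e (Suc j) + (\<mu> - of_int r) *\<^sub>R gs e j"
    by (simp add: linear_diff[OF linear_resid] linear_scale[OF linear_resid] gs_Suc
        flip: gs_eq_resid) (simp add: algebra_simps)
  also have "g \<dots> \<dots> = height e (Suc j) + (\<mu> - of_int r)\<^sup>2 * height e j"
    using gs_orthogonal[OF tri j Suc_lessD[OF j]] gs_orthogonal[OF tri Suc_lessD[OF j] j]
    by (simp add: g_simps height_def power2_eq_square)
  also have "(\<mu> - of_int r)\<^sup>2 * height e j \<le> (1/4) * height e j"
  proof (rule mult_right_mono)
    have "\<bar>\<mu> - of_int r\<bar> \<le> 1/2" unfolding r_def using of_int_round_abs_le[of \<mu>] by (simp add: abs_minus_commute)
    then show "(\<mu> - of_int r)\<^sup>2 \<le> 1/4"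
      using power_mono[of "\<bar>\<mu> - of_int r\<bar>" "1/2" 2] by (simp add: power2_eq_square)
    show "0 \<le> height e j" by (simp add: height_def g_nonneg)
  qed
  finally show ?thesis by simp
qed

text \<open>
  The vectors \<open>u i\<close> and \<open>J (u i)\<close> are pairwise \<open>g\<close>-orthogonal because \<open>g (J v) w = \<omega> v w\<close>.
\<close>

lemma orthogonal_lagrangian_spans:
  fixes u :: "nat \<Rightarrow> 'a"
  assumes dim: "DIM('a) = 2 * n" and orth: "\<And>i j. i < n \<Longrightarrow> j < n \<Longrightarrow> i \<noteq> j \<Longrightarrow> g (u i) (u j) = 0"
    and iso: "isotropic \<omega> u n" and nz: "\<And>i. i < n \<Longrightarrow> u i \<noteq> 0"
  shows "span ((\<lambda>i. if i < n then u i else J (u (i - n))) ` {..<2 * n}) = UNIV"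
proof -
  define w where "w i = (if i < n then u i else J (u (i - n)))" for i
  have J0: "J v \<noteq> 0" if "v \<noteq> 0" for v
    using J_props(2)[of v] linear_0[OF J_props(1)] that by auto
  have w_orth: "g (w i) (w j) = 0" if "i < 2 * n" "j < 2 * n" "i \<noteq> j" for i j
  proof (cases "i < n \<or> j < n")
    case True
    then show ?thesis
      using that orth[of i j] iso by (auto simp: w_def g_J(1,2) isotropic_def)
  next
    case False
    then have "i - n < n" "j - n < n" "i - n \<noteq> j - n" using that by auto
    then show ?thesis
      using False orth[of "i - n" "j - n"] by (simp add: w_def g_J(3))
  qed
  have w_nz: "w i \<noteq> 0" if "i < 2 * n" for i
    using that nz J0 by (auto simp: w_def)
  have "inj_on w {..<2 * n} \<and> independent (w ` {..<2 * n})"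
  proof (rule triangular_independent)
    fix j assume j: "j < 2 * n"
    show "w j \<notin> span (w ` {..<j})"
    proof
      assume "w j \<in> span (w ` {..<j})"
      moreover have "g (w j) x = 0" if "x \<in> w ` {..<j}" for x
        using that j w_orth[of j] by auto
      ultimately have "g (w j) (w j) = 0"
        using linear_eq_0_on_span[OF g_linear(1)] by blast
      then show False using w_nz[OF j] unfolding g_zero by blast
    qed
  qed
  then have "card (w ` {..<2 * n}) = DIM('a)" "independent (w ` {..<2 * n})"
    using dim by (simp_all add: card_image)
  then have "span (w ` {..<2 * n}) = UNIV" by (metis dim_eq_card_independent dim_eq_full)
  then show ?thesis unfolding w_def .
qed

text \<open>
  Modulo the span of \<open>e 0, \<dots>, e (m - 1)\<close> its \<open>\<omega>\<close>-orthogonal complement is the complex line of \<open>gs e m\<close>.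
  The coefficient of \<open>J (gs e m)\<close> is determined by \<open>\<omega>\<close> alone, up to the normalisation by the
  height.
\<close>

lemma lagrangian_normal_decomposition:
  fixes e :: "nat \<Rightarrow> 'a"
  assumes dim: "DIM('a) = 2 * Suc m" and e: "\<And>j. j < Suc m \<Longrightarrow> e j \<notin> span (e ` {..<j})"
    and iso: "isotropic \<omega> e (Suc m)" and f: "f \<in> symplectic_perp \<omega> e m"
  shows "\<exists>s. resid e m f = s *\<^sub>R gs e m + (\<omega> (e m) f / height e m) *\<^sub>R J (gs e m)"
proof -
  let ?o = "gs e m" and ?h = "height e m"
  have em: "\<And>j. j < m \<Longrightarrow> e j \<notin> span (e ` {..<j})" using e by simp
  have h: "?h > 0" by (rule height_pos[OF e lessI])
  have iso': "isotropic \<omega> (gs e) (Suc m)"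
    unfolding isotropic_def
  proof (intro allI impI)
    fix i j assume "i < Suc m" "j < Suc m"
    then have "gs e i \<in> span (e ` {..<Suc m})" "gs e j \<in> span (e ` {..<Suc m})"
      by (simp_all add: span_base flip: gs_span[OF e])
    then show "\<omega> (gs e i) (gs e j) = 0"
      using iso by (rule_tac symplectic_eq_0_on_span[OF symp]) (auto simp: isotropic_def)
  qed
  have f_W: "\<omega> w f = 0" if "w \<in> span (e ` {..<m})" for w
    using symplectic_eq_0_on_span[OF symp, of "e ` {..<m}" "{f}" w f] that f
    by (auto simp: symplectic_perp_def span_base)
  have W_W: "\<omega> v w = 0" if "v \<in> span (e ` {..<Suc m})" "w \<in> span (e ` {..<Suc m})" for v w
    using that iso by (rule_tac symplectic_eq_0_on_span[OF symp]) (auto simp: isotropic_def)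
  have mono: "span (e ` {..<m}) \<subseteq> span (e ` {..<Suc m})" by (intro span_mono) auto
  have o_W: "?o \<in> span (e ` {..<Suc m})" by (simp add: span_base flip: gs_span[OF e])
  have o_f: "\<omega> ?o f = \<omega> (e m) f"
    using f_W[of "?o - e m"] resid_diff[OF em, where v = "e m"]
    by (simp add: gs_eq_resid[of e m] linear_diff[OF omega_lin(2)])
  define z where "z = resid e m f"
  have z_diff: "z - f \<in> span (e ` {..<m})" unfolding z_def by (rule resid_diff[OF em])
  have o_z: "\<omega> ?o z = \<omega> (e m) f"
    using W_W[OF o_W, of "z - f"] z_diff mono o_f by (auto simp: linear_diff[OF omega_lin(1)])
  have z_g: "g z (gs e j) = 0" if "j < m" for j unfolding z_def by (rule resid_orthogonal[OF em that])
  have z_\<omega>: "\<omega> (gs e j) z = 0" if "j < m" for j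
  proof -
    have "gs e j \<in> span (e ` {..<m})" using that by (simp add: span_base flip: gs_span[OF em])
    then have "\<omega> (gs e j) f = 0" "\<omega> (gs e j) (z - f) = 0"
      using f_W W_W mono z_diff by blast+
    then show ?thesis by (simp add: linear_diff[OF omega_lin(1)])
  qed
  define y where "y = z - (g z ?o / ?h) *\<^sub>R ?o - (\<omega> (e m) f / ?h) *\<^sub>R J ?o"
  have oo: "\<omega> (gs e i) (gs e j) = 0" if "i < Suc m" "j < Suc m" for i j
    using iso' that by (auto simp: isotropic_def)
  have y1: "g y (gs e j) = 0" if j: "j < Suc m" for j
  proof (cases "j = m")
    case True
    then show ?thesis using h oo[of m m]
      by (simp add: y_def g_simps g_J height_def)
  next
    case False
    then show ?thesis using j z_g[of j] gs_orthogonal[OF e lessI j] oo[OF lessI j]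
      by (simp add: y_def g_simps g_J)
  qed
  have y2: "g y (J (gs e j)) = 0" if j: "j < Suc m" for j
  proof (cases "j = m")
    case True
    then show ?thesis using h oo[of m m] o_z
      by (simp add: y_def g_J(1) omega_simps height_def flip: g_def)
  next
    case False
    then show ?thesis using j z_\<omega>[of j] gs_orthogonal[OF e j lessI] oo[OF j lessI]
      by (simp add: y_def g_J(1) omega_simps flip: g_def)
  qed
  let ?w = "\<lambda>i. if i < Suc m then gs e i else J (gs e (i - Suc m))"
  have "span (?w ` {..<2 * Suc m}) = UNIV"
  proof (rule orthogonal_lagrangian_spans[OF dim _ iso'])
    show "gs e i \<noteq> 0" if "i < Suc m" for i using height_pos[OF e that] by (auto simp: height_def g_simps)
  qed (use gs_orthogonal[OF e] in blast)
  moreover have "g y x = 0" if "x \<in> ?w ` {..<2 * Suc m}" for x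
    using that y1 y2 by auto
  ultimately have "g y y = 0"
    using linear_eq_0_on_span[OF g_linear(1)] by blast
  then have "y = 0" by (simp add: g_zero)
  then have "z = (g z ?o / ?h) *\<^sub>R ?o + (\<omega> (e m) f / ?h) *\<^sub>R J ?o"
    by (simp add: y_def algebra_simps)
  then show ?thesis unfolding z_def by blast
qed


text \<open>
  In the plane spanned by \<open>o = gs e m\<close> and \<open>J o\<close> the vector \<open>f\<close> has height \<open>M / h\<close> over the line of \<open>o\<close>, in
  units of the length of \<open>o\<close>, where \<open>h\<close> is the square of that length.  Minimality of
  \<open>e m\<close> gives \<open>h \<le> h / 4 + M\<^sup>2 / h\<close>.
\<close>

lemma height_last:
  assumes dim: "DIM('a) = 2 * Suc m" and \<Lambda>: "is_lattice \<Lambda>" and e: "reduced_frame \<Lambda> e (Suc m)"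
    and f: "f \<in> \<Lambda> \<inter> symplectic_perp \<omega> e m" and fM: "\<omega> (e m) f = M" and M: "M > 0"
  shows "height e m \<le> 2 * M"
proof -
  have prim: "primitive_frame \<Lambda> e (Suc m)" and iso: "isotropic \<omega> e (Suc m)"
    and min: "\<And>v. v \<in> \<Lambda> \<inter> symplectic_perp \<omega> e m \<Longrightarrow> v \<notin> span (e ` {..<m}) \<Longrightarrow>
        resid_norm e m (e m) \<le> resid_norm e m v"
    using e by (auto simp: reduced_frame_def)
  have tri: "\<And>j. j < Suc m \<Longrightarrow> e j \<notin> span (e ` {..<j})" using prim by (simp add: primitive_frame_def)
  let ?o = "gs e m" and ?h = "height e m"
  have h: "?h > 0" by (rule height_pos[OF tri lessI])
  obtain s where s: "resid e m f = s *\<^sub>R ?o + (M / ?h) *\<^sub>R J ?o"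
    using lagrangian_normal_decomposition[OF dim tri iso, of f] f fM by auto
  define r where "r = round s"
  let ?v = "f - of_int r *\<^sub>R e m"
  have "?v \<in> \<Lambda> \<inter> symplectic_perp \<omega> e m"
  proof
    show "?v \<in> \<Lambda>" using prim f by (intro lattice_diff_scale[OF \<Lambda>]) (auto simp: primitive_frame_def)
    show "?v \<in> symplectic_perp \<omega> e m"
      using iso f by (intro subspace_diff subspace_scale subspace_symplectic_perp symp)
        (auto simp: symplectic_perp_def isotropic_def)
  qed
  moreover have "?v \<notin> span (e ` {..<m})"
  proof
    assume v: "?v \<in> span (e ` {..<m})"
    have "\<omega> (e m) ?v = 0"
      by (rule linear_eq_0_on_span[OF omega_lin(1) _ v]) (use iso in \<open>auto simp: isotropic_def\<close>)
    then show False using fM M symplectic_self[OF symp] by (simp add: omega_simps)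
  qed
  ultimately have "resid_norm e m (e m) \<le> resid_norm e m ?v" by (rule min)
  then have "?h \<le> g (resid e m ?v) (resid e m ?v)"
    by (simp add: resid_norm_def height_def gs_eq_resid)
  also have "resid e m ?v = (s - of_int r) *\<^sub>R ?o + (M / ?h) *\<^sub>R J ?o"
    by (simp add: linear_diff[OF linear_resid] linear_scale[OF linear_resid] s
        flip: gs_eq_resid) (simp add: algebra_simps)
  also have "g \<dots> \<dots> = (s - of_int r)\<^sup>2 * ?h + (M / ?h)\<^sup>2 * ?h"
  proof -
    have "g ?o (J ?o) = 0" "g (J ?o) ?o = 0"
      using symplectic_self[OF symp] by (simp_all only: g_J(1,2))
    moreover have "g (J ?o) (J ?o) = g ?o ?o" by (rule g_J(3))
    ultimately show ?thesis by (simp add: g_simps height_def power2_eq_square)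
  qed
  also have "(s - of_int r)\<^sup>2 * ?h \<le> (1/4) * ?h"
  proof (rule mult_right_mono)
    have "\<bar>s - of_int r\<bar> \<le> 1/2" unfolding r_def using of_int_round_abs_le[of s] by (simp add: abs_minus_commute)
    then show "(s - of_int r)\<^sup>2 \<le> 1/4"
      using power_mono[of "\<bar>s - of_int r\<bar>" "1/2" 2] by (simp add: power2_eq_square)
  qed (use h in simp)
  finally have "(3/4) * ?h \<le> (M / ?h)\<^sup>2 * ?h" by simp
  then have "(3/4) * ?h * ?h \<le> M * M" using h by (simp add: power2_eq_square field_simps)
  then have "?h\<^sup>2 \<le> (2 * M)\<^sup>2" by (simp add: power2_eq_square) (use M mult_pos_pos[of M M] in linarith)
  then show ?thesis by (rule power2_le_imp_le) (use M in simp)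
qed

lemma height_bound:
  assumes dim: "DIM('a) = 2 * Suc m" and \<Lambda>: "is_lattice \<Lambda>" and e: "reduced_frame \<Lambda> e (Suc m)"
    and f: "f \<in> \<Lambda> \<inter> symplectic_perp \<omega> e m" and fM: "\<omega> (e m) f = M" and M: "M > 0"
    and j: "j \<le> m"
  shows "height e j \<le> (4/3) ^ m * (2 * M)"
proof -
  have "height e j \<le> (4/3) ^ (m - j) * (2 * M)"
    using j
  proof (induction rule: inc_induct)
    case base
    show ?case using height_last[OF assms(1-6)] by simp
  next
    case (step n)
    have "height e n \<le> (4/3) * height e (Suc n)"
      using step by (intro height_step[OF \<Lambda> e]) auto
    also have "\<dots> \<le> (4/3) * ((4/3) ^ (m - Suc n) * (2 * M))" using step.IH by (rule mult_left_mono) simp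
    also have "\<dots> = (4/3) ^ (m - n) * (2 * M)"
    proof -
      have "m - n = Suc (m - Suc n)" using step by simp
      then show ?thesis by simp
    qed
    finally show ?case .
  qed
  also have "\<dots> \<le> (4/3) ^ m * (2 * M)"
    using M by (intro mult_right_mono power_increasing) auto
  finally show ?thesis .
qed

end

lemma matrix_act_linear: "linear (matrix_act A)"
  by (rule linearI) (simp_all add: matrix_act_def complex_eq_iff algebra_simps)

lemma matrix_act_eq_0_iff:
  assumes "det A \<noteq> 0"
  shows "matrix_act A z = 0 \<longleftrightarrow> z = 0"
proof
  assume "matrix_act A z = 0"
  then have 1: "A$1$1 * Re z + A$1$2 * Im z = 0" and 2: "A$2$1 * Re z + A$2$2 * Im z = 0"
    by (simp_all add: matrix_act_def complex_eq_iff)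
  have "det A * Re z = A$2$2 * (A$1$1 * Re z + A$1$2 * Im z) - A$1$2 * (A$2$1 * Re z + A$2$2 * Im z)"
    "det A * Im z = A$1$1 * (A$2$1 * Re z + A$2$2 * Im z) - A$2$1 * (A$1$1 * Re z + A$1$2 * Im z)"
    by (simp_all add: det_2 algebra_simps)
  then have "det A * Re z = 0" "det A * Im z = 0" unfolding 1 2 by simp_all
  then show "z = 0" using assms by (simp add: complex_eq_iff)
qed (simp add: matrix_act_def complex_eq_iff)

lemma matrix_act_area: "Im (cnj (matrix_act A z) * matrix_act A w) = det A * Im (cnj z * w)"
  by (simp add: matrix_act_def det_2 algebra_simps)

text \<open>
  In units of \<open>a\<close>, the vector \<open>b\<close> can be moved by multiples of \<open>a\<close> to a point with real part at most \<open>1/2\<close>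
  and absolute value at least \<open>1\<close>, so its imaginary part is at least \<open>1/2\<close>.
\<close>

lemma planar_lattice_short_vector:
  fixes a b :: complex
  assumes a: "a \<noteq> 0" and short: "\<And>r::int. cmod a \<le> cmod (b - of_int r * a)"
  shows "(cmod a)\<^sup>2 \<le> 2 * \<bar>Im (cnj a * b)\<bar>"
proof -
  define q where "q = b / a"
  define r where "r = round (Re q)"
  have b: "b = q * a" using a by (simp add: q_def)
  have "cmod a \<le> cmod (q - of_int r) * cmod a"
    using short[of r] by (simp add: b norm_mult flip: left_diff_distrib)
  then have "1 \<le> cmod (q - of_int r)" using a by simp
  then have "1 \<le> (cmod (q - of_int r))\<^sup>2" by simp
  also have "\<dots> = (Re q - of_int r)\<^sup>2 + (Im q)\<^sup>2" by (simp add: cmod_power2)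
  also have "(Re q - of_int r)\<^sup>2 \<le> 1/4"
    using power_mono[of "\<bar>Re q - of_int r\<bar>" "1/2" 2] of_int_round_abs_le[of "Re q"]
    by (simp add: r_def power2_eq_square abs_minus_commute)
  finally have "(1/2)\<^sup>2 \<le> \<bar>Im q\<bar>\<^sup>2" by (simp add: power2_eq_square)
  then have t: "1/2 \<le> \<bar>Im q\<bar>" by (rule power2_le_imp_le) simp
  have "cnj a * b = of_real ((cmod a)\<^sup>2) * q"
    by (simp only: b complex_norm_square) simp
  then have "\<bar>Im (cnj a * b)\<bar> = (cmod a)\<^sup>2 * \<bar>Im q\<bar>" by (simp add: abs_mult)
  moreover have "(cmod a)\<^sup>2 * (1/2) \<le> (cmod a)\<^sup>2 * \<bar>Im q\<bar>" using t by (intro mult_left_mono) auto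
  ultimately show ?thesis by simp
qed

section \<open>A Lagrangian frame on which the form is small\<close>

text \<open>
  An integral combination lies in the span of the first \<open>m\<close> vectors only if its last coefficient is
  zero.
\<close>

lemma primitive_frame_drop_last:
  assumes prim: "primitive_frame \<Lambda> e (Suc m)"
  shows "primitive_frame \<Lambda> e m"
proof -
  have "\<exists>c :: nat \<Rightarrow> int. v = (\<Sum>j<m. of_int (c j) *\<^sub>R e j)"
    if v\<Lambda>: "v \<in> \<Lambda>" and v: "v \<in> span (e ` {..<m})" for v
  proof -
    have "span (e ` {..<m}) \<subseteq> span (e ` {..<Suc m})" by (intro span_mono) auto
    then obtain c :: "nat \<Rightarrow> int" where c: "v = (\<Sum>j<Suc m. of_int (c j) *\<^sub>R e j)"
      using prim v\<Lambda> v unfolding primitive_frame_def by blast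
    have "c m = 0"
    proof (rule ccontr)
      assume nz: "c m \<noteq> 0"
      have "(\<Sum>j<m. of_int (c j) *\<^sub>R e j) \<in> span (e ` {..<m})"
        by (intro span_sum span_scale span_base) auto
      from span_diff[OF v this] have "of_int (c m) *\<^sub>R e m \<in> span (e ` {..<m})"
        by (simp add: c)
      from span_scale[OF this, of "1 / of_int (c m)"] have "e m \<in> span (e ` {..<m})"
        using nz by simp
      then show False using prim by (simp add: primitive_frame_def)
    qed
    then show ?thesis using c by auto
  qed
  then show ?thesis using prim by (simp add: primitive_frame_def)
qed

definition unitary_frame :: "('a \<Rightarrow> 'a \<Rightarrow> real) \<Rightarrow> ('a \<Rightarrow> 'a) \<Rightarrow> nat \<Rightarrow> (nat \<Rightarrow> 'a) \<Rightarrow> bool" where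
  "unitary_frame \<omega> J n x \<longleftrightarrow>
     isotropic \<omega> x n \<and> (\<forall>j<n. \<forall>k<n. \<omega> (x j) (J (x k)) = (if j = k then 1 else 0))"

lemma isotropic_span_lagrangian:
  fixes e :: "nat \<Rightarrow> 'a::euclidean_space"
  assumes \<omega>: "symplectic_form \<omega>" and dim: "DIM('a) = 2 * n" and e: "\<And>j. j < n \<Longrightarrow> e j \<notin> span (e ` {..<j})"
    and iso: "isotropic \<omega> e n"
  shows "lagrangian_subspace \<omega> (span (e ` {..<n}))"
proof -
  have "inj_on e {..<n} \<and> independent (e ` {..<n})" by (rule triangular_independent[OF e])
  then have "dim (span (e ` {..<n})) = n"
    by (simp add: dim_eq_card_independent card_image)
  moreover have "\<omega> v w = 0" if "v \<in> span (e ` {..<n})" "w \<in> span (e ` {..<n})" for v w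
    by (rule symplectic_eq_0_on_span[OF \<omega> _ that]) (use iso in \<open>auto simp: isotropic_def\<close>)
  ultimately show ?thesis using dim by (simp add: lagrangian_subspace_def)
qed

lemma U_forms_alternating: "\<Omega> \<in> U_forms n \<omega> \<Longrightarrow> alternating_form n \<Omega>"
  by (rule alternating_form_complexI)
    (simp_all add: U_forms_def complex_primitive_forms_def primitive_forms_def)

lemma U_forms_nonzero_on_frame:
  fixes e :: "nat \<Rightarrow> 'a::euclidean_space"
  assumes \<Omega>: "\<Omega> \<in> U_forms n \<omega>" and L: "lagrangian_subspace \<omega> (span (e ` {..<n}))"
  shows "\<Omega> e \<noteq> 0"
proof
  assume "\<Omega> e = 0"
  obtain v where v: "\<forall>i<n. v i \<in> span (e ` {..<n})" "\<Omega> v \<noteq> 0"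
    using \<Omega> L by (auto simp: U_forms_def)
  then show False
    using alternating_form_eq_0_on_span[OF U_forms_alternating[OF \<Omega>] \<open>\<Omega> e = 0\<close>] by blast
qed

lemma alternating_form_matrix_act:
  "alternating_form k \<Omega> \<Longrightarrow> alternating_form k (\<lambda>v. matrix_act A (\<Omega> v))"
  by (rule alternating_form_compose_linear[OF _ matrix_act_linear])

context compatible_structure
begin

lemma unitary_frame_of_gs:
  assumes e: "\<And>j. j < n \<Longrightarrow> e j \<notin> span (e ` {..<j})" and iso: "isotropic \<omega> e n"
  shows "unitary_frame \<omega> J n (\<lambda>j. (1 / sqrt (height e j)) *\<^sub>R gs e j)"
  unfolding unitary_frame_def
proof (intro conjI allI impI)
  have gs: "gs e i \<in> span (e ` {..<n})" if "i < n" for i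
    using that by (simp add: span_base flip: gs_span[OF e])
  show "isotropic \<omega> (\<lambda>j. (1 / sqrt (height e j)) *\<^sub>R gs e j) n"
    unfolding isotropic_def
  proof (intro allI impI)
    fix i j assume "i < n" "j < n"
    show "\<omega> ((1 / sqrt (height e i)) *\<^sub>R gs e i) ((1 / sqrt (height e j)) *\<^sub>R gs e j) = 0"
      by (rule symplectic_eq_0_on_span[OF symp _ span_scale[OF gs[OF \<open>i < n\<close>]] span_scale[OF gs[OF \<open>j < n\<close>]]])
        (use iso in \<open>auto simp: isotropic_def\<close>)
  qed
  fix i j assume i: "i < n" and j: "j < n"
  have "\<omega> ((1 / sqrt (height e i)) *\<^sub>R gs e i) (J ((1 / sqrt (height e j)) *\<^sub>R gs e j)) =
      g (gs e i) (gs e j) / (sqrt (height e i) * sqrt (height e j))"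
    by (simp add: g_simps flip: g_def)
  also have "\<dots> = (if i = j then 1 else 0)"
  proof (cases "i = j")
    case True
    then show ?thesis using height_pos[OF e j] by (simp add: height_def)
  next
    case False
    then show ?thesis using gs_orthogonal[OF e i j] by simp
  qed
  finally show "\<omega> ((1 / sqrt (height e i)) *\<^sub>R gs e i) (J ((1 / sqrt (height e j)) *\<^sub>R gs e j)) =
      (if i = j then 1 else 0)" .
qed

text \<open>
  Passing to the Gram--Schmidt vectors does not change the value, and normalising them divides it by
  their lengths.
\<close>

lemma alternating_form_frame_value:
  fixes \<Omega> :: "(nat \<Rightarrow> 'a) \<Rightarrow> complex"
  assumes \<Omega>: "alternating_form n \<Omega>" and e: "\<And>j. j < n \<Longrightarrow> e j \<notin> span (e ` {..<j})"
  shows "(cmod (\<Omega> e))\<^sup>2 = (\<Prod>j<n. height e j) * (cmod (\<Omega> (\<lambda>j. (1 / sqrt (height e j)) *\<^sub>R gs e j)))\<^sup>2"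
proof -
  have "gs e j - e j \<in> span (gs e ` {..<j})" if "j < n" for j
  proof -
    have tri: "\<And>i. i < j \<Longrightarrow> e i \<notin> span (e ` {..<i})" using e that by simp
    have "span (gs e ` {..<j}) = span (e ` {..<j})" by (rule gs_span[OF tri])
    moreover have "resid e j (e j) - e j \<in> span (e ` {..<j})" by (rule resid_diff[OF tri])
    ultimately show ?thesis using gs_eq_resid[of e j] by simp
  qed
  then have "\<Omega> e = \<Omega> (gs e)" by (rule alternating_form_triangular_change[OF \<Omega>, symmetric])
  also have "\<dots> = \<Omega> (\<lambda>j. sqrt (height e j) *\<^sub>R ((1 / sqrt (height e j)) *\<^sub>R gs e j))"
    using height_pos[OF e] by (intro alternating_form_cong[OF \<Omega>]) (simp add: order.strict_implies_not_eq[OF _, symmetric] less_imp_neq)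
  also have "\<dots> = (\<Prod>j<n. sqrt (height e j)) *\<^sub>R \<Omega> (\<lambda>j. (1 / sqrt (height e j)) *\<^sub>R gs e j)"
    by (rule alternating_form_scale_args[OF \<Omega>])
  finally have "(cmod (\<Omega> e))\<^sup>2 =
      (\<Prod>j<n. sqrt (height e j))\<^sup>2 * (cmod (\<Omega> (\<lambda>j. (1 / sqrt (height e j)) *\<^sub>R gs e j)))\<^sup>2"
    by (simp add: power_mult_distrib)
  also have "(\<Prod>j<n. sqrt (height e j))\<^sup>2 = (\<Prod>j<n. (sqrt (height e j))\<^sup>2)"
    by (simp add: prod_power_distrib)
  also have "\<dots> = (\<Prod>j<n. height e j)"
    using height_pos[OF e] by (intro prod.cong) (auto simp: less_imp_le)
  finally show ?thesis .
qed

text \<open>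
  Modulo the first \<open>m\<close> vectors \<open>f\<close> is a complex multiple of \<open>e m\<close>, and \<open>\<Omega>\<close> is complex linear.
\<close>

lemma last_vector_area:
  assumes dim: "DIM('a) = 2 * Suc m" and e: "\<And>j. j < Suc m \<Longrightarrow> e j \<notin> span (e ` {..<j})"
    and iso: "isotropic \<omega> e (Suc m)" and f: "f \<in> symplectic_perp \<omega> e m"
    and \<Omega>: "alternating_form (Suc m) \<Omega>" and type: "type_n_0 (Suc m) J \<Omega>"
  shows "Im (cnj (\<Omega> e) * \<Omega> (e(m := f))) = (cmod (\<Omega> e))\<^sup>2 * (\<omega> (e m) f / height e m)"
proof -
  let ?F = "\<lambda>v. \<Omega> (e(m := v))" and ?t = "\<omega> (e m) f / height e m"
  have em: "\<And>j. j < m \<Longrightarrow> e j \<notin> span (e ` {..<j})" using e by simp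
  have lin: "linear ?F" by (rule alternating_form_linear[OF \<Omega> lessI])
  have F0: "?F w = 0" if "w \<in> span (e ` {..<m})" for w
    by (rule alternating_form_update_in_span[OF \<Omega> lessI _ that]) auto
  have F_resid: "?F (resid e m v) = ?F v" for v
    using F0[OF resid_diff[OF em, where v = v]] by (simp add: linear_diff[OF lin])
  obtain s where s: "resid e m f = s *\<^sub>R gs e m + ?t *\<^sub>R J (gs e m)"
    using lagrangian_normal_decomposition[OF dim e iso f] by blast
  have F_gs: "?F (gs e m) = \<Omega> e"
    unfolding gs_eq_resid F_resid by simp
  have "?F (gs e m) + \<i> * ?F (J (gs e m)) = 0"
    using type by (simp add: type_n_0_def)
  then have "\<i> * (?F (gs e m) + \<i> * ?F (J (gs e m))) = 0" by simp
  then have "?F (J (gs e m)) = \<i> * \<Omega> e" unfolding F_gs by (simp add: algebra_simps)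
  then have "?F f = (of_real s + \<i> * of_real ?t) * \<Omega> e"
    by (simp add: F_resid[of f, symmetric] s linear_add[OF lin] linear_scale[OF lin] F_gs
        scaleR_conv_of_real algebra_simps)
  then have "cnj (\<Omega> e) * ?F f = of_real ((cmod (\<Omega> e))\<^sup>2) * (of_real s + \<i> * of_real ?t)"
    by (simp only: complex_norm_square) (simp add: mult_ac)
  then show ?thesis by simp
qed

text \<open>
  A constant \<open>M\<close> as in \<open>symplectic_dual_lattice_vectors\<close> is independent of \<open>J\<close>, \<open>\<Omega>\<close> and \<open>A\<close>, so the
  bound is uniform.  All but the last vector of the frame come from a reduced frame.
\<close>

lemma short_lagrangian_frame_bound:
  assumes dim: "DIM('a) = 2 * Suc m" and torus: "rational_symplectic_torus \<omega> \<Lambda>"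
    and M: "M > 0" "\<And>e i. primitive_frame \<Lambda> e DIM('a) \<Longrightarrow> i < DIM('a) \<Longrightarrow>
      \<exists>f\<in>\<Lambda>. \<forall>j<DIM('a). \<omega> (e j) f = (if j = i then M else 0)"
    and \<Omega>: "\<Omega> \<in> U_forms (Suc m) \<omega>" and type: "type_n_0 (Suc m) J \<Omega>" and A: "det A \<noteq> 0"
  shows "\<exists>e x. primitive_frame \<Lambda> e (Suc m) \<and> isotropic \<omega> e (Suc m) \<and> unitary_frame \<omega> J (Suc m) x \<and>
     (cmod (matrix_act A (\<Omega> e)))\<^sup>2 \<le> 2 * M * ((4/3) ^ m * (2 * M)) ^ m * \<bar>det A\<bar> * (cmod (\<Omega> x))\<^sup>2"
proof -
  have \<Lambda>: "is_lattice \<Lambda>" using torus by (simp add: rational_symplectic_torus_def)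
  obtain e where red: "reduced_frame \<Lambda> e (Suc m)"
    using reduced_frame_exists[OF torus, of "Suc m"] dim by auto
  then have prim: "primitive_frame \<Lambda> e (Suc m)" and iso: "isotropic \<omega> e (Suc m)"
    by (auto simp: reduced_frame_def)
  have tri: "\<And>j. j < Suc m \<Longrightarrow> e j \<notin> span (e ` {..<j})" using prim by (simp add: primitive_frame_def)
  have dual: "\<exists>f\<in>\<Lambda> \<inter> symplectic_perp \<omega> u m. \<omega> (u m) f = M" if u: "primitive_frame \<Lambda> u (Suc m)" for u
  proof -
    obtain u' where u': "\<And>j. j < Suc m \<Longrightarrow> u' j = u j" "primitive_frame \<Lambda> u' DIM('a)"
      using primitive_frame_extends_to_basis[OF \<Lambda> u] dim by (metis le_add1 mult_2)
    obtain f where f: "f \<in> \<Lambda>" "\<And>j. j < DIM('a) \<Longrightarrow> \<omega> (u' j) f = (if j = m then M else 0)"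
      using M(2)[OF u'(2), of m] dim by auto
    have "\<omega> (u j) f = (if j = m then M else 0)" if "j < Suc m" for j
      using f(2)[of j] u'(1)[OF that] that dim by simp
    then show ?thesis using f(1) by (intro bexI[of _ f]) (auto simp: symplectic_perp_def)
  qed
  obtain f0 where f0: "f0 \<in> \<Lambda> \<inter> symplectic_perp \<omega> e m" "\<omega> (e m) f0 = M" using dual[OF prim] by blast
  \<comment> \<open>The common bound of the heights.\<close>
  define K where "K = (4/3) ^ m * (2 * M)"
  have K: "height e j \<le> K" if "j \<le> m" for j
    unfolding K_def by (rule height_bound[OF dim \<Lambda> red f0 M(1) that])
  have prim_m: "primitive_frame \<Lambda> e m" by (rule primitive_frame_drop_last[OF prim])
  have iso_m: "isotropic \<omega> e m" using iso by (simp add: isotropic_def)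
  have alt: "alternating_form (Suc m) \<Omega>" by (rule U_forms_alternating[OF \<Omega>])
  let ?\<Psi> = "\<lambda>v. matrix_act A (\<Omega> v)"
  note alt' = alternating_form_matrix_act[OF alt, of A]
  define F where "F v = ?\<Psi> (e(m := v))" for v
  have lin: "linear F" unfolding F_def by (rule alternating_form_linear[OF alt' lessI])
  have semi: "seminorm (\<lambda>v. cmod (F v))"
    by (simp add: seminorm_def linear_add[OF lin] linear_scale[OF lin] norm_triangle_ineq)
  have img: "(e(m := v)) ` {..<j} = e ` {..<j}" if "j \<le> m" for v j using that by auto
  have tri': "(e(m := v)) j \<notin> span ((e(m := v)) ` {..<j})"
    if "v \<notin> span (e ` {..<m})" "j < Suc m" for v j
    using that tri[of j] img[of j v] by (cases "j = m") auto
  have ker: "cmod (F v) = 0 \<longleftrightarrow> v \<in> span (e ` {..<m})" if v: "v \<in> symplectic_perp \<omega> e m" for v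
  proof
    assume "v \<in> span (e ` {..<m})"
    then have "F v = 0"
      unfolding F_def by (intro alternating_form_update_in_span[OF alt' lessI, of "{..<m}"]) auto
    then show "cmod (F v) = 0" by simp
  next
    assume "cmod (F v) = 0"
    then have 0: "\<Omega> (e(m := v)) = 0" using matrix_act_eq_0_iff[OF A] by (simp add: F_def)
    show "v \<in> span (e ` {..<m})"
    proof (rule ccontr)
      assume "v \<notin> span (e ` {..<m})"
      then have "lagrangian_subspace \<omega> (span ((e(m := v)) ` {..<Suc m}))"
        by (intro isotropic_span_lagrangian[OF symp dim] tri' isotropic_extend[OF iso_m v])
      from U_forms_nonzero_on_frame[OF \<Omega> this] 0 show False by simp
    qed
  qed
  note P = subspace_symplectic_perp[OF symp, of e m] and WP = isotropic_span_perp[OF symp iso_m]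
  have ex: "\<exists>v\<in>\<Lambda> \<inter> symplectic_perp \<omega> e m. v \<notin> span (e ` {..<m})"
    using prim iso tri[OF lessI] by (intro bexI[of _ "e m"])
      (auto simp: primitive_frame_def symplectic_perp_def isotropic_def)
  \<comment> \<open>The last vector \<open>e m\<close> of the reduced frame has served to bound the other heights.  It is replaced
    by a vector which is shortest for the form itself.\<close>
  obtain y where y: "y \<in> \<Lambda> \<inter> symplectic_perp \<omega> e m" "y \<notin> span (e ` {..<m})"
      "\<And>v. v \<in> \<Lambda> \<inter> symplectic_perp \<omega> e m \<Longrightarrow> v \<notin> span (e ` {..<m}) \<Longrightarrow> cmod (F y) \<le> cmod (F v)"
    by (rule shortest_lattice_vector_modulo[OF \<Lambda> prim_m P WP semi ker ex], assumption) (rule that)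
  define u where "u = e(m := y)"
  have u_prim: "primitive_frame \<Lambda> u (Suc m)"
    unfolding u_def by (rule primitive_frame_extend_shortest[OF \<Lambda> prim_m P WP semi ker y])
  have u_iso: "isotropic \<omega> u (Suc m)"
    unfolding u_def using y(1) by (intro isotropic_extend iso_m) auto
  have u_tri: "\<And>j. j < Suc m \<Longrightarrow> u j \<notin> span (u ` {..<j})" using u_prim by (simp add: primitive_frame_def)
  obtain f where f: "f \<in> \<Lambda> \<inter> symplectic_perp \<omega> u m" "\<omega> (u m) f = M" using dual[OF u_prim] by blast
  have f_perp: "f \<in> symplectic_perp \<omega> e m" using f(1) by (auto simp: symplectic_perp_def u_def)
  have y_e: "\<omega> y (e j) = 0" if "j < m" for j
    using u_iso that unfolding isotropic_def u_def
    by (metis fun_upd_other fun_upd_same lessI less_SucI less_irrefl)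
  have Fy: "F y = ?\<Psi> u" by (simp add: F_def u_def)
  have "cmod (F y) \<le> cmod (F f - of_int r * F y)" for r :: int
  proof -
    let ?v = "f - of_int r *\<^sub>R y"
    have "?v \<in> \<Lambda> \<inter> symplectic_perp \<omega> e m"
      using f(1) y(1) f_perp
      by (intro IntI lattice_diff_scale[OF \<Lambda>] subspace_diff[OF P] subspace_scale[OF P]) auto
    moreover have "?v \<notin> span (e ` {..<m})"
    proof
      assume v: "?v \<in> span (e ` {..<m})"
      have "\<omega> y ?v = 0"
        by (rule linear_eq_0_on_span[OF omega_lin(1) _ v])
          (use y_e in auto)
      then show False using f(2) M(1) symplectic_self[OF symp] by (simp add: omega_simps u_def)
    qed
    ultimately have "cmod (F y) \<le> cmod (F ?v)" by (rule y(3))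
    then show ?thesis
      by (simp add: linear_diff[OF lin] linear_scale[OF lin] scaleR_conv_of_real)
  qed
  moreover have "F y \<noteq> 0" using ker[of y] y by auto
  ultimately have "(cmod (F y))\<^sup>2 \<le> 2 * \<bar>Im (cnj (F y) * F f)\<bar>"
    by (intro planar_lattice_short_vector)
  also have "Im (cnj (F y) * F f) = det A * Im (cnj (\<Omega> u) * \<Omega> (u(m := f)))"
    unfolding F_def u_def fun_upd_upd by (rule matrix_act_area)
  also have "\<dots> = det A * ((cmod (\<Omega> u))\<^sup>2 * (M / height u m))"
    using last_vector_area[OF dim u_tri u_iso _ alt type, of f] f by simp
  also have "(cmod (\<Omega> u))\<^sup>2 * (M / height u m) =
      M * (\<Prod>j<m. height e j) * (cmod (\<Omega> (\<lambda>j. (1 / sqrt (height u j)) *\<^sub>R gs u j)))\<^sup>2"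
  proof -
    have "height u j = height e j" if "j < m" for j
      unfolding height_def using that gs_cong[of j u e] by (simp add: u_def)
    then have "(\<Prod>j<Suc m. height u j) = (\<Prod>j<m. height e j) * height u m" by simp
    moreover have "height u m > 0" by (rule height_pos[OF u_tri lessI])
    ultimately show ?thesis
      using alternating_form_frame_value[OF alt u_tri] by simp
  qed
  finally have "(cmod (?\<Psi> u))\<^sup>2 \<le> 2 * (\<bar>det A\<bar> * (M * (\<Prod>j<m. height e j) *
      (cmod (\<Omega> (\<lambda>j. (1 / sqrt (height u j)) *\<^sub>R gs u j)))\<^sup>2))"
    unfolding Fy using M(1) by (simp add: abs_mult height_def g_nonneg prod_nonneg)
  also have "\<dots> \<le> 2 * (\<bar>det A\<bar> * (M * K ^ m * (cmod (\<Omega> (\<lambda>j. (1 / sqrt (height u j)) *\<^sub>R gs u j)))\<^sup>2))"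
  proof -
    have "(\<Prod>j<m. height e j) \<le> (\<Prod>j<m. K)"
      using K by (intro prod_mono) (auto simp: height_def g_nonneg)
    then show ?thesis using M(1) by (intro mult_left_mono mult_right_mono) auto
  qed
  finally have "(cmod (?\<Psi> u))\<^sup>2 \<le> 2 * M * K ^ m * \<bar>det A\<bar> *
      (cmod (\<Omega> (\<lambda>j. (1 / sqrt (height u j)) *\<^sub>R gs u j)))\<^sup>2"
    by (simp add: mult_ac)
  then show ?thesis
    using u_prim u_iso unitary_frame_of_gs[OF u_tri u_iso] unfolding K_def by blast
qed

end

section \<open>The wedge product of a form of type (n, 0) with its conjugate\<close>

text \<open>
  The argument list \<open>x 0, \<dots>, x (n - 1), y 0, \<dots>, y (n - 1)\<close>.
\<close>

definition block :: "nat \<Rightarrow> (nat \<Rightarrow> 'a) \<Rightarrow> (nat \<Rightarrow> 'a) \<Rightarrow> nat \<Rightarrow> 'a" where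
  "block n x y i = (if i < n then x i else y (i - n))"

text \<open>
  Here \<open>\<epsilon>1\<close> and \<open>\<epsilon>2\<close> are \<open>\<plusminus>\<i>\<close>, according to whether the form has type \<open>(n, 0)\<close> or \<open>(0, n)\<close>, and
  \<open>\<delta>\<close> is their quotient, which is its own inverse.  Exchange \<open>x\<^sub>j\<close> and \<open>J x\<^sub>j\<close>.  If they are arguments of
  the same form, the term is zero since that form depends on them through the complex line only.
  Otherwise one form gains a factor \<open>\<epsilon>1\<close> or \<open>\<epsilon>2\<close>, the other one loses a factor, and the permutation
  changes its sign.
\<close>

lemma wedge_term_swap_pair:
  fixes \<Psi>1 \<Psi>2 :: "(nat \<Rightarrow> 'a::real_vector) \<Rightarrow> complex"
  assumes alt: "alternating_form n \<Psi>1" "alternating_form n \<Psi>2"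
    and J1: "\<And>v x i. i < n \<Longrightarrow> \<Psi>1 (v(i := J x)) = \<epsilon>1 * \<Psi>1 (v(i := x))"
    and J2: "\<And>v x i. i < n \<Longrightarrow> \<Psi>2 (v(i := J x)) = \<epsilon>2 * \<Psi>2 (v(i := x))"
    and \<epsilon>: "\<epsilon>1 = \<delta> * \<epsilon>2" "\<epsilon>2 = \<delta> * \<epsilon>1"
    and \<sigma>: "\<sigma> permutes {..<n + n}" and j: "j < n"
    and u: "u = block n x (\<lambda>i. J (x i))"
    and t_def: "\<And>\<sigma>. t \<sigma> = of_int (sign \<sigma>) * \<Psi>1 (\<lambda>i. u (\<sigma> i)) * \<Psi>2 (\<lambda>i. u (\<sigma> (n + i)))"
  shows "t (Transposition.transpose j (n + j) \<circ> \<sigma>) = - \<delta> * t \<sigma>"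
    and "inv \<sigma> j < n \<Longrightarrow> inv \<sigma> (n + j) < n \<Longrightarrow> t \<sigma> = 0"
proof -
  let ?s = "Transposition.transpose j (n + j)"
  define a b where "a = inv \<sigma> j" and "b = inv \<sigma> (n + j)"
  have ab: "\<sigma> a = j" "\<sigma> b = n + j" using permutes_inverses(1)[OF \<sigma>] by (auto simp: a_def b_def)
  have ab_less: "a < n + n" "b < n + n"
    using permutes_in_image[OF permutes_inv[OF \<sigma>]] j by (auto simp: a_def b_def)
  have "a \<noteq> b" using ab j by auto
  have eq_iff: "\<sigma> i = j \<longleftrightarrow> i = a" "\<sigma> i = n + j \<longleftrightarrow> i = b" for i
    using inj_eq[OF permutes_inj[OF \<sigma>], of i a] inj_eq[OF permutes_inj[OF \<sigma>], of i b] ab by simp_all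
  have u_j: "u j = x j" "u (n + j) = J (x j)" using j by (auto simp: u block_def)
  have us: "u (?s (\<sigma> i)) = (if i = a then J (x j) else if i = b then x j else u (\<sigma> i))" for i
    using eq_iff[of i] u_j j by (auto simp: Transposition.transpose_def)
  have u\<sigma>: "u (\<sigma> a) = x j" "u (\<sigma> b) = J (x j)" using ab u_j by auto
  have sgn: "sign (?s \<circ> \<sigma>) = - sign \<sigma>"
    using j permutes_imp_permutation[OF _ \<sigma>] by (simp add: sign_compose sign_swap_id permutation_swap_id)
  let ?V = "\<lambda>i. u (\<sigma> i)" and ?W = "\<lambda>i. u (\<sigma> (n + i))"
  let ?V' = "\<lambda>i. u (?s (\<sigma> i))" and ?W' = "\<lambda>i. u (?s (\<sigma> (n + i)))"
  have t': "t (?s \<circ> \<sigma>) = - of_int (sign \<sigma>) * \<Psi>1 ?V' * \<Psi>2 ?W'"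
    unfolding t_def sgn by simp
  have both1: "\<Psi>1 v = 0" if "v a = x j" "v b = J (x j) \<or> v b = x j" "a < n" "b < n" for v
  proof -
    have "\<Psi>1 (v(b := x j)) = 0"
      using that \<open>a \<noteq> b\<close> by (intro alternating_form_repeat[OF alt(1), of a b]) auto
    moreover from this have "\<Psi>1 (v(b := J (x j))) = 0" by (simp add: J1[OF that(4)])
    ultimately show ?thesis using that(2) by (elim disjE) (simp_all add: fun_upd_idem)
  qed
  have both1': "\<Psi>1 v = 0" if "v a = J (x j)" "v b = x j" "a < n" "b < n" for v
  proof -
    have "\<Psi>1 (v(a := x j)) = 0"
      using that \<open>a \<noteq> b\<close> by (intro alternating_form_repeat[OF alt(1), of a b]) auto
    then have "\<Psi>1 (v(a := J (x j))) = 0" by (simp add: J1[OF that(3)])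
    then show ?thesis using that(1) by (simp add: fun_upd_idem)
  qed
  have both2: "\<Psi>2 v = 0"
    if "{v (a - n), v (b - n)} = {x j, J (x j)}" "a \<ge> n" "b \<ge> n" for v
  proof -
    have ab': "a - n < n" "b - n < n" "a - n \<noteq> b - n" using that ab_less \<open>a \<noteq> b\<close> by auto
    have "v (a - n) = J (x j) \<and> v (b - n) = x j \<or> v (a - n) = x j \<and> v (b - n) = J (x j)"
      using that(1) by (auto simp: doubleton_eq_iff)
    then show ?thesis
    proof
      assume *: "v (a - n) = J (x j) \<and> v (b - n) = x j"
      then have "\<Psi>2 (v(a - n := x j)) = 0"
        using ab' by (intro alternating_form_repeat[OF alt(2), of "a - n" "b - n"]) auto
      then have "\<Psi>2 (v(a - n := J (x j))) = 0" by (simp add: J2[OF ab'(1)])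
      then show ?thesis using * by (simp add: fun_upd_idem)
    next
      assume *: "v (a - n) = x j \<and> v (b - n) = J (x j)"
      then have "\<Psi>2 (v(b - n := x j)) = 0"
        using ab' by (intro alternating_form_repeat[OF alt(2), of "a - n" "b - n"]) auto
      then have "\<Psi>2 (v(b - n := J (x j))) = 0" by (simp add: J2[OF ab'(2)])
      then show ?thesis using * by (simp add: fun_upd_idem)
    qed
  qed
  show "t \<sigma> = 0" if "inv \<sigma> j < n" "inv \<sigma> (n + j) < n"
    using both1[of ?V] that u\<sigma> by (simp add: t_def a_def b_def)
  consider "a < n" "b < n" | "a \<ge> n" "b \<ge> n" | "a < n" "b \<ge> n" | "a \<ge> n" "b < n" by linarith
  then show "t (?s \<circ> \<sigma>) = - \<delta> * t \<sigma>"
  proof cases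
    case 1
    then show ?thesis
      using both1[of ?V] both1'[of ?V'] u\<sigma> us[of a] us[of b] \<open>a \<noteq> b\<close> unfolding t' by (simp add: t_def)
  next
    case 2
    then have "\<Psi>2 ?W = 0" "\<Psi>2 ?W' = 0"
      using u\<sigma> us[of a] us[of b] \<open>a \<noteq> b\<close> by (intro both2; auto)+
    then show ?thesis unfolding t' by (simp add: t_def)
  next
    case 3
    have b': "b - n < n" "n + (b - n) = b" using 3 ab_less by auto
    have "\<Psi>1 ?V' = \<Psi>1 (?V(a := J (x j)))"
      using 3 us by (intro alternating_form_cong[OF alt(1)]) auto
    moreover have "\<Psi>1 (?V(a := x j)) = \<Psi>1 ?V" using u\<sigma> by (simp add: fun_upd_idem)
    moreover have "\<Psi>2 ?W' = \<Psi>2 (?W(b - n := x j))"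
      using 3 us b' by (intro alternating_form_cong[OF alt(2)]) auto
    moreover have "\<Psi>2 (?W(b - n := J (x j))) = \<Psi>2 ?W"
      using u\<sigma> b' by (intro arg_cong[of _ _ \<Psi>2]) auto
    ultimately show ?thesis
      using J1[OF 3(1), of ?V "x j"] J2[OF b'(1), of ?W "x j"] unfolding t' by (simp add: t_def \<epsilon>(1))
  next
    case 4
    have a': "a - n < n" "n + (a - n) = a" using 4 ab_less by auto
    have V': "\<Psi>1 ?V' = \<Psi>1 (?V(b := x j))"
      using 4 us by (intro alternating_form_cong[OF alt(1)]) auto
    have "?V(b := J (x j)) = ?V" using u\<sigma> by (simp add: fun_upd_idem)
    then have V: "\<Psi>1 ?V = \<epsilon>1 * \<Psi>1 (?V(b := x j))"
      using J1[OF 4(2), of ?V "x j"] by simp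
    have "\<Psi>2 ?W' = \<Psi>2 (?W(a - n := J (x j)))"
      using 4 us a' by (intro alternating_form_cong[OF alt(2)]) auto
    moreover have "?W(a - n := x j) = ?W"
      using u\<sigma> a' by (intro fun_upd_idem) simp
    ultimately have W': "\<Psi>2 ?W' = \<epsilon>2 * \<Psi>2 ?W"
      using J2[OF a'(1), of ?W "x j"] by simp
    show ?thesis unfolding t' t_def[of \<sigma>] V V' W' by (simp add: \<epsilon>(2))
  qed
qed

text \<open>
  A permutation which preserves both halves is a product of permutations of the halves, and each of the
  two forms absorbs the sign of one of them.
\<close>

lemma wedge_term_preserving_halves:
  fixes \<Psi>1 \<Psi>2 :: "(nat \<Rightarrow> 'a::real_vector) \<Rightarrow> complex"
  assumes alt: "alternating_form n \<Psi>1" "alternating_form n \<Psi>2"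
    and \<sigma>: "\<sigma> permutes {..<n + n}" and half: "\<And>i. i < n \<Longrightarrow> \<sigma> i < n"
  shows "of_int (sign \<sigma>) * \<Psi>1 (\<lambda>i. u (\<sigma> i)) * \<Psi>2 (\<lambda>i. u (\<sigma> (n + i))) = \<Psi>1 u * \<Psi>2 (\<lambda>i. u (n + i))"
proof -
  define \<tau>1 where "\<tau>1 i = (if i < n then \<sigma> i else i)" for i
  have inj: "inj \<sigma>" by (rule permutes_inj[OF \<sigma>])
  have "inj_on \<tau>1 {..<n}" using inj by (auto simp: \<tau>1_def inj_on_def)
  moreover have "\<tau>1 ` {..<n} \<subseteq> {..<n}" using half by (auto simp: \<tau>1_def)
  ultimately have "bij_betw \<tau>1 {..<n} {..<n}" by (simp add: bij_betw_def endo_inj_surj)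
  then have \<tau>1: "\<tau>1 permutes {..<n}" by (rule bij_imp_permutes) (simp add: \<tau>1_def)
  define \<tau>2 where "\<tau>2 = inv \<tau>1 \<circ> \<sigma>"
  have \<tau>1': "\<tau>1 permutes {..<n + n}" using \<tau>1 by (rule permutes_subset) auto
  have \<tau>2_all: "\<tau>2 permutes {..<n + n}"
    unfolding \<tau>2_def by (intro permutes_compose \<sigma> permutes_inv \<tau>1')
  have "\<tau>2 i = i" if "i < n" for i
    using that permutes_inverses(2)[OF \<tau>1, of i] by (simp add: \<tau>2_def \<tau>1_def)
  then have \<tau>2: "\<tau>2 permutes {n..<n + n}"
    by (intro permutes_superset[OF \<tau>2_all]) auto
  have \<sigma>_eq: "\<sigma> = \<tau>1 \<circ> \<tau>2"
    using permutes_inverses(1)[OF \<tau>1] by (auto simp: \<tau>2_def fun_eq_iff)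
  have "sign \<sigma> = sign \<tau>1 * sign \<tau>2"
    unfolding \<sigma>_eq using \<tau>1 \<tau>2 by (intro sign_compose permutes_imp_permutation) auto
  moreover have "\<Psi>1 (\<lambda>i. u (\<sigma> i)) = of_int (sign \<tau>1) *\<^sub>R \<Psi>1 u"
  proof -
    have "\<Psi>1 (\<lambda>i. u (\<sigma> i)) = \<Psi>1 (u \<circ> \<tau>1)"
      by (rule alternating_form_cong[OF alt(1)]) (simp add: \<tau>1_def)
    then show ?thesis using alternating_form_permute[OF alt(1) \<tau>1] by simp
  qed
  moreover have "\<Psi>2 (\<lambda>i. u (\<sigma> (n + i))) = of_int (sign \<tau>2) *\<^sub>R \<Psi>2 (\<lambda>i. u (n + i))"
  proof -
    have "\<sigma> (n + i) = \<tau>2 (n + i)" if "i < n" for i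
      using permutes_in_image[OF \<tau>2, of "n + i"] that by (simp add: \<sigma>_eq \<tau>1_def)
    then have "\<Psi>2 (\<lambda>i. u (\<sigma> (n + i))) = \<Psi>2 (\<lambda>i. (u \<circ> \<tau>2) (n + i))"
      by (intro alternating_form_cong[OF alt(2)]) simp
    also have "\<dots> = of_int (sign \<tau>2) *\<^sub>R \<Psi>2 (\<lambda>i. u (n + i))"
    proof (rule antisymmetric_permute[where f = "\<lambda>v. \<Psi>2 (\<lambda>i. v (n + i))", OF _ _ \<tau>2])
      fix v :: "nat \<Rightarrow> 'a" and a b assume ab: "a \<in> {n..<n + n}" "b \<in> {n..<n + n}" "a \<noteq> b"
      then have "(\<lambda>i. (v \<circ> Transposition.transpose a b) (n + i)) =
          (\<lambda>i. v (n + i)) \<circ> Transposition.transpose (a - n) (b - n)"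
        by (auto simp: fun_eq_iff Transposition.transpose_def)
      then show "\<Psi>2 (\<lambda>i. (v \<circ> Transposition.transpose a b) (n + i)) = - \<Psi>2 (\<lambda>i. v (n + i))"
        using alternating_form_transpose[OF alt(2), of "a - n" "b - n" "\<lambda>i. v (n + i)"] ab by auto
    qed simp
    finally show ?thesis .
  qed
  ultimately show ?thesis
    by (cases \<tau>1 rule: sign_cases; cases \<tau>2 rule: sign_cases) simp_all
qed

lemma type_n_0_D:
  assumes type: "type_n_0 n J \<Omega>" and i: "i < n"
  shows "\<Omega> (v(i := J x)) = \<i> * \<Omega> (v(i := x))"
proof -
  have "\<Omega> (v(i := x)) + \<i> * \<Omega> (v(i := J x)) = 0" using assms by (simp add: type_n_0_def)
  then have "\<i> * (\<Omega> (v(i := x)) + \<i> * \<Omega> (v(i := J x))) = 0" by simp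
  then show ?thesis by (simp add: algebra_simps)
qed

lemma type_n_0_J_all:
  assumes \<Omega>: "alternating_form n \<Omega>" and type: "type_n_0 n J \<Omega>"
  shows "\<Omega> (\<lambda>i. J (x i)) = \<i> ^ n * \<Omega> x"
proof -
  have "\<Omega> (\<lambda>i. if i < m then J (x i) else x i) = \<i> ^ m * \<Omega> x" if "m \<le> n" for m
    using that
  proof (induction m)
    case (Suc m)
    let ?w = "\<lambda>i. if i < m then J (x i) else x i"
    have "(\<lambda>i. if i < Suc m then J (x i) else x i) = ?w(m := J (x m))" "?w(m := x m) = ?w"
      by (auto simp: fun_eq_iff less_Suc_eq)
    then show ?case using type_n_0_D[OF type, of m ?w "x m"] Suc by simp
  qed simp
  moreover have "\<Omega> (\<lambda>i. J (x i)) = \<Omega> (\<lambda>i. if i < n then J (x i) else x i)"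
    by (rule alternating_form_cong[OF \<Omega>]) simp
  ultimately show ?thesis by simp
qed

text \<open>
  This is \<open>\<Omega> \<and> \<Omega> = 0\<close>: exchanging \<open>x\<^sub>0\<close> and \<open>J x\<^sub>0\<close> changes the sign of every term.
\<close>

lemma wedge_type_n_0_self:
  fixes \<Omega> :: "(nat \<Rightarrow> 'a::real_vector) \<Rightarrow> complex"
  assumes \<Omega>: "alternating_form n \<Omega>" and type: "type_n_0 n J \<Omega>" and n: "n > 0"
  shows "(\<Sum>\<sigma> | \<sigma> permutes {..<n + n}. of_int (sign \<sigma>) * \<Omega> (\<lambda>i. block n x (\<lambda>i. J (x i)) (\<sigma> i)) *
      \<Omega> (\<lambda>i. block n x (\<lambda>i. J (x i)) (\<sigma> (n + i)))) = 0" (is "(\<Sum>\<sigma> | _. ?t \<sigma>) = 0")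
proof -
  let ?s = "Transposition.transpose 0 (n + 0)"
  have s: "?s permutes {..<n + n}" using n by (intro permutes_swap_id) auto
  have "(\<Sum>\<sigma> | \<sigma> permutes {..<n + n}. ?t \<sigma>) = (\<Sum>\<sigma> | \<sigma> permutes {..<n + n}. ?t (?s \<circ> \<sigma>))"
    by (rule setum_permutations_compose_left[OF s])
  also have "\<dots> = (\<Sum>\<sigma> | \<sigma> permutes {..<n + n}. - 1 * ?t \<sigma>)"
  proof (rule sum.cong[OF refl])
    fix \<sigma> assume \<sigma>: "\<sigma> \<in> {\<sigma>. \<sigma> permutes {..<n + n}}"
    show "?t (?s \<circ> \<sigma>) = - 1 * ?t \<sigma>"
      by (rule wedge_term_swap_pair(1)[OF \<Omega> \<Omega> type_n_0_D[OF type] type_n_0_D[OF type] _ _ _ n refl])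
        (use \<sigma> in simp_all)
  qed
  also have "\<dots> = - (\<Sum>\<sigma> | \<sigma> permutes {..<n + n}. ?t \<sigma>)" by (simp add: sum_negf)
  finally show ?thesis by simp
qed

text \<open>
  Now exchanging \<open>x\<^sub>j\<close> and \<open>J x\<^sub>j\<close> does not change the term.  Exchanges move all the \<open>x\<^sub>j\<close> into the first
  half, unless some pair is in the same half, in which case the term is zero.
\<close>

lemma wedge_term_type_n_0_conj:
  fixes \<Omega> :: "(nat \<Rightarrow> 'a::real_vector) \<Rightarrow> complex"
  assumes \<Omega>: "alternating_form n \<Omega>" and type: "type_n_0 n J \<Omega>" and \<sigma>: "\<sigma> permutes {..<n + n}"
    and t_def: "\<And>\<sigma>. t \<sigma> = of_int (sign \<sigma>) * \<Omega> (\<lambda>i. block n x (\<lambda>i. J (x i)) (\<sigma> i)) *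
      cnj (\<Omega> (\<lambda>i. block n x (\<lambda>i. J (x i)) (\<sigma> (n + i))))"
  shows "t \<sigma> = 0 \<or> t \<sigma> = (- \<i>) ^ n * of_real ((cmod (\<Omega> x))\<^sup>2)"
  using \<sigma>
proof (induction "card {i. i < n \<and> \<sigma> i \<ge> n}" arbitrary: \<sigma> rule: less_induct)
  case less
  let ?u = "block n x (\<lambda>i. J (x i))"
  have alt': "alternating_form n (\<lambda>v. cnj (\<Omega> v))"
    by (rule alternating_form_compose_linear[OF \<Omega>]) (rule bounded_linear.linear[OF bounded_linear_cnj])
  have J': "cnj (\<Omega> (v(i := J y))) = - \<i> * cnj (\<Omega> (v(i := y)))" if "i < n" for v y i
    using type_n_0_D[OF type that, of v y] by simp
  note \<sigma> = less.prems
  show ?case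
  proof (cases "\<exists>i<n. \<sigma> i \<ge> n")
    case False
    then have "t \<sigma> = \<Omega> ?u * cnj (\<Omega> (\<lambda>i. ?u (n + i)))"
      unfolding t_def using wedge_term_preserving_halves[OF \<Omega> alt' \<sigma>] by (simp add: not_le)
    also have "\<Omega> ?u = \<Omega> x" by (rule alternating_form_cong[OF \<Omega>]) (simp add: block_def)
    also have "(\<lambda>i. ?u (n + i)) = (\<lambda>i. J (x i))" by (simp add: block_def)
    also have "\<Omega> x * cnj (\<Omega> (\<lambda>i. J (x i))) = (- \<i>) ^ n * (\<Omega> x * cnj (\<Omega> x))"
      by (simp add: type_n_0_J_all[OF \<Omega> type])
    finally show ?thesis unfolding complex_norm_square by (rule disjI2)
  next
    case True
    then obtain i where i: "i < n" "\<sigma> i \<ge> n" by blast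
    define j where "j = \<sigma> i - n"
    have "\<sigma> i < n + n" using permutes_in_image[OF \<sigma>, of i] i by auto
    then have j: "j < n" "\<sigma> i = n + j" using i by (auto simp: j_def)
    have inv_nj: "inv \<sigma> (n + j) = i" using permutes_inverses(2)[OF \<sigma>, of i] j(2) by simp
    have swap: "t (Transposition.transpose j (n + j) \<circ> \<sigma>) = - (- 1) * t \<sigma>"
      by (rule wedge_term_swap_pair(1)[OF \<Omega> alt' type_n_0_D[OF type] J' _ _ \<sigma> j(1) refl t_def]) simp_all
    have both: "t \<sigma> = 0" if "inv \<sigma> j < n" "inv \<sigma> (n + j) < n"
      by (rule wedge_term_swap_pair(2)[where \<delta> = "- 1", OF \<Omega> alt' type_n_0_D[OF type] J' _ _ \<sigma> j(1) refl t_def])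
        (use that in simp_all)
    show ?thesis
    proof (cases "inv \<sigma> j < n")
      case True
      then have "t \<sigma> = 0" using both inv_nj i by simp
      then show ?thesis by simp
    next
      case False
      let ?s = "Transposition.transpose j (n + j)"
      have s\<sigma>: "?s \<circ> \<sigma> permutes {..<n + n}"
        using j by (intro permutes_compose \<sigma> permutes_swap_id) auto
      have "\<sigma> k \<noteq> j" if "k < n" for k
        using False that permutes_inverses(2)[OF \<sigma>, of k] by auto
      then have "{k. k < n \<and> (?s \<circ> \<sigma>) k \<ge> n} \<subseteq> {k. k < n \<and> \<sigma> k \<ge> n} - {i}"
        using j by (auto simp: Transposition.transpose_def split: if_splits)
      then have "card {k. k < n \<and> (?s \<circ> \<sigma>) k \<ge> n} < card {k. k < n \<and> \<sigma> k \<ge> n}"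
        using i by (intro psubset_card_mono) auto
      then have "t (?s \<circ> \<sigma>) = 0 \<or> t (?s \<circ> \<sigma>) = (- \<i>) ^ n * of_real ((cmod (\<Omega> x))\<^sup>2)"
        by (rule less.hyps[OF _ s\<sigma>])
      moreover have "t (?s \<circ> \<sigma>) = t \<sigma>" using swap by simp
      ultimately show ?thesis by simp
    qed
  qed
qed

lemma wedge_type_n_0_conj:
  fixes \<Omega> :: "(nat \<Rightarrow> 'a::real_vector) \<Rightarrow> complex"
  assumes \<Omega>: "alternating_form n \<Omega>" and type: "type_n_0 n J \<Omega>"
  obtains K :: real where "K \<ge> 1"
    "(\<Sum>\<sigma> | \<sigma> permutes {..<n + n}. of_int (sign \<sigma>) * \<Omega> (\<lambda>i. block n x (\<lambda>i. J (x i)) (\<sigma> i)) *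
      cnj (\<Omega> (\<lambda>i. block n x (\<lambda>i. J (x i)) (\<sigma> (n + i))))) =
      of_real K * ((- \<i>) ^ n * of_real ((cmod (\<Omega> x))\<^sup>2))"
proof -
  \<comment> \<open>The sum counts the permutations with a non-zero term; the identity is one of them.\<close>
  define t where "t \<sigma> = of_int (sign \<sigma>) * \<Omega> (\<lambda>i. block n x (\<lambda>i. J (x i)) (\<sigma> i)) *
      cnj (\<Omega> (\<lambda>i. block n x (\<lambda>i. J (x i)) (\<sigma> (n + i))))" for \<sigma>
  define c where "c = (- \<i>) ^ n * complex_of_real ((cmod (\<Omega> x))\<^sup>2)"
  let ?S = "{\<sigma>. \<sigma> permutes {..<n + n}}"
  let ?T = "{\<sigma> \<in> ?S. t \<sigma> = c}"
  have t: "t \<sigma> = 0 \<or> t \<sigma> = c" if "\<sigma> permutes {..<n + n}" for \<sigma>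
    unfolding c_def by (rule wedge_term_type_n_0_conj[OF \<Omega> type that t_def])
  have fin: "finite ?S" by (rule finite_permutations) simp
  have "t id = \<Omega> x * cnj (\<Omega> (\<lambda>i. J (x i)))"
  proof -
    have "\<Omega> (block n x (\<lambda>i. J (x i))) = \<Omega> x"
      by (rule alternating_form_cong[OF \<Omega>]) (simp add: block_def)
    then show ?thesis by (simp add: t_def) (simp add: block_def)
  qed
  also have "\<dots> = (- \<i>) ^ n * (\<Omega> x * cnj (\<Omega> x))" by (simp add: type_n_0_J_all[OF \<Omega> type])
  also have "\<dots> = c" unfolding c_def complex_norm_square ..
  finally have id: "id \<in> ?T" by (simp add: permutes_id)
  have "sum t ?S = sum t ?T"
    using t by (intro sum.mono_neutral_right fin) auto
  also have "\<dots> = of_nat (card ?T) * c" by simp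
  finally have "sum t ?S = of_real (real (card ?T)) * c" by simp
  moreover have "real (card ?T) \<ge> 1"
  proof -
    have "finite ?T" using fin by simp
    then have "card ?T > 0" unfolding card_gt_0_iff using id by blast
    then show ?thesis by linarith
  qed
  ultimately show thesis using that unfolding t_def c_def by blast
qed

section \<open>The orientation defined by the symplectic form\<close>

text \<open>
  As a rearrangement of \<open>block (Suc k) x y\<close> it moves \<open>y 0\<close> to the second position, past \<open>x 1, \<dots>, x k\<close>.
\<close>

definition block_cycle :: "nat \<Rightarrow> nat \<Rightarrow> nat" where
  "block_cycle k i = (if i = 1 then Suc k else if 2 \<le> i \<and> i \<le> Suc k then i - 1 else i)"

lemma block_cycle:
  shows block_cycle_permutes: "block_cycle k permutes {..<2 * Suc k}"
    and block_cycle_sign: "sign (block_cycle k) = (-1) ^ k"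
proof -
  have *: "block_cycle k permutes {..<2 * Suc k} \<and> sign (block_cycle k) = (-1) ^ k"
  proof (induction k)
    case 0
    have "block_cycle 0 = id" by (auto simp: block_cycle_def fun_eq_iff)
    then show ?case by (metis permutes_id power_0 sign_id)
  next
    case (Suc k)
    have eq: "block_cycle (Suc k) = Transposition.transpose (Suc k) (Suc (Suc k)) \<circ> block_cycle k"
      by (auto simp: block_cycle_def fun_eq_iff Transposition.transpose_def)
    have perm: "block_cycle k permutes {..<2 * Suc (Suc k)}"
      using Suc by (auto intro: permutes_subset)
    then have "sign (block_cycle (Suc k)) = - sign (block_cycle k)"
      unfolding eq using permutes_imp_permutation[OF _ perm]
      by (simp add: sign_compose sign_swap_id permutation_swap_id)
    moreover have "block_cycle (Suc k) permutes {..<2 * Suc (Suc k)}"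
      unfolding eq by (intro permutes_compose perm permutes_swap_id) auto
    ultimately show ?case using Suc by simp
  qed
  show "block_cycle k permutes {..<2 * Suc k}" "sign (block_cycle k) = (-1) ^ k" using * by auto
qed

lemma block_block_cycle:
  "block (Suc k) x y (block_cycle k (2 + i)) = block k (\<lambda>i. x (Suc i)) (\<lambda>i. y (Suc i)) i"
  by (auto simp: block_def block_cycle_def intro!: arg_cong[of _ _ y])

text \<open>
  The sign by which the order \<open>x\<^sub>0, \<dots>, x\<^sub>n\<^sub>-\<^sub>1, y\<^sub>0, \<dots>, y\<^sub>n\<^sub>-\<^sub>1\<close> differs from \<open>x\<^sub>0, y\<^sub>0, x\<^sub>1, y\<^sub>1, \<dots>\<close>.
\<close>

definition block_sign :: "nat \<Rightarrow> real" where
  "block_sign n = (-1) ^ (n * (n - 1) div 2)"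

lemma block_sign_Suc: "block_sign (Suc n) = (-1) ^ n * block_sign n"
proof (cases n)
  case (Suc m)
  have "Suc n * (Suc n - 1) div 2 = n + n * (n - 1) div 2"
    by (simp add: Suc) 
  then show ?thesis by (simp add: block_sign_def power_add)
qed (simp add: block_sign_def)

lemma block_sign_sq: "block_sign n * block_sign n = 1"
  by (simp add: block_sign_def flip: power_mult_distrib)

definition symplectic_frame :: "('a \<Rightarrow> 'a \<Rightarrow> real) \<Rightarrow> nat \<Rightarrow> (nat \<Rightarrow> 'a) \<Rightarrow> (nat \<Rightarrow> 'a) \<Rightarrow> bool" where
  "symplectic_frame \<omega> k x y \<longleftrightarrow> (\<forall>i<k. \<forall>j<k. \<omega> (x i) (x j) = 0 \<and> \<omega> (y i) (y j) = 0 \<and>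
     \<omega> (x i) (y j) = (if i = j then 1 else 0))"

text \<open>
  For a non-zero term the first two arguments are some \<open>x\<^sub>m\<close> and \<open>y\<^sub>m\<close>.  Exchanging the pairs with
  numbers \<open>0\<close> and \<open>m\<close>, an even permutation, reduces to \<open>m = 0\<close>, where \<open>block_cycle\<close> does the rest.
\<close>

lemma wedge_power_term:
  assumes \<omega>: "symplectic_form \<omega>" and xy: "symplectic_frame \<omega> (Suc k) x y"
    and \<sigma>: "\<sigma> permutes {..<2 * Suc k}"
    and w: "w = block (Suc k) x y"
    and t: "t = of_int (sign \<sigma>) * \<omega> (w (\<sigma> 0)) (w (\<sigma> 1)) * wedge_power k \<omega> (\<lambda>i. w (\<sigma> (2 + i)))"
  shows "t = 0 \<or> (\<exists>x' y'. symplectic_frame \<omega> k x' y' \<and> t = (-1) ^ k * wedge_power k \<omega> (block k x' y'))"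
proof -
  note flip = symplectic_flip[OF \<omega>]
  \<comment> \<open>The case in which \<open>x\<^sub>m\<close> comes before \<open>y\<^sub>m\<close>.\<close>
  have ord: ?thesis if \<sigma>: "\<sigma> permutes {..<2 * Suc k}" and m: "m < Suc k" "\<sigma> 0 = m" "\<sigma> 1 = Suc k + m"
      and t: "t = of_int (sign \<sigma>) * \<omega> (w (\<sigma> 0)) (w (\<sigma> 1)) * wedge_power k \<omega> (\<lambda>i. w (\<sigma> (2 + i)))"
    for \<sigma> m
  proof -
    let ?s = "Transposition.transpose 0 m"
    let ?\<pi> = "Transposition.transpose 0 m \<circ> Transposition.transpose (Suc k) (Suc k + m)"
    have \<pi>: "?\<pi> permutes {..<2 * Suc k}"
      using m by (intro permutes_compose permutes_swap_id) auto
    have sgn_\<pi>: "sign ?\<pi> = 1"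
      by (subst sign_compose) (auto simp: permutation_swap_id sign_swap_id)
    have \<pi>\<pi>: "?\<pi> \<circ> ?\<pi> = id"
      using m by (auto simp: fun_eq_iff Transposition.transpose_def)
    define x' y' where "x' = x \<circ> ?s" and "y' = y \<circ> ?s"
    have frame': "symplectic_frame \<omega> (Suc k) x' y'"
      using xy m by (auto simp: symplectic_frame_def x'_def y'_def Transposition.transpose_def)
    have w\<pi>: "w (?\<pi> i) = block (Suc k) x' y' i" if "i < 2 * Suc k" for i
      using m that by (auto simp: w block_def x'_def y'_def Transposition.transpose_def)
    define \<tau> where "\<tau> = inv (block_cycle k) \<circ> (?\<pi> \<circ> \<sigma>)"
    note c = block_cycle_permutes[of k]
    have \<tau>: "\<tau> permutes {..<2 * Suc k}"
      unfolding \<tau>_def by (intro permutes_compose \<sigma> \<pi> permutes_inv c)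
    \<comment> \<open>By construction \<open>\<tau>\<close> fixes \<open>0\<close> and \<open>1\<close>, so it only permutes the arguments of the remaining power.\<close>
    have c_\<tau>: "block_cycle k (\<tau> i) = ?\<pi> (\<sigma> i)" for i
      using permutes_inverses(1)[OF c] by (simp add: \<tau>_def)
    have inj_c: "block_cycle k i = block_cycle k j \<longleftrightarrow> i = j" for i j
      using permutes_inj[OF c] by (auto dest: injD)
    have "block_cycle k (\<tau> 0) = block_cycle k 0" "block_cycle k (\<tau> 1) = block_cycle k 1"
      unfolding c_\<tau> m using m(1) by (auto simp: block_cycle_def Transposition.transpose_def)
    then have fixed: "\<tau> 0 = 0" "\<tau> 1 = 1" unfolding inj_c .
    have \<tau>2: "\<tau> permutes {2..<2 * Suc k}"
    proof (rule permutes_superset[OF \<tau>])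
      fix i assume "i \<in> {..<2 * Suc k} - {2..<2 * Suc k}"
      then have "i = 0 \<or> i = 1" by auto
      then show "\<tau> i = i" using fixed by auto
    qed
    have perms: "permutation \<sigma>" "permutation ?\<pi>" "permutation \<tau>" "permutation (block_cycle k)"
      using \<sigma> \<pi> \<tau> c by (auto intro: permutes_imp_permutation[OF finite_lessThan])
    have "sign \<tau> = sign (block_cycle k) * sign \<sigma>"
      unfolding \<tau>_def using perms sgn_\<pi>
      by (simp add: sign_compose permutation_compose permutation_inverse sign_inverse)
    then have sgn: "sign \<sigma> * sign \<tau> = (-1) ^ k"
      unfolding block_cycle_sign by (simp add: mult.left_commute[of "sign \<sigma>"])
    define z where "z i = block (Suc k) x' y' (block_cycle k i)" for i
    have w\<sigma>: "w (\<sigma> i) = z (\<tau> i)" if "i < 2 * Suc k" for i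
    proof -
      have "?\<pi> (\<sigma> i) < 2 * Suc k"
        using permutes_in_image[OF permutes_compose[OF \<sigma> \<pi>], of i] that by simp
      then have "w (?\<pi> (?\<pi> (\<sigma> i))) = block (Suc k) x' y' (?\<pi> (\<sigma> i))" by (rule w\<pi>)
      moreover have "?\<pi> (?\<pi> (\<sigma> i)) = \<sigma> i" using \<pi>\<pi> by (metis comp_apply id_apply)
      ultimately show ?thesis unfolding z_def c_\<tau> by simp
    qed
    have "\<omega> (w (\<sigma> 0)) (w (\<sigma> 1)) = 1"
      using xy m by (simp add: w block_def symplectic_frame_def)
    moreover have "wedge_power k \<omega> (\<lambda>i. w (\<sigma> (2 + i))) =
        of_int (sign \<tau>) *\<^sub>R wedge_power k \<omega> (\<lambda>i. z (2 + i))"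
    proof -
      have alt: "alternating_form (2 * k) (wedge_power k \<omega>)"
        using \<omega> by (intro alternating_form_wedge_power) (auto simp: symplectic_form_def)
      have "wedge_power k \<omega> (\<lambda>i. w (\<sigma> (2 + i))) = wedge_power k \<omega> (\<lambda>i. (z \<circ> \<tau>) (2 + i))"
        by (rule alternating_form_cong[OF alt]) (simp add: w\<sigma>)
      also have "\<dots> = of_int (sign \<tau>) *\<^sub>R wedge_power k \<omega> (\<lambda>i. z (2 + i))"
      proof (rule antisymmetric_permute[where f = "\<lambda>v. wedge_power k \<omega> (\<lambda>i. v (2 + i))", OF _ _ \<tau>2])
        fix v :: "nat \<Rightarrow> 'a" and a b
        assume ab: "a \<in> {2..<2 * Suc k}" "b \<in> {2..<2 * Suc k}" "a \<noteq> b"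
        then have "2 + (a - 2) = a" "2 + (b - 2) = b" by auto
        then have "(\<lambda>i. (v \<circ> Transposition.transpose a b) (2 + i)) =
            (\<lambda>i. v (2 + i)) \<circ> Transposition.transpose (a - 2) (b - 2)"
          by (auto simp: fun_eq_iff Transposition.transpose_def)
        moreover have "a - 2 < 2 * k" "b - 2 < 2 * k" "a - 2 \<noteq> b - 2" using ab by auto
        ultimately show "wedge_power k \<omega> (\<lambda>i. (v \<circ> Transposition.transpose a b) (2 + i)) =
            - wedge_power k \<omega> (\<lambda>i. v (2 + i))"
          using alternating_form_transpose[OF alt, of "a - 2" "b - 2" "\<lambda>i. v (2 + i)"] by simp
      qed simp
      finally show ?thesis .
    qed
    moreover have "(\<lambda>i. z (2 + i)) = block k (\<lambda>i. x' (Suc i)) (\<lambda>i. y' (Suc i))"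
      unfolding z_def block_block_cycle ..
    ultimately have "t = of_int (sign \<sigma> * sign \<tau>) *
        wedge_power k \<omega> (block k (\<lambda>i. x' (Suc i)) (\<lambda>i. y' (Suc i)))"
      unfolding t by simp
    moreover have "symplectic_frame \<omega> k (\<lambda>i. x' (Suc i)) (\<lambda>i. y' (Suc i))"
      using frame' by (simp add: symplectic_frame_def)
    ultimately show ?thesis unfolding sgn by auto
  qed
  have ran: "\<sigma> 0 < 2 * Suc k" "\<sigma> 1 < 2 * Suc k" "\<sigma> 0 \<noteq> \<sigma> 1"
    using permutes_in_image[OF \<sigma>, of 0] permutes_in_image[OF \<sigma>, of 1] permutes_inj[OF \<sigma>]
    by (auto dest: injD)
  have xx: "\<omega> (x i) (x j) = 0" "\<omega> (y i) (y j) = 0" "i \<noteq> j \<Longrightarrow> \<omega> (x i) (y j) = 0"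
      "i \<noteq> j \<Longrightarrow> \<omega> (y i) (x j) = 0" if "i < Suc k" "j < Suc k" for i j
    using xy that flip[of "y i" "x j"] by (auto simp: symplectic_frame_def)
  consider m where "m < Suc k" "\<sigma> 0 = m" "\<sigma> 1 = Suc k + m"
    | m where "m < Suc k" "\<sigma> 1 = m" "\<sigma> 0 = Suc k + m"
    | "\<omega> (w (\<sigma> 0)) (w (\<sigma> 1)) = 0"
  proof (cases "\<sigma> 0 < Suc k"; cases "\<sigma> 1 < Suc k")
    assume "\<sigma> 0 < Suc k" "\<sigma> 1 < Suc k"
    then show thesis using xx(1) that(3) by (simp add: w block_def)
  next
    assume *: "\<sigma> 0 < Suc k" "\<not> \<sigma> 1 < Suc k"
    then have "\<sigma> 1 - Suc k < Suc k" using ran by simp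
    with * show thesis
      using xx(3)[of "\<sigma> 0" "\<sigma> 1 - Suc k"] that(3) that(1)[of "\<sigma> 0"]
      by (cases "\<sigma> 0 = \<sigma> 1 - Suc k") (auto simp: w block_def)
  next
    assume *: "\<not> \<sigma> 0 < Suc k" "\<sigma> 1 < Suc k"
    then have "\<sigma> 0 - Suc k < Suc k" using ran by simp
    with * show thesis
      using xx(4)[of "\<sigma> 0 - Suc k" "\<sigma> 1"] that(3) that(2)[of "\<sigma> 1"]
      by (cases "\<sigma> 0 - Suc k = \<sigma> 1") (auto simp: w block_def)
  next
    assume *: "\<not> \<sigma> 0 < Suc k" "\<not> \<sigma> 1 < Suc k"
    then have "\<sigma> 0 - Suc k < Suc k" "\<sigma> 1 - Suc k < Suc k" using ran by auto
    with * show thesis using xx(2) that(3) by (simp add: w block_def)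
  qed
  then show ?thesis
  proof cases
    case 1
    then show ?thesis using ord[OF \<sigma> _ _ _ t] by blast
  next
    case 2
    let ?\<sigma> = "\<sigma> \<circ> Transposition.transpose 0 1"
    have "?\<sigma> permutes {..<2 * Suc k}"
      by (intro permutes_compose[OF _ \<sigma>] permutes_swap_id) auto
    moreover have "?\<sigma> 0 = m" "?\<sigma> 1 = Suc k + m" using 2 by auto
    moreover have "t = of_int (sign ?\<sigma>) * \<omega> (w (?\<sigma> 0)) (w (?\<sigma> 1)) * wedge_power k \<omega> (\<lambda>i. w (?\<sigma> (2 + i)))"
    proof -
      have "sign ?\<sigma> = - sign \<sigma>"
        using permutes_imp_permutation[OF _ \<sigma>] by (simp add: sign_compose sign_swap_id permutation_swap_id)
      moreover have "\<omega> (w (?\<sigma> 0)) (w (?\<sigma> 1)) = - \<omega> (w (\<sigma> 0)) (w (\<sigma> 1))"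
        using flip[of "w (\<sigma> 1)" "w (\<sigma> 0)"] by simp
      moreover have "?\<sigma> (2 + i) = \<sigma> (2 + i)" for i by (simp add: Transposition.transpose_def)
      ultimately show ?thesis unfolding t by simp
    qed
    ultimately show ?thesis using ord[of ?\<sigma> m] 2(1) by blast
  next
    case 3
    then show ?thesis by (simp add: t)
  qed
qed

text \<open>
  Expanding the first factor \<open>\<omega>\<close> of the power, all non-zero terms have the same sign.  The upper
  bound is uniform in the frame.
\<close>

lemma wedge_power_symplectic_frame:
  fixes \<omega> :: "'a::euclidean_space \<Rightarrow> 'a \<Rightarrow> real"
  assumes \<omega>: "symplectic_form \<omega>"
  shows "\<exists>B>0. \<forall>x y. symplectic_frame \<omega> k x y \<longrightarrow>
    0 < block_sign k * wedge_power k \<omega> (block k x y) \<and> block_sign k * wedge_power k \<omega> (block k x y) \<le> B"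
proof (induction k)
  case 0
  show ?case by (intro exI[of _ 1]) (simp add: block_sign_def)
next
  case (Suc k)
  then obtain B where B: "B > 0" "\<And>x y. symplectic_frame \<omega> k x y \<Longrightarrow>
    0 < block_sign k * wedge_power k \<omega> (block k x y) \<and> block_sign k * wedge_power k \<omega> (block k x y) \<le> B"
    by blast
  let ?S = "{\<sigma>. \<sigma> permutes {..<2 + 2 * k}}"
  have fin: "finite ?S" by (rule finite_permutations) simp
  define q :: real where "q = 1 / (fact 2 * fact (2 * k))"
  have q: "q > 0" by (simp add: q_def)
  have "0 < block_sign (Suc k) * wedge_power (Suc k) \<omega> (block (Suc k) x y) \<and>
      block_sign (Suc k) * wedge_power (Suc k) \<omega> (block (Suc k) x y) \<le> q * (real (card ?S) * B)"
    if xy: "symplectic_frame \<omega> (Suc k) x y" for x y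
  proof -
    define w where "w = block (Suc k) x y"
    define t where "t \<sigma> = of_int (sign \<sigma>) * \<omega> (w (\<sigma> 0)) (w (\<sigma> 1)) * wedge_power k \<omega> (\<lambda>i. w (\<sigma> (2 + i)))" for \<sigma>
    define T where "T \<sigma> = block_sign (Suc k) * t \<sigma>" for \<sigma>
    have T: "T \<sigma> = 0 \<or> 0 < T \<sigma> \<and> T \<sigma> \<le> B" if "\<sigma> permutes {..<2 + 2 * k}" for \<sigma>
    proof -
      have \<sigma>: "\<sigma> permutes {..<2 * Suc k}" using that by simp
      show ?thesis
        using wedge_power_term[OF \<omega> xy \<sigma> w_def t_def]
      proof
        assume "\<exists>x' y'. symplectic_frame \<omega> k x' y' \<and> t \<sigma> = (-1) ^ k * wedge_power k \<omega> (block k x' y')"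
        then obtain x' y' where *: "symplectic_frame \<omega> k x' y'"
          "t \<sigma> = (-1) ^ k * wedge_power k \<omega> (block k x' y')" by blast
        have "T \<sigma> = ((-1) ^ k * (-1) ^ k) * (block_sign k * wedge_power k \<omega> (block k x' y'))"
          unfolding T_def *(2) block_sign_Suc by (simp only: mult_ac)
        also have "(-1) ^ k * (-1) ^ k = (1::real)" by (simp flip: power_mult_distrib)
        finally show ?thesis using B(2)[OF *(1)] by simp
      qed (simp add: T_def)
    qed
    have nonneg: "0 \<le> T \<sigma>" and le: "T \<sigma> \<le> B" if "\<sigma> \<in> ?S" for \<sigma>
      using T[of \<sigma>] that B(1) by auto
    have c: "block_cycle k \<in> ?S" using block_cycle_permutes[of k] by simp
    have "t (block_cycle k) \<noteq> 0"
    proof -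
      have "block_cycle k 0 = 0" "block_cycle k 1 = Suc k"
        by (simp_all add: block_cycle_def)
      then have "\<omega> (w (block_cycle k 0)) (w (block_cycle k 1)) = 1"
        using xy by (simp add: w_def block_def symplectic_frame_def)
      then have "t (block_cycle k) = of_int (sign (block_cycle k)) *
          wedge_power k \<omega> (block k (\<lambda>i. x (Suc i)) (\<lambda>i. y (Suc i)))"
        unfolding t_def unfolding w_def block_block_cycle by simp
      moreover have "symplectic_frame \<omega> k (\<lambda>i. x (Suc i)) (\<lambda>i. y (Suc i))"
        using xy by (simp add: symplectic_frame_def)
      ultimately show ?thesis using B(2) by fastforce
    qed
    then have "T (block_cycle k) \<noteq> 0" by (simp add: T_def block_sign_def)
    then have "0 < T (block_cycle k)" using nonneg[OF c] by linarith
    then have pos: "0 < sum T ?S" using sum_pos2[OF fin c] nonneg by blast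
    have "sum T ?S \<le> real (card ?S) * B" using sum_bounded_above[of ?S T B] le by simp
    moreover have "block_sign (Suc k) * wedge_power (Suc k) \<omega> w = q * sum T ?S"
      by (simp add: wedge_def form_of_bilinear_def q_def T_def t_def sum_distrib_left mult_ac)
    ultimately show ?thesis using pos q unfolding w_def by (simp add: mult_left_mono)
  qed
  moreover have "q * (real (card ?S) * B) > 0"
  proof -
    have "id \<in> ?S" by (simp only: mem_Collect_eq permutes_id)
    then have "card ?S > 0" unfolding card_gt_0_iff using fin by blast
    then show ?thesis using q B(1) by simp
  qed
  ultimately show ?case by blast
qed

section \<open>A lower bound for the volume\<close>

lemma lattice_basis_permute:
  fixes \<Lambda> :: "'a::euclidean_space set"
  assumes b: "lattice_basis \<Lambda> b" and p: "p permutes {..<DIM('a)}"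
  shows "lattice_basis \<Lambda> (b \<circ> p)"
proof -
  have inj: "inj_on b {..<DIM('a)}" and ind: "independent (b ` {..<DIM('a)})"
    and \<Lambda>: "\<Lambda> = range (\<lambda>c :: nat \<Rightarrow> int. \<Sum>i<DIM('a). of_int (c i) *\<^sub>R b i)"
    using b by (simp_all add: lattice_basis_def)
  have img: "p ` {..<DIM('a)} = {..<DIM('a)}" by (rule permutes_image[OF p])
  have "inj_on (b \<circ> p) {..<DIM('a)}"
    by (rule comp_inj_on[OF permutes_inj_on[OF p]]) (simp add: img inj)
  moreover have "independent ((b \<circ> p) ` {..<DIM('a)})"
    unfolding image_comp[symmetric] img by (rule ind)
  moreover have "\<Lambda> = range (\<lambda>c :: nat \<Rightarrow> int. \<Sum>i<DIM('a). of_int (c i) *\<^sub>R (b \<circ> p) i)"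
  proof -
    have eq: "(\<Sum>i<DIM('a). of_int (c i) *\<^sub>R b i) = (\<Sum>i<DIM('a). of_int ((c \<circ> p) i) *\<^sub>R (b \<circ> p) i)"
      for c :: "nat \<Rightarrow> int"
      using sum.permute[OF p, of "\<lambda>i. of_int (c i) *\<^sub>R b i"] by (simp add: o_def)
    have eq': "(\<Sum>i<DIM('a). of_int (c i) *\<^sub>R (b \<circ> p) i) = (\<Sum>i<DIM('a). of_int ((c \<circ> inv p) i) *\<^sub>R b i)"
      for c :: "nat \<Rightarrow> int"
      unfolding eq[of "c \<circ> inv p"] by (simp add: permutes_inverses(2)[OF p])
    show ?thesis
      unfolding \<Lambda> by (intro equalityI image_subsetI; rule range_eqI) (rule eq, rule eq')
  qed
  ultimately show ?thesis unfolding lattice_basis_def by blast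
qed

text \<open>
  Exchanging two vectors of a basis reverses its orientation.
\<close>

lemma positive_lattice_basis_exists:
  fixes \<omega> :: "'a::euclidean_space \<Rightarrow> 'a \<Rightarrow> real"
  assumes \<Lambda>: "is_lattice \<Lambda>" and \<omega>: "symplectic_form \<omega>" and dim: "DIM('a) = 2 * n"
    and u: "wedge_power n \<omega> u \<noteq> 0" and n: "n > 0"
  shows "\<exists>b. lattice_basis \<Lambda> b \<and> wedge_power n \<omega> b > 0"
proof -
  obtain b where b: "lattice_basis \<Lambda> b" using \<Lambda> by (auto simp: is_lattice_def)
  have alt: "alternating_form (2 * n) (wedge_power n \<omega>)"
    using \<omega> by (intro alternating_form_wedge_power) (auto simp: symplectic_form_def)
  have "wedge_power n \<omega> b \<noteq> 0"
  proof
    assume 0: "wedge_power n \<omega> b = 0"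
    have "span (b ` {..<2 * n}) = UNIV" using lattice_basis_span[OF b] unfolding dim .
    then have "wedge_power n \<omega> u = 0"
      by (intro alternating_form_eq_0_on_span[OF alt 0]) simp
    then show False using u by simp
  qed
  moreover have "wedge_power n \<omega> (b \<circ> Transposition.transpose 0 1) = - wedge_power n \<omega> b"
    using n by (intro alternating_form_transpose[OF alt]) auto
  moreover have "lattice_basis \<Lambda> (b \<circ> Transposition.transpose 0 1)"
    using n dim by (intro lattice_basis_permute[OF b] permutes_swap_id) auto
  ultimately consider "lattice_basis \<Lambda> b" "wedge_power n \<omega> b > 0"
    | "lattice_basis \<Lambda> (b \<circ> Transposition.transpose 0 1)" "wedge_power n \<omega> (b \<circ> Transposition.transpose 0 1) > 0"
    using b by linarith
  then show ?thesis by cases blast+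
qed

text \<open>
  A real linear map of the plane is the sum of a complex linear and a complex antilinear one.
\<close>

lemma matrix_act_conj_split:
  obtains a b where "\<And>z. matrix_act A z = a * z + b * cnj z" "det A = (cmod a)\<^sup>2 - (cmod b)\<^sup>2"
proof (rule that)
  let ?a = "Complex ((A$1$1 + A$2$2) / 2) ((A$2$1 - A$1$2) / 2)"
  let ?b = "Complex ((A$1$1 - A$2$2) / 2) ((A$2$1 + A$1$2) / 2)"
  show "matrix_act A z = ?a * z + ?b * cnj z" for z
    by (simp add: matrix_act_def complex_eq_iff field_simps)
  show "det A = (cmod ?a)\<^sup>2 - (cmod ?b)\<^sup>2"
    unfolding cmod_power2 by (simp add: det_2 power2_eq_square field_simps)
qed

lemma unitary_frame_symplectic:
  assumes "compatible_complex_structure \<omega> J" "unitary_frame \<omega> J n x"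
  shows "symplectic_frame \<omega> n x (\<lambda>i. J (x i))"
  using assms by (simp add: symplectic_frame_def unitary_frame_def isotropic_def compatible_complex_structure_def)

lemma unitary_frame_spans:
  fixes x :: "nat \<Rightarrow> 'a::euclidean_space"
  assumes \<omega>: "symplectic_form \<omega>" and J: "compatible_complex_structure \<omega> J" and dim: "DIM('a) = 2 * n"
    and x: "unitary_frame \<omega> J n x"
  shows "span (block n x (\<lambda>i. J (x i)) ` {..<2 * n}) = UNIV"
proof -
  interpret compatible_structure \<omega> J by unfold_locales (rule \<omega> J)+
  have "span ((\<lambda>i. if i < n then x i else J (x (i - n))) ` {..<2 * n}) = UNIV"
  proof (rule orthogonal_lagrangian_spans[OF dim])
    show "isotropic \<omega> x n" using x by (simp add: unitary_frame_def)
    show "g (x i) (x j) = 0" if "i < n" "j < n" "i \<noteq> j" for i j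
      using x that by (simp add: unitary_frame_def g_def)
    show "x i \<noteq> 0" if "i < n" for i
    proof
      assume "x i = 0"
      then have "g (x i) (x i) = 0" by (simp add: g_zero)
      then show False using x that by (simp add: unitary_frame_def g_def)
    qed
  qed
  moreover have "block n x (\<lambda>i. J (x i)) = (\<lambda>i. if i < n then x i else J (x (i - n)))"
    by (simp add: block_def fun_eq_iff)
  ultimately show ?thesis by simp
qed

text \<open>
  Of the four products in \<open>(a \<Omega> + b \<Omega>\<^sup>*) \<and> (a \<Omega> + b \<Omega>\<^sup>*)\<^sup>*\<close> only \<open>\<Omega> \<and> \<Omega>\<^sup>*\<close> and its conjugate are non-zero.
\<close>

lemma wedge_matrix_act:
  fixes \<Omega> :: "(nat \<Rightarrow> 'a::real_vector) \<Rightarrow> complex"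
  assumes \<Omega>: "alternating_form n \<Omega>" and type: "type_n_0 n J \<Omega>" and n: "n > 0"
    and ab: "\<And>z. matrix_act A z = a * z + b * cnj z"
  shows "\<exists>K\<ge>1. wedge n n (\<lambda>v. matrix_act A (\<Omega> v)) (\<lambda>v. cnj (matrix_act A (\<Omega> v))) (block n x (\<lambda>i. J (x i))) =
    of_real (K / (fact n * fact n) * (cmod (\<Omega> x))\<^sup>2) *
      ((- \<i>) ^ n * of_real ((cmod a)\<^sup>2) + \<i> ^ n * of_real ((cmod b)\<^sup>2))"
proof -
  let ?u = "block n x (\<lambda>i. J (x i))" and ?S = "{\<sigma>. \<sigma> permutes {..<n + n}}"
  define P where "P \<sigma> = \<Omega> (\<lambda>i. ?u (\<sigma> i))" for \<sigma>
  define Q where "Q \<sigma> = \<Omega> (\<lambda>i. ?u (\<sigma> (n + i)))" for \<sigma>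
  let ?e = "\<lambda>\<sigma>. complex_of_int (sign \<sigma>)"
  obtain K :: real where K: "K \<ge> 1"
    "(\<Sum>\<sigma>\<in>?S. ?e \<sigma> * P \<sigma> * cnj (Q \<sigma>)) = of_real K * ((- \<i>) ^ n * of_real ((cmod (\<Omega> x))\<^sup>2))"
    unfolding P_def Q_def by (rule wedge_type_n_0_conj[OF \<Omega> type, of x])
  have S2: "(\<Sum>\<sigma>\<in>?S. ?e \<sigma> * P \<sigma> * Q \<sigma>) = 0"
    using wedge_type_n_0_self[OF \<Omega> type n, of x] by (simp add: P_def Q_def)
  have S3: "(\<Sum>\<sigma>\<in>?S. ?e \<sigma> * cnj (P \<sigma>) * cnj (Q \<sigma>)) = 0"
    using arg_cong[OF S2, of cnj] by simp
  have S4: "(\<Sum>\<sigma>\<in>?S. ?e \<sigma> * cnj (P \<sigma>) * Q \<sigma>) = of_real K * (\<i> ^ n * of_real ((cmod (\<Omega> x))\<^sup>2))"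
    using arg_cong[OF K(2), of cnj] by simp
  have "(\<Sum>\<sigma>\<in>?S. ?e \<sigma> * matrix_act A (P \<sigma>) * cnj (matrix_act A (Q \<sigma>))) =
      (\<Sum>\<sigma>\<in>?S. a * cnj a * (?e \<sigma> * P \<sigma> * cnj (Q \<sigma>)) + a * cnj b * (?e \<sigma> * P \<sigma> * Q \<sigma>) +
        b * cnj a * (?e \<sigma> * cnj (P \<sigma>) * cnj (Q \<sigma>)) + b * cnj b * (?e \<sigma> * cnj (P \<sigma>) * Q \<sigma>))"
    by (rule sum.cong) (simp_all add: ab algebra_simps)
  also have "\<dots> = a * cnj a * (\<Sum>\<sigma>\<in>?S. ?e \<sigma> * P \<sigma> * cnj (Q \<sigma>)) + a * cnj b * (\<Sum>\<sigma>\<in>?S. ?e \<sigma> * P \<sigma> * Q \<sigma>) +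
        b * cnj a * (\<Sum>\<sigma>\<in>?S. ?e \<sigma> * cnj (P \<sigma>) * cnj (Q \<sigma>)) + b * cnj b * (\<Sum>\<sigma>\<in>?S. ?e \<sigma> * cnj (P \<sigma>) * Q \<sigma>)"
    by (simp only: sum.distrib sum_distrib_left)
  also have "\<dots> = of_real (K * (cmod (\<Omega> x))\<^sup>2) *
      ((- \<i>) ^ n * of_real ((cmod a)\<^sup>2) + \<i> ^ n * of_real ((cmod b)\<^sup>2))"
    unfolding K(2) S2 S3 S4 complex_norm_square[of a, symmetric] complex_norm_square[of b, symmetric]
    by (simp add: algebra_simps)
  finally have "wedge n n (\<lambda>v. matrix_act A (\<Omega> v)) (\<lambda>v. cnj (matrix_act A (\<Omega> v))) ?u =
      (1 / (fact n * fact n)) *\<^sub>R (of_real (K * (cmod (\<Omega> x))\<^sup>2) *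
      ((- \<i>) ^ n * of_real ((cmod a)\<^sup>2) + \<i> ^ n * of_real ((cmod b)\<^sup>2)))"
    unfolding wedge_def P_def Q_def by simp
  also have "\<dots> = of_real (K / (fact n * fact n) * (cmod (\<Omega> x))\<^sup>2) *
      ((- \<i>) ^ n * of_real ((cmod a)\<^sup>2) + \<i> ^ n * of_real ((cmod b)\<^sup>2))"
    by (simp add: scaleR_conv_of_real)
  finally show ?thesis using K(1) by blast
qed

text \<open>
  The top form defining the volume is compared with \<open>\<omega>\<^sup>n\<close>, on the basis of the lattice and on the
  basis \<open>x, J x\<close> given by the unitary frame.  For odd \<open>n\<close> the two contributions to the volume have
  opposite signs, and the determinant has to be positive.
\<close>

lemma Vol_lower_bound:
  fixes \<omega> :: "'a::euclidean_space \<Rightarrow> 'a \<Rightarrow> real"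
  assumes torus: "rational_symplectic_torus \<omega> \<Lambda>" and dim: "DIM('a) = 2 * n" and n: "n > 0"
  shows "\<exists>c>0. \<forall>J \<Omega> x A. compatible_complex_structure \<omega> J \<longrightarrow> alternating_form n \<Omega> \<longrightarrow> type_n_0 n J \<Omega> \<longrightarrow>
    unitary_frame \<omega> J n x \<longrightarrow> det A > 0 \<or> even n \<longrightarrow>
    c * (\<bar>det A\<bar> * (cmod (\<Omega> x))\<^sup>2) \<le> Vol n \<omega> \<Lambda> (\<lambda>v. matrix_act A (\<Omega> v))"
proof -
  have \<omega>: "symplectic_form \<omega>" and \<Lambda>: "is_lattice \<Lambda>"
    using torus by (auto simp: rational_symplectic_torus_def)
  obtain B where B: "B > 0" "\<And>x y. symplectic_frame \<omega> n x y \<Longrightarrow>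
      0 < block_sign n * wedge_power n \<omega> (block n x y) \<and> block_sign n * wedge_power n \<omega> (block n x y) \<le> B"
    using wedge_power_symplectic_frame[OF \<omega>, of n] by blast
  \<comment> \<open>The basis on which \<open>torus_integral\<close> evaluates forms.\<close>
  define b0 where "b0 = (SOME b. lattice_basis \<Lambda> b \<and> wedge_power n \<omega> b > 0)"
  define W where "W = wedge_power n \<omega> b0"
  \<comment> \<open>A unitary frame implies \<open>W > 0\<close>; without one the claim is void and any positive number will do.\<close>
  define c where "c = (if W > 0 then 1 / (2 ^ n * (fact n * fact n)) * (W / B) else 1)"
  have "c > 0" using B(1) by (simp add: c_def)
  moreover have "c * (\<bar>det A\<bar> * (cmod (\<Omega> x))\<^sup>2) \<le> Vol n \<omega> \<Lambda> (\<lambda>v. matrix_act A (\<Omega> v))"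
    if J: "compatible_complex_structure \<omega> J" and \<Omega>: "alternating_form n \<Omega>" and type: "type_n_0 n J \<Omega>"
      and x: "unitary_frame \<omega> J n x" and A: "det A > 0 \<or> even n" for J \<Omega> x A
  proof -
    define u where "u = block n x (\<lambda>i. J (x i))"
    define V where "V = block_sign n * wedge_power n \<omega> u"
    have V: "0 < V" "V \<le> B"
      using B(2)[OF unitary_frame_symplectic[OF J x]] by (simp_all add: V_def u_def)
    then have "wedge_power n \<omega> u \<noteq> 0" by (auto simp: V_def)
    from someI_ex[OF positive_lattice_basis_exists[OF \<Lambda> \<omega> dim this n]]
    have W: "W > 0" unfolding W_def b0_def by (rule conjunct2)
    define \<eta> where "\<eta> v = (-1) ^ (n * (n - 1) div 2) * (\<i> / 2) ^ n *
        wedge n n (\<lambda>v. matrix_act A (\<Omega> v)) (\<lambda>w. cnj (matrix_act A (\<Omega> w))) v" for v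
    have Vol: "Vol n \<omega> \<Lambda> (\<lambda>v. matrix_act A (\<Omega> v)) = Re (\<eta> b0)"
      by (simp add: Vol_def torus_integral_def b0_def \<eta>_def)
    have alt: "alternating_form (2 * n) \<eta>"
    proof -
      have "alternating_form (n + n) (wedge n n (\<lambda>v. matrix_act A (\<Omega> v)) (\<lambda>v. cnj (matrix_act A (\<Omega> v))))"
        by (intro alternating_form_wedge alternating_form_matrix_act[OF \<Omega>]
            alternating_form_compose_linear[OF alternating_form_matrix_act[OF \<Omega>]]
            bounded_linear.linear[OF bounded_linear_cnj])
      from alternating_form_compose_linear[OF this, of "\<lambda>z. (-1) ^ (n * (n - 1) div 2) * (\<i> / 2) ^ n * z"]
      show ?thesis
        unfolding \<eta>_def mult_2 by (simp add: bounded_linear.linear bounded_linear_mult_right)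
    qed
    have alt_w: "alternating_form (2 * n) (wedge_power n \<omega>)"
      using \<omega> by (intro alternating_form_wedge_power) (auto simp: symplectic_form_def)
    have proportional: "\<eta> b0 * of_real (wedge_power n \<omega> u) = \<eta> u * of_real W"
      unfolding W_def
      by (rule top_forms_proportional[OF alt alt_w]) (simp add: u_def unitary_frame_spans[OF \<omega> J dim x])
    obtain a b where ab: "\<And>z. matrix_act A z = a * z + b * cnj z" "det A = (cmod a)\<^sup>2 - (cmod b)\<^sup>2"
      by (rule matrix_act_conj_split[of A]) (rule that)
    obtain K where K: "K \<ge> 1" "wedge n n (\<lambda>v. matrix_act A (\<Omega> v)) (\<lambda>v. cnj (matrix_act A (\<Omega> v))) u =
      of_real (K / (fact n * fact n) * (cmod (\<Omega> x))\<^sup>2) *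
        ((- \<i>) ^ n * of_real ((cmod a)\<^sup>2) + \<i> ^ n * of_real ((cmod b)\<^sup>2))"
      unfolding u_def using wedge_matrix_act[OF \<Omega> type n ab(1)] by blast
    define D where "D = (cmod a)\<^sup>2 + (-1) ^ n * (cmod b)\<^sup>2"
    have D: "\<bar>det A\<bar> \<le> D"
    proof (cases "even n")
      case True
      then show ?thesis unfolding ab(2) D_def by (simp add: abs_le_iff)
    next
      case False
      then have "det A > 0" using A by simp
      moreover have "D = det A" using False by (simp add: ab(2) D_def)
      ultimately show ?thesis by simp
    qed
    define R where "R = K / (2 ^ n * (fact n * fact n)) * (cmod (\<Omega> x))\<^sup>2 * D"
    have ii: "(\<i> / 2) ^ n * ((- \<i>) ^ n * of_real p + \<i> ^ n * of_real q) =
        of_real ((p + (-1) ^ n * q) / 2 ^ n)" for p q :: real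
    proof -
      have "\<i> ^ n * (- \<i>) ^ n = 1" "\<i> ^ n * \<i> ^ n = (-1) ^ n"
        by (simp_all flip: power_mult_distrib)
      then have "\<i> ^ n * ((- \<i>) ^ n * of_real p + \<i> ^ n * of_real q) = of_real p + (-1) ^ n * of_real q"
        by (simp add: distrib_left flip: mult.assoc)
      then show ?thesis by (simp add: power_divide)
    qed
    have \<eta>_u: "\<eta> u = of_real (block_sign n * R)"
    proof -
      have "\<eta> u = of_real (block_sign n) * of_real (K / (fact n * fact n) * (cmod (\<Omega> x))\<^sup>2) *
          ((\<i> / 2) ^ n * ((- \<i>) ^ n * of_real ((cmod a)\<^sup>2) + \<i> ^ n * of_real ((cmod b)\<^sup>2)))"
        unfolding \<eta>_def K(2) by (simp add: block_sign_def)
      also have "\<dots> = of_real (block_sign n * R)"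
        unfolding ii R_def D_def by (simp add: field_simps)
      finally show ?thesis .
    qed
    have "Re (\<eta> b0) * V = R * W"
    proof -
      have "Re (\<eta> b0 * of_real (wedge_power n \<omega> u)) = Re (\<eta> u * of_real W)" by (simp only: proportional)
      then have "Re (\<eta> b0) * wedge_power n \<omega> u = block_sign n * R * W" by (simp add: \<eta>_u)
      then have "block_sign n * (Re (\<eta> b0) * wedge_power n \<omega> u) = (block_sign n * block_sign n) * (R * W)"
        by (simp only: mult_ac)
      then show ?thesis by (simp add: block_sign_sq V_def mult_ac)
    qed
    then have Re_eq: "Re (\<eta> b0) = R * (W / V)" using V(1) by (simp add: field_simps)
    have Kf: "1 / (2 ^ n * (fact n * fact n)) \<le> K / (2 ^ n * (fact n * fact n))"
      using K(1) by (intro divide_right_mono) auto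
    have "1 / (2 ^ n * (fact n * fact n)) * (cmod (\<Omega> x))\<^sup>2 * \<bar>det A\<bar> \<le> R"
      unfolding R_def using Kf D K(1) by (intro mult_mono) auto
    moreover have "W / B \<le> W / V" using V W by (intro divide_left_mono) auto
    ultimately have "1 / (2 ^ n * (fact n * fact n)) * (cmod (\<Omega> x))\<^sup>2 * \<bar>det A\<bar> * (W / B) \<le> R * (W / V)"
    proof (rule mult_mono)
      show "0 \<le> R" unfolding R_def using K(1) D abs_ge_zero[of "det A"] by (intro mult_nonneg_nonneg) auto
      show "0 \<le> W / B" using W B(1) by simp
    qed
    then show ?thesis unfolding Vol Re_eq c_def using W by (simp add: mult_ac)
  qed
  ultimately show ?thesis by blast
qed

section \<open>Linear Lagrangian tori\<close>

text \<open>
  The real factor \<open>r\<close> may be negative, which shifts the argument by \<open>\<pi>\<close>.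
\<close>

lemma Arg_rcong_pi:
  assumes "z \<noteq> 0" "z = of_real r * cis \<phi>"
  shows "[Arg z = \<phi>] (rmod pi)"
proof -
  have "of_real (cmod z) * cis (Arg z) = of_real r * cis \<phi>"
    using rcis_cmod_Arg[of z] assms(2) by (simp add: rcis_def)
  then have "of_real (cmod z) * (cis (Arg z) * cis (- \<phi>)) = of_real r * (cis \<phi> * cis (- \<phi>))"
    by (simp only: mult.assoc[symmetric])
  then have "of_real (cmod z) * cis (Arg z - \<phi>) = of_real r"
    by (simp add: cis_mult)
  from arg_cong[OF this, of Im] have "cmod z * sin (Arg z - \<phi>) = 0" by simp
  then have "sin (Arg z - \<phi>) = 0" using assms(1) by simp
  then obtain i where "Arg z - \<phi> = of_int i * pi" by (auto simp: sin_zero_iff_int2)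
  then have "\<phi> = Arg z + of_int (- i) * pi" by simp
  then show ?thesis unfolding rcong_altdef by blast
qed

lemma has_phase_span:
  assumes \<Omega>: "alternating_form n \<Omega>" and e: "\<Omega> e \<noteq> 0" "\<Omega> e = of_real r * cis \<phi>"
  shows "has_phase n \<Omega> (span (e ` {..<n})) \<phi>"
  unfolding has_phase_def
proof (intro conjI allI impI)
  show "\<exists>v. (\<forall>i<n. v i \<in> span (e ` {..<n})) \<and> \<Omega> v \<noteq> 0"
    using e by (intro exI[of _ e]) (auto simp: span_base)
  fix v assume v: "(\<forall>i<n. v i \<in> span (e ` {..<n})) \<and> \<Omega> v \<noteq> 0"
  then obtain s where "\<Omega> v = of_real s * \<Omega> e"
    using alternating_form_real_ratio[OF \<Omega> e(1), of v] by blast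
  then have "\<Omega> v = of_real (s * r) * cis \<phi>" by (simp add: e(2))
  then show "[Arg (\<Omega> v) = \<phi>] (rmod pi)" using v by (intro Arg_rcong_pi[of _ "s * r"]) auto
qed

text \<open>
  The derivative of an affine map in a fixed direction is constant, hence affine again.
\<close>

lemma Ck_on_affine:
  fixes c :: "'c::real_normed_vector"
  assumes "bounded_linear L"
  shows "Ck_on k (\<lambda>x. c + L x) U"
  using assms
proof (induction k arbitrary: c L)
  case 0
  then show ?case
    unfolding Ck_on.simps by (intro continuous_on_add continuous_on_const linear_continuous_on)
next
  case (Suc k)
  have deriv: "((\<lambda>x. c + L x) has_derivative L) (at x)" for x
    using Suc.prems by (auto intro!: derivative_eq_intros bounded_linear_imp_has_derivative)
  then have "frechet_derivative (\<lambda>x. c + L x) (at x) = L" for x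
    by (metis frechet_derivative_at)
  moreover have "Ck_on k (\<lambda>x. L h) U" for h
    using Suc.IH[OF bounded_linear_zero, of "L h"] by simp
  ultimately show ?case using deriv by (auto simp: differentiable_def)
qed

lemma torus_proj_eq_iff:
  assumes "is_lattice \<Lambda>"
  shows "torus_proj \<Lambda> v = torus_proj \<Lambda> w \<longleftrightarrow> v - w \<in> \<Lambda>"
proof
  assume "torus_proj \<Lambda> v = torus_proj \<Lambda> w"
  moreover have "v \<in> torus_proj \<Lambda> v"
    unfolding torus_proj_def using lattice_0[OF assms] by (intro image_eqI[of _ _ 0]) auto
  ultimately show "v - w \<in> \<Lambda>" by (auto simp: torus_proj_def)
next
  assume *: "v - w \<in> \<Lambda>"
  have "torus_proj \<Lambda> v \<subseteq> torus_proj \<Lambda> w" if "v - w \<in> \<Lambda>" for v w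
  proof
    fix x assume "x \<in> torus_proj \<Lambda> v"
    then obtain l where l: "l \<in> \<Lambda>" "x = v + l" by (auto simp: torus_proj_def)
    then have "x = w + ((v - w) + l)" by simp
    moreover have "(v - w) + l \<in> \<Lambda>" using lattice_add[OF assms that l(1)] .
    ultimately show "x \<in> torus_proj \<Lambda> w" unfolding torus_proj_def by blast
  qed
  moreover have "w - v \<in> \<Lambda>" using lattice_diff[OF assms lattice_0[OF assms] *] by simp
  ultimately show "torus_proj \<Lambda> v = torus_proj \<Lambda> w" using * by blast
qed

text \<open>
  A basis \<open>e\<close> of the lattice together with its coordinate functionals \<open>\<xi>\<close>.  Its first \<open>CARD('n)\<close>
  vectors span the subspace whose image in the torus is studied.
\<close>

locale adapted_basis =
  fixes \<Lambda> :: "'a::euclidean_space set" and e :: "nat \<Rightarrow> 'a" and \<xi> :: "nat \<Rightarrow> 'a \<Rightarrow> real"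
    and N :: "'n::finite itself"
  assumes \<Lambda>: "is_lattice \<Lambda>" and dim: "CARD('n) \<le> DIM('a)" and basis: "primitive_frame \<Lambda> e DIM('a)"
    and \<xi>_linear: "\<And>i. linear (\<xi> i)"
    and \<xi>_dual: "\<And>i j. j < DIM('a) \<Longrightarrow> \<xi> i (e j) = (if j = i then 1 else 0)"

context adapted_basis
begin

definition W :: "'a set" where "W = span (e ` {..<CARD('n)})"

definition S :: "'a set" where "S = torus_proj \<Lambda> -` torus_proj \<Lambda> ` W"

definition idx :: "'n \<Rightarrow> nat" where "idx = to_nat_on UNIV"

definition par :: "real^'n \<Rightarrow> 'a" where "par x = (\<Sum>i\<in>UNIV. (x $ i) *\<^sub>R e (idx i))"

definition chart :: "'a \<Rightarrow> real^'n \<Rightarrow> 'a" where "chart p x = p + par x"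

lemma \<xi>_expand: "v = (\<Sum>j<DIM('a). \<xi> j v *\<^sub>R e j)"
  by (rule coordinate_functionals_expand[OF \<xi>_linear \<xi>_dual])
    (simp_all add: primitive_frame_span_UNIV[OF basis])

lemma idx_bij: "bij_betw idx UNIV {..<CARD('n)}"
  unfolding idx_def by (rule to_nat_on_finite) simp

lemma idx_less: "idx i < CARD('n)"
  using idx_bij by (auto simp: bij_betw_def)

lemma idx_inj: "idx i = idx j \<longleftrightarrow> i = j"
  using idx_bij by (auto simp: bij_betw_def inj_on_def)

lemma idx_sum: "(\<Sum>i\<in>UNIV. f (idx i)) = (\<Sum>j<CARD('n). f j)"
  by (rule sum.reindex_bij_betw[OF idx_bij])

lemma \<xi>_par: "\<xi> (idx i) (par x) = x $ i"
proof -
  have eq: "\<xi> (idx i) (e (idx a)) = (if a = i then 1 else 0)" for a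
    using \<xi>_dual[OF less_le_trans[OF idx_less[of a] dim], of "idx i"] by (simp add: idx_inj)
  show ?thesis
    by (simp add: par_def linear_sum[OF \<xi>_linear] linear_scale[OF \<xi>_linear] eq if_distrib cong: if_cong)
qed

lemma \<xi>_W: "v \<in> W \<Longrightarrow> CARD('n) \<le> j \<Longrightarrow> \<xi> j v = 0"
  unfolding W_def by (rule linear_eq_0_on_span[OF \<xi>_linear]) (use dim in \<open>auto simp: \<xi>_dual\<close>)

lemma W_iff: "v \<in> W \<longleftrightarrow> (\<forall>j\<in>{CARD('n)..<DIM('a)}. \<xi> j v = 0)"
proof
  assume v: "\<forall>j\<in>{CARD('n)..<DIM('a)}. \<xi> j v = 0"
  have "v = (\<Sum>j<DIM('a). \<xi> j v *\<^sub>R e j)" by (rule \<xi>_expand)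
  also have "\<dots> = (\<Sum>j<CARD('n). \<xi> j v *\<^sub>R e j)"
    using v dim by (intro sum.mono_neutral_right) auto
  finally show "v \<in> W"
    unfolding W_def span_image_lessThan by (intro exI[of _ "\<lambda>j. \<xi> j v"])
qed (auto simp: \<xi>_W)

lemma subspace_W: "subspace W" by (simp add: W_def)

lemma par_W: "par x \<in> W"
  unfolding par_def W_def by (intro span_sum span_scale span_base imageI) (simp add: idx_less)

lemma W_par: "v \<in> W \<Longrightarrow> par (\<chi> i. \<xi> (idx i) v) = v"
proof -
  assume v: "v \<in> W"
  have "v = (\<Sum>j<CARD('n). \<xi> j v *\<^sub>R e j)"
    by (rule coordinate_functionals_expand[OF \<xi>_linear]) (use v dim in \<open>auto simp: W_def \<xi>_dual\<close>)
  then show ?thesis unfolding par_def by (simp add: idx_sum[of "\<lambda>j. \<xi> j v *\<^sub>R e j"])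
qed

lemma linear_par: "linear par"
  by (rule linearI) (simp_all add: par_def scaleR_add_left sum.distrib scaleR_sum_right)

lemma par_inj: "par x = 0 \<Longrightarrow> x = 0"
  using \<xi>_par[of _ x] by (simp add: vec_eq_iff linear_0[OF \<xi>_linear])

lemma \<xi>_\<Lambda>: "v \<in> \<Lambda> \<Longrightarrow> j < DIM('a) \<Longrightarrow> \<xi> j v \<in> \<int>"
proof -
  assume v: "v \<in> \<Lambda>" and j: "j < DIM('a)"
  obtain c :: "nat \<Rightarrow> int" where c: "v = (\<Sum>j<DIM('a). of_int (c j) *\<^sub>R e j)"
    using primitive_frame_combination[OF basis v] by blast
  have "\<xi> j v = of_int (c j)"
    using j by (simp add: c linear_sum[OF \<xi>_linear] linear_scale[OF \<xi>_linear] \<xi>_dual if_distrib cong: if_cong)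
  then show ?thesis by simp
qed

lemma S_eq: "S = {v. \<exists>w\<in>W. v - w \<in> \<Lambda>}"
  by (auto simp: S_def torus_proj_eq_iff[OF \<Lambda>])

text \<open>
  In the coordinates of the lattice basis, the preimage of the subtorus consists of the
  translates of the subspace by integral values of the remaining coordinates.
\<close>

lemma S_iff: "v \<in> S \<longleftrightarrow> (\<forall>j\<in>{CARD('n)..<DIM('a)}. \<xi> j v \<in> \<int>)"
proof
  assume "v \<in> S"
  then obtain w where w: "w \<in> W" "v - w \<in> \<Lambda>" by (auto simp: S_eq)
  show "\<forall>j\<in>{CARD('n)..<DIM('a)}. \<xi> j v \<in> \<int>"
  proof
    fix j assume j: "j \<in> {CARD('n)..<DIM('a)}"
    have "\<xi> j v = \<xi> j (v - w)" using w(1) j by (simp add: linear_diff[OF \<xi>_linear] \<xi>_W)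
    then show "\<xi> j v \<in> \<int>" using \<xi>_\<Lambda>[OF w(2), of j] j by simp
  qed
next
  assume v: "\<forall>j\<in>{CARD('n)..<DIM('a)}. \<xi> j v \<in> \<int>"
  define w where "w = (\<Sum>j<CARD('n). \<xi> j v *\<^sub>R e j)"
  have "w \<in> W"
    unfolding w_def W_def span_image_lessThan by (intro exI[of _ "\<lambda>j. \<xi> j v"]) simp
  have "v = (\<Sum>j\<in>{..<CARD('n)} \<union> {CARD('n)..<DIM('a)}. \<xi> j v *\<^sub>R e j)"
    using \<xi>_expand[of v] dim by (simp add: ivl_disj_un_one)
  also have "\<dots> = w + (\<Sum>j\<in>{CARD('n)..<DIM('a)}. \<xi> j v *\<^sub>R e j)"
    unfolding w_def by (rule sum.union_disjoint) auto
  finally have "v - w = (\<Sum>j\<in>{CARD('n)..<DIM('a)}. \<xi> j v *\<^sub>R e j)" by (simp add: algebra_simps)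
  also have "\<dots> = (\<Sum>j\<in>{CARD('n)..<DIM('a)}. of_int \<lfloor>\<xi> j v\<rfloor> *\<^sub>R e j)"
    using v by (intro sum.cong) auto
  also have "\<dots> \<in> \<Lambda>"
    using basis by (intro lattice_sum[OF \<Lambda>]) (auto simp: primitive_frame_def)
  finally show "v \<in> S" using \<open>w \<in> W\<close> by (auto simp: S_eq)
qed

lemma chart_deriv: "(chart p has_derivative par) (at x)"
  unfolding chart_def[abs_def] using linear_par
  by (auto intro!: derivative_eq_intros bounded_linear_imp_has_derivative linear_conv_bounded_linear[THEN iffD1])

lemma chart_frechet: "frechet_derivative (chart p) (at x) = par"
  using frechet_derivative_at[OF chart_deriv] by simp

lemma chart_image: "chart p ` UNIV = {v. v - p \<in> W}"
proof
  show "chart p ` UNIV \<subseteq> {v. v - p \<in> W}" by (auto simp: chart_def par_W)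
  show "{v. v - p \<in> W} \<subseteq> chart p ` UNIV"
  proof
    fix v assume "v \<in> {v. v - p \<in> W}"
    then have "v = chart p (\<chi> i. \<xi> (idx i) (v - p))" using W_par[of "v - p"] by (simp add: chart_def)
    then show "v \<in> chart p ` UNIV" by blast
  qed
qed

lemma continuous_\<xi>: "continuous_on A (\<xi> j)"
  using \<xi>_linear by (intro linear_continuous_on) (simp add: linear_conv_bounded_linear)

text \<open>
  Near \<open>p\<close> the integral coordinates cannot jump, so the preimage of the subtorus is an affine subspace.
\<close>

lemma local_parametrization_chart:
  assumes p: "p \<in> S"
  shows "local_parametrization S (chart p) UNIV"
  unfolding local_parametrization_def
proof (intro conjI ballI)
  show "smooth_on (chart p) UNIV"
    unfolding smooth_on_def chart_def[abs_def]
    using Ck_on_affine linear_par by (auto simp: linear_conv_bounded_linear)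
  show "inj (frechet_derivative (chart p) (at x))" for x
    unfolding chart_frechet linear_injective_0[OF linear_par] using par_inj by blast
  have "chart p ` UNIV = S \<inter> (\<Inter>j\<in>{CARD('n)..<DIM('a)}. {v. \<bar>\<xi> j v - \<xi> j p\<bar> < 1})"
  proof -
    have "v - p \<in> W \<longleftrightarrow> v \<in> S \<and> (\<forall>j\<in>{CARD('n)..<DIM('a)}. \<bar>\<xi> j v - \<xi> j p\<bar> < 1)" for v
    proof -
      have "\<xi> j v = \<xi> j p \<longleftrightarrow> \<xi> j v \<in> \<int> \<and> \<bar>\<xi> j v - \<xi> j p\<bar> < 1" if "j \<in> {CARD('n)..<DIM('a)}" for j
        using p that Ints_eq_abs_less1[of "\<xi> j v" "\<xi> j p"] by (auto simp: S_iff)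
      then show ?thesis unfolding W_iff S_iff by (auto simp: linear_diff[OF \<xi>_linear])
    qed
    then show ?thesis unfolding chart_image by auto
  qed
  moreover have "open (\<Inter>j\<in>{CARD('n)..<DIM('a)}. {v. \<bar>\<xi> j v - \<xi> j p\<bar> < 1})"
    by (intro open_INT ballI open_Collect_less continuous_intros continuous_\<xi>) auto
  ultimately show "openin (top_of_set S) (chart p ` UNIV)" by (auto simp: openin_open)
  show "\<exists>g. homeomorphism UNIV (chart p ` UNIV) (chart p) g"
  proof (intro exI homeomorphismI)
    let ?g = "\<lambda>v. \<chi> i. \<xi> (idx i) (v - p)"
    show "continuous_on UNIV (chart p)"
      using has_derivative_continuous[OF chart_deriv] by (simp add: continuous_on_eq_continuous_within)
    show "continuous_on (chart p ` UNIV) ?g"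
      by (intro continuous_on_vec_lambda continuous_on_compose2[OF continuous_\<xi>[where A = UNIV]] continuous_intros) auto
    show "chart p ` UNIV \<subseteq> chart p ` UNIV" "?g ` (chart p ` UNIV) \<subseteq> UNIV" by auto
    show "?g (chart p x) = x" for x by (simp add: chart_def \<xi>_par vec_eq_iff)
    show "chart p (?g v) = v" if "v \<in> chart p ` UNIV" for v
      using that W_par[of "v - p"] unfolding chart_image by (simp add: chart_def)
  qed
qed simp

lemma embedded_submanifold_S: "embedded_submanifold TYPE('n) S"
  unfolding embedded_submanifold_def
proof
  fix p assume "p \<in> S"
  moreover have "p \<in> chart p ` UNIV" by (simp add: chart_image subspace_0[OF subspace_W])
  ultimately show "\<exists>(\<psi> :: real^'n \<Rightarrow> 'a) U. local_parametrization S \<psi> U \<and> p \<in> \<psi> ` U"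
    using local_parametrization_chart by blast
qed

text \<open>
  Along any parametrisation the transversal coordinates are integers, hence locally constant.
\<close>

lemma derivative_in_W:
  fixes \<psi> :: "real^'n \<Rightarrow> 'a"
  assumes \<psi>: "local_parametrization S \<psi> U" and x: "x \<in> U"
  shows "frechet_derivative \<psi> (at x) h \<in> W"
  unfolding W_iff
proof
  fix j assume j: "j \<in> {CARD('n)..<DIM('a)}"
  have U: "open U" and smooth: "Ck_on (Suc 0) \<psi> U"
    using \<psi> by (auto simp: local_parametrization_def smooth_on_def)
  have \<psi>S: "\<psi> ` U \<subseteq> S" using \<psi> unfolding local_parametrization_def by (blast dest: openin_imp_subset)
  let ?D = "frechet_derivative \<psi> (at x)"
  have D: "(\<psi> has_derivative ?D) (at x)"
    using smooth x frechet_derivative_works by auto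
  have bl: "bounded_linear (\<xi> j)" using \<xi>_linear by (simp add: linear_conv_bounded_linear)
  have D\<xi>: "((\<lambda>y. \<xi> j (\<psi> y)) has_derivative (\<lambda>h. \<xi> j (?D h))) (at x)"
    by (rule bounded_linear.has_derivative[OF bl D])
  then have "continuous (at x) (\<lambda>y. \<xi> j (\<psi> y))" by (rule has_derivative_continuous)
  then have "((\<lambda>y. \<xi> j (\<psi> y)) \<longlongrightarrow> \<xi> j (\<psi> x)) (at x)" by (simp add: continuous_within)
  from tendstoD[OF this, of 1] have "eventually (\<lambda>y. dist (\<xi> j (\<psi> y)) (\<xi> j (\<psi> x)) < 1) (at x)" by simp
  moreover have "eventually (\<lambda>y. y \<in> U) (at x)" using U x by (rule eventually_at_in_open')
  ultimately have ev: "eventually (\<lambda>y. \<xi> j (\<psi> y) = \<xi> j (\<psi> x)) (at x)"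
  proof eventually_elim
    case (elim y)
    have "\<xi> j (\<psi> y) \<in> \<int>" "\<xi> j (\<psi> x) \<in> \<int>" using \<psi>S elim(2) x j unfolding S_iff[abs_def] subset_iff by (auto simp: S_iff)
    then show ?case using elim(1) Ints_eq_abs_less1[of "\<xi> j (\<psi> y)" "\<xi> j (\<psi> x)"] by (simp add: dist_real_def)
  qed
  have "((\<lambda>y. \<xi> j (\<psi> y)) has_derivative (\<lambda>h. 0)) (at x)"
    by (rule has_derivative_transform_eventually[OF has_derivative_const[of "\<xi> j (\<psi> x)"]])
      (use ev in \<open>auto elim: eventually_mono\<close>)
  then have "(\<lambda>h. \<xi> j (?D h)) = (\<lambda>h. 0)" using D\<xi> has_derivative_unique by blast
  then show "\<xi> j (?D h) = 0" by metis
qed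

lemma tangent_space_S:
  assumes p: "p \<in> S"
  shows "tangent_space TYPE('n) S p = W"
proof
  show "tangent_space TYPE('n) S p \<subseteq> W"
    unfolding tangent_space_def using derivative_in_W by auto
  show "W \<subseteq> tangent_space TYPE('n) S p"
  proof
    fix v assume "v \<in> W"
    then have "v = frechet_derivative (chart p) (at 0) (\<chi> i. \<xi> (idx i) v)"
      by (simp add: chart_frechet W_par)
    moreover have "chart p 0 = p" by (simp add: chart_def linear_0[OF linear_par])
    ultimately show "v \<in> tangent_space TYPE('n) S p"
      unfolding tangent_space_def using local_parametrization_chart[OF p] by blast
  qed
qed

lemma W_reduce: "v \<in> W \<Longrightarrow> \<exists>x. (\<forall>i. 0 \<le> x $ i \<and> x $ i < 1) \<and> torus_proj \<Lambda> (par x) = torus_proj \<Lambda> v"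
proof -
  assume v: "v \<in> W"
  let ?x = "\<chi> i. frac (\<xi> (idx i) v)"
  have "v - par ?x = par (\<chi> i. \<xi> (idx i) v) - par ?x" using W_par[OF v] by simp
  also have "\<dots> = (\<Sum>i\<in>UNIV. of_int \<lfloor>\<xi> (idx i) v\<rfloor> *\<^sub>R e (idx i))"
    by (simp add: par_def frac_def flip: sum_subtractf scaleR_diff_left)
  also have "\<dots> \<in> \<Lambda>"
    using basis idx_less dim by (intro lattice_sum[OF \<Lambda>]) (auto simp: primitive_frame_def intro: less_le_trans)
  finally have "torus_proj \<Lambda> v = torus_proj \<Lambda> (par ?x)" by (simp add: torus_proj_eq_iff[OF \<Lambda>])
  then show ?thesis by (intro exI[of _ ?x]) (simp add: frac_lt_1)
qed

text \<open>
  The subtorus is the image of a cube.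
\<close>

lemma compactin_proj_W: "compactin (torus_topology \<Lambda>) (torus_proj \<Lambda> ` W)"
proof -
  have "openin (torus_topology \<Lambda>) (torus \<Lambda>)"
    by (simp add: openin_torus_topology torus_def vimage_def)
  then have "torus \<Lambda> \<subseteq> topspace (torus_topology \<Lambda>)" by (rule openin_subset)
  then have cont: "continuous_map euclidean (torus_topology \<Lambda>) (torus_proj \<Lambda>)"
    unfolding continuous_map_def by (auto simp: openin_torus_topology torus_def vimage_def)
  have "compact (par ` cbox 0 1)"
    using linear_par by (intro compact_continuous_image linear_continuous_on compact_cbox)
      (simp add: linear_conv_bounded_linear)
  then have "compactin (torus_topology \<Lambda>) (torus_proj \<Lambda> ` par ` cbox 0 1)"
    by (intro image_compactin[OF _ cont]) simp
  moreover have "torus_proj \<Lambda> ` par ` cbox 0 1 = torus_proj \<Lambda> ` W"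
  proof
    show "torus_proj \<Lambda> ` par ` cbox 0 1 \<subseteq> torus_proj \<Lambda> ` W" using par_W by auto
    show "torus_proj \<Lambda> ` W \<subseteq> torus_proj \<Lambda> ` par ` cbox 0 1"
    proof (rule image_subsetI)
      fix v assume "v \<in> W"
      then obtain x where x: "\<forall>i. 0 \<le> x $ i \<and> x $ i < 1" "torus_proj \<Lambda> (par x) = torus_proj \<Lambda> v"
        using W_reduce by blast
      then have "x \<in> cbox 0 1" by (simp add: mem_box_cart less_imp_le)
      then show "torus_proj \<Lambda> v \<in> torus_proj \<Lambda> ` par ` cbox 0 1" using x(2)[symmetric] by blast
    qed
  qed
  ultimately show ?thesis by simp
qed


lemma compact_special_lagrangian_proj_W:
  assumes L: "lagrangian_subspace \<omega> W" and phase: "has_phase CARD('n) \<Omega> W \<phi>"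
  shows "compact_special_lagrangian TYPE('n) \<omega> \<Lambda> \<Omega> (torus_proj \<Lambda> ` W)"
  unfolding compact_special_lagrangian_def Let_def
proof (intro conjI)
  show "torus_proj \<Lambda> ` W \<noteq> {}" using subspace_0[OF subspace_W] by blast
  show "torus_proj \<Lambda> ` W \<subseteq> torus \<Lambda>" by (auto simp: torus_def)
  show "compactin (torus_topology \<Lambda>) (torus_proj \<Lambda> ` W)" by (rule compactin_proj_W)
  show "embedded_submanifold TYPE('n) (torus_proj \<Lambda> -` torus_proj \<Lambda> ` W)"
    using embedded_submanifold_S by (simp add: S_def)
  show "\<forall>p\<in>torus_proj \<Lambda> -` torus_proj \<Lambda> ` W.
      lagrangian_subspace \<omega> (tangent_space TYPE('n) (torus_proj \<Lambda> -` torus_proj \<Lambda> ` W) p)"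
    using tangent_space_S L unfolding S_def by simp
  show "\<exists>\<phi>. \<forall>p\<in>torus_proj \<Lambda> -` torus_proj \<Lambda> ` W.
      has_phase CARD('n) \<Omega> (tangent_space TYPE('n) (torus_proj \<Lambda> -` torus_proj \<Lambda> ` W) p) \<phi>"
    using tangent_space_S phase unfolding S_def by auto
qed

text \<open>
  A fundamental cell in the first piece; the other pieces are empty.
\<close>

definition cells :: "nat \<Rightarrow> (real^'n) set" where
  "cells k = (if k = 0 then {x. \<forall>i. 0 \<le> x $ i \<and> x $ i < 1} else {})"

lemma cell_borel: "cells k \<in> sets borel"
proof -
  have "{x :: real^'n. \<forall>i. 0 \<le> x $ i \<and> x $ i < 1} = (\<Inter>i. {x. 0 \<le> x $ i}) \<inter> (\<Inter>i. {x. x $ i < 1})"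
    by auto
  moreover have "closed (\<Inter>i. {x :: real^'n. 0 \<le> x $ i})"
    by (intro closed_INT ballI closed_Collect_le continuous_intros)
  moreover have "open (\<Inter>i. {x :: real^'n. x $ i < 1})"
    by (intro open_INT ballI open_Collect_less continuous_intros) auto
  ultimately show ?thesis unfolding cells_def by auto
qed

lemma parametrized_partition_proj_W:
  "parametrized_partition \<Lambda> (torus_proj \<Lambda> ` W) (\<lambda>_. chart 0) cells"
  unfolding parametrized_partition_def
proof (intro conjI allI)
  have S0: "0 \<in> S" using S_iff by (simp add: linear_0[OF \<xi>_linear])
  fix k
  show "cells k \<in> sets borel" by (rule cell_borel)
  show "\<exists>U. cells k \<subseteq> U \<and> local_parametrization (torus_proj \<Lambda> -` torus_proj \<Lambda> ` W) (chart 0) U"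
    using local_parametrization_chart[OF S0] unfolding S_def by blast
  show "inj_on (\<lambda>x. torus_proj \<Lambda> (chart 0 x)) (cells k)"
  proof (rule inj_onI)
    fix x y assume xy: "x \<in> cells k" "y \<in> cells k" "torus_proj \<Lambda> (chart 0 x) = torus_proj \<Lambda> (chart 0 y)"
    then have "par x - par y \<in> \<Lambda>" by (simp add: chart_def torus_proj_eq_iff[OF \<Lambda>])
    then have "\<xi> (idx i) (par x - par y) \<in> \<int>" for i
      using less_le_trans[OF idx_less dim] by (intro \<xi>_\<Lambda>)
    then have int: "x $ i - y $ i \<in> \<int>" for i
      by (simp add: linear_diff[OF \<xi>_linear] \<xi>_par)
    have "x $ i = y $ i" for i
    proof -
      have "0 \<le> x $ i \<and> x $ i < 1 \<and> 0 \<le> y $ i \<and> y $ i < 1"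
        using xy by (simp add: cells_def split: if_splits)
      then have "\<bar>(x $ i - y $ i) - 0\<bar> < 1" by linarith
      then show ?thesis using Ints_eq_abs_less1[OF int[of i] Ints_0] by simp
    qed
    then show "x = y" by (simp add: vec_eq_iff)
  qed
next
  show "disjoint_family (\<lambda>k. (\<lambda>x. torus_proj \<Lambda> (chart 0 x)) ` cells k)"
    by (auto simp: disjoint_family_on_def cells_def)
  show "(\<Union>k. (\<lambda>x. torus_proj \<Lambda> (chart 0 x)) ` cells k) = torus_proj \<Lambda> ` W"
  proof
    show "(\<Union>k. (\<lambda>x. torus_proj \<Lambda> (chart 0 x)) ` cells k) \<subseteq> torus_proj \<Lambda> ` W"
      using par_W by (auto simp: chart_def)
    show "torus_proj \<Lambda> ` W \<subseteq> (\<Union>k. (\<lambda>x. torus_proj \<Lambda> (chart 0 x)) ` cells k)"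
    proof (rule image_subsetI)
      fix v assume "v \<in> W"
      then obtain x where x: "\<forall>i. 0 \<le> x $ i \<and> x $ i < 1" "torus_proj \<Lambda> (par x) = torus_proj \<Lambda> v"
        using W_reduce by blast
      then have "x \<in> cells 0" "torus_proj \<Lambda> v = torus_proj \<Lambda> (chart 0 x)" by (simp_all add: cells_def chart_def)
      then show "torus_proj \<Lambda> v \<in> (\<Union>k. (\<lambda>x. torus_proj \<Lambda> (chart 0 x)) ` cells k)" by blast
    qed
  qed
qed

lemma density_coeff_chart:
  assumes \<Omega>: "alternating_form CARD('n) \<Omega>"
  shows "density_coeff \<Omega> (chart p) x = cmod (\<Omega> e)"
proof -
  have "par (axis (from_nat_into UNIV k) 1) = e k" if "k < CARD('n)" for k
  proof -
    have "k \<in> idx ` UNIV" using idx_bij that by (auto simp: bij_betw_def)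
    then have k: "idx (from_nat_into UNIV k) = k" unfolding idx_def by (rule to_nat_on_from_nat_into)
    have "par (axis (from_nat_into UNIV k) 1) =
        (\<Sum>i\<in>UNIV. if i = from_nat_into UNIV k then e (idx i) else 0)"
      unfolding par_def by (intro sum.cong) (auto simp: axis_def)
    then show ?thesis by (simp add: k)
  qed
  then have "\<Omega> (\<lambda>k. frechet_derivative (chart p) (at x) (axis (from_nat_into UNIV k) 1)) = \<Omega> e"
    unfolding chart_frechet by (intro alternating_form_cong[OF \<Omega>])
  then show ?thesis by (simp add: density_coeff_def)
qed

lemma density_integral_proj_W:
  assumes \<Omega>: "alternating_form CARD('n) \<Omega>"
  shows "density_integral TYPE('n) \<Lambda> \<Omega> (torus_proj \<Lambda> ` W) \<le> ennreal (cmod (\<Omega> e))"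
proof -
  let ?f = "\<lambda>k. \<integral>\<^sup>+ x \<in> cells k. ennreal (density_coeff \<Omega> (chart 0) x) \<partial>lborel"
  have "density_integral TYPE('n) \<Lambda> \<Omega> (torus_proj \<Lambda> ` W) \<le> (\<Sum>k. ?f k)"
    unfolding density_integral_def
    by (rule INF_lower2[of "(\<lambda>_. chart 0, cells)"]) (simp_all add: parametrized_partition_proj_W)
  also have "(\<Sum>k. ?f k) = (\<Sum>k\<in>{0}. ?f k)"
    by (rule suminf_finite) (auto simp: cells_def)
  also have "\<dots> = ennreal (cmod (\<Omega> e)) * emeasure lborel (cells 0)"
    using cell_borel by (simp add: density_coeff_chart[OF \<Omega>] nn_integral_cmult_indicator)
  also have "emeasure lborel (cells 0) \<le> emeasure lborel (cbox (0 :: real^'n) 1)"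
    by (intro emeasure_mono) (auto simp: cells_def mem_box_cart less_imp_le)
  also have "emeasure lborel (cbox (0 :: real^'n) 1) = 1"
    by (subst emeasure_lborel_cbox) (auto simp: Basis_vec_def inner_axis prod.neutral)
  finally show ?thesis by (simp add: mult_left_mono)
qed

lemma Sys_le:
  assumes L: "lagrangian_subspace \<omega> W" and \<Omega>: "alternating_form CARD('n) \<Omega>" and nz: "\<Omega> e \<noteq> 0"
  shows "Sys TYPE('n) \<omega> \<Lambda> \<Omega> \<le> ereal (cmod (\<Omega> e))"
proof -
  have "\<Omega> e = of_real (cmod (\<Omega> e)) * cis (Arg (\<Omega> e))"
    using rcis_cmod_Arg[of "\<Omega> e"] by (simp add: rcis_def)
  then have "has_phase CARD('n) \<Omega> W (Arg (\<Omega> e))"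
    unfolding W_def by (rule has_phase_span[OF \<Omega> nz])
  then have "compact_special_lagrangian TYPE('n) \<omega> \<Lambda> \<Omega> (torus_proj \<Lambda> ` W)"
    by (rule compact_special_lagrangian_proj_W[OF L])
  then have "Sys TYPE('n) \<omega> \<Lambda> \<Omega> \<le> enn2ereal (density_integral TYPE('n) \<Lambda> \<Omega> (torus_proj \<Lambda> ` W))"
    unfolding Sys_def by (intro INF_lower) simp
  also have "\<dots> \<le> enn2ereal (ennreal (cmod (\<Omega> e)))"
    using density_integral_proj_W[OF \<Omega>] by (simp add: less_eq_ennreal.rep_eq)
  finally show ?thesis by simp
qed

end

text \<open>
  The image of the span of \<open>e\<close> is a competitor in the definition of the systole.
\<close>

lemma Sys_squared_le:
  fixes \<omega> :: "'a::euclidean_space \<Rightarrow> 'a \<Rightarrow> real"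
  assumes torus: "rational_symplectic_torus \<omega> \<Lambda>" and dims: "DIM('a) = 2 * CARD('n::finite)"
    and e: "primitive_frame \<Lambda> e CARD('n)" and iso: "isotropic \<omega> e CARD('n)"
    and \<Omega>: "alternating_form CARD('n) \<Omega>" and nz: "\<Omega> e \<noteq> 0"
  shows "(Sys TYPE('n) \<omega> \<Lambda> \<Omega>)\<^sup>2 \<le> ereal ((cmod (\<Omega> e))\<^sup>2)"
proof -
  have \<omega>: "symplectic_form \<omega>" and \<Lambda>: "is_lattice \<Lambda>"
    using torus by (auto simp: rational_symplectic_torus_def)
  have le: "CARD('n) \<le> DIM('a)" using dims by simp
  obtain e' where e': "\<And>j. j < CARD('n) \<Longrightarrow> e' j = e j" "primitive_frame \<Lambda> e' DIM('a)"
    using primitive_frame_extends_to_basis[OF \<Lambda> e le] by blast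
  obtain \<xi> :: "nat \<Rightarrow> 'a \<Rightarrow> real" where
    \<xi>: "\<And>i. linear (\<xi> i)" "\<And>i j. j < DIM('a) \<Longrightarrow> \<xi> i (e' j) = (if j = i then 1 else 0)"
    by (rule coordinate_functionals[OF conjunct1 conjunct2, OF primitive_frame_independent[OF e'(2)]
          primitive_frame_independent[OF e'(2)]]) (rule that)
  interpret adapted_basis \<Lambda> e' \<xi> "TYPE('n)"
  proof (rule adapted_basis.intro)
    show "linear (\<xi> i)" for i by (rule \<xi>(1))
    show "\<xi> i (e' j) = (if j = i then 1 else 0)" if "j < DIM('a)" for i j by (rule \<xi>(2)[OF that])
  qed (fact \<Lambda> le e'(2))+
  have \<Omega>e: "\<Omega> e' = \<Omega> e" by (rule alternating_form_cong[OF \<Omega>]) (rule e'(1))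
  have "lagrangian_subspace \<omega> W"
    unfolding W_def
  proof (rule isotropic_span_lagrangian[OF \<omega> dims])
    show "isotropic \<omega> e' CARD('n)" using iso e'(1) by (simp add: isotropic_def)
    show "e' j \<notin> span (e' ` {..<j})" if "j < CARD('n)" for j
      using e'(2) that le by (simp add: primitive_frame_def)
  qed
  then have "Sys TYPE('n) \<omega> \<Lambda> \<Omega> \<le> ereal (cmod (\<Omega> e))"
    using Sys_le[OF _ \<Omega>] nz unfolding \<Omega>e by blast
  moreover have "0 \<le> Sys TYPE('n) \<omega> \<Lambda> \<Omega>"
    unfolding Sys_def by (intro INF_greatest) simp
  ultimately have "Sys TYPE('n) \<omega> \<Lambda> \<Omega> * Sys TYPE('n) \<omega> \<Lambda> \<Omega> \<le> ereal (cmod (\<Omega> e)) * ereal (cmod (\<Omega> e))"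
    by (intro ereal_mult_mono) auto
  then show ?thesis by (simp add: power2_eq_square)
qed

section \<open>Almost geometric forms have positive phase degree\<close>

lemma primitive_forms_combination:
  assumes \<alpha>: "\<alpha> \<in> primitive_forms n \<omega>" and \<beta>: "\<beta> \<in> primitive_forms n \<omega>"
  shows "(\<lambda>v. p * \<alpha> v + q * \<beta> v) \<in> primitive_forms n \<omega>"
proof -
  have "alternating_form n (\<lambda>v. Complex (\<alpha> v) (\<beta> v))"
    using \<alpha> \<beta> by (intro alternating_form_complexI) (simp_all add: primitive_forms_def)
  moreover have "linear (\<lambda>z. p * Re z + q * Im z)"
    by (rule linearI) (simp_all add: algebra_simps)
  ultimately have "alternating_form n (\<lambda>v. p * \<alpha> v + q * \<beta> v)"
    using alternating_form_compose_linear[of n "\<lambda>v. Complex (\<alpha> v) (\<beta> v)"] by fastforce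
  moreover have "wedge n 2 (\<lambda>v. p * \<alpha> v + q * \<beta> v) (form_of_bilinear \<omega>) v =
      p * wedge n 2 \<alpha> (form_of_bilinear \<omega>) v + q * wedge n 2 \<beta> (form_of_bilinear \<omega>) v" for v
    by (simp add: wedge_def sum_distrib_left sum.distrib algebra_simps)
  ultimately show ?thesis using \<alpha> \<beta> by (simp add: primitive_forms_def)
qed

lemma matrix_act_U_forms:
  assumes \<Omega>: "\<Omega> \<in> U_forms n \<omega>" and A: "det A \<noteq> 0"
  shows "(\<lambda>v. matrix_act A (\<Omega> v)) \<in> U_forms n \<omega>"
proof -
  have "(\<lambda>v. Re (\<Omega> v)) \<in> primitive_forms n \<omega>" "(\<lambda>v. Im (\<Omega> v)) \<in> primitive_forms n \<omega>"
    using \<Omega> by (auto simp: U_forms_def complex_primitive_forms_def)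
  then have "(\<lambda>v. matrix_act A (\<Omega> v)) \<in> complex_primitive_forms n \<omega>"
    by (simp add: complex_primitive_forms_def matrix_act_def primitive_forms_combination)
  then show ?thesis using \<Omega> matrix_act_eq_0_iff[OF A] by (auto simp: U_forms_def)
qed

text \<open>
  Normalised Gram--Schmidt vectors of a reduced frame.
\<close>

lemma unitary_frame_exists:
  fixes \<omega> :: "'a::euclidean_space \<Rightarrow> 'a \<Rightarrow> real"
  assumes torus: "rational_symplectic_torus \<omega> \<Lambda>" and dim: "DIM('a) = 2 * n"
    and J: "compatible_complex_structure \<omega> J" and \<Omega>: "\<Omega> \<in> U_forms n \<omega>"
  obtains x where "unitary_frame \<omega> J n x" "\<Omega> x \<noteq> 0"
proof -
  have \<omega>: "symplectic_form \<omega>" using torus by (simp add: rational_symplectic_torus_def)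
  interpret compatible_structure \<omega> J by unfold_locales (rule \<omega> J)+
  obtain e where red: "reduced_frame \<Lambda> e n"
    using reduced_frame_exists[OF torus, of n] dim by auto
  then have iso: "isotropic \<omega> e n" and tri: "\<And>j. j < n \<Longrightarrow> e j \<notin> span (e ` {..<j})"
    by (simp_all add: reduced_frame_def primitive_frame_def)
  have "\<Omega> e \<noteq> 0"
    by (rule U_forms_nonzero_on_frame[OF \<Omega> isotropic_span_lagrangian[OF \<omega> dim tri iso]])
  then have "\<Omega> (\<lambda>j. (1 / sqrt (height e j)) *\<^sub>R gs e j) \<noteq> 0"
    using alternating_form_frame_value[OF U_forms_alternating[OF \<Omega>] tri] by auto
  with unitary_frame_of_gs[OF tri iso] show thesis by (rule that)
qed

text \<open>
  On the loop \<open>e\<^sup>i\<^sup>\<theta> x\<^sub>0, x\<^sub>1, \<dots>\<close> the complex linear part of \<open>A\<close> contributes \<open>a c e\<^sup>i\<^sup>\<theta>\<close> and the antilinear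
  part \<open>b c\<^sup>* e\<^sup>-\<^sup>i\<^sup>\<theta>\<close>, which is smaller because \<open>det A > 0\<close>.  The phase therefore has the lift
  \<open>Arg (a c) + \<theta> + Arg (1 + w)\<close>, where the last summand returns to its initial value.
\<close>

lemma U_ag_subset_U_plus:
  fixes \<omega> :: "'a::euclidean_space \<Rightarrow> 'a \<Rightarrow> real"
  assumes torus: "rational_symplectic_torus \<omega> \<Lambda>" and dim: "DIM('a) = 2 * n" and n: "n > 0"
  shows "U_ag n \<omega> \<subseteq> U_plus n \<omega>"
proof
  fix \<Psi> assume "\<Psi> \<in> U_ag n \<omega>"
  then obtain A \<Omega> where \<Psi>: "\<Psi> = (\<lambda>v. matrix_act A (\<Omega> v))" and A: "det A > 0"
    and geom: "\<Omega> \<in> U_geom n \<omega>"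
    unfolding U_ag_def by blast
  from geom have \<Omega>: "\<Omega> \<in> U_forms n \<omega>" by (simp add: U_geom_def)
  from geom obtain J where J: "compatible_complex_structure \<omega> J" and type: "type_n_0 n J \<Omega>"
    unfolding U_geom_def by blast
  have U: "\<Psi> \<in> U_forms n \<omega>" unfolding \<Psi> using A by (intro matrix_act_U_forms[OF \<Omega>]) simp
  obtain x where x: "unitary_frame \<omega> J n x" "\<Omega> x \<noteq> 0"
    by (rule unitary_frame_exists[OF torus dim J \<Omega>]) (rule that)
  let ?y = "\<lambda>i. J (x i)"
  have basis: "symplectic_basis n \<omega> x ?y"
    using unitary_frame_symplectic[OF J x(1)] by (simp add: symplectic_frame_def symplectic_basis_def)
  obtain a b where ab: "\<And>z. matrix_act A z = a * z + b * cnj z" "det A = (cmod a)\<^sup>2 - (cmod b)\<^sup>2"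
    by (rule matrix_act_conj_split[of A]) (rule that)
  have "(cmod b)\<^sup>2 < (cmod a)\<^sup>2" using A unfolding ab(2) by linarith
  then have ab_less: "cmod b < cmod a" by (rule power2_less_imp_less) (rule norm_ge_zero)
  then have a0: "a \<noteq> 0" by auto
  define c where "c = \<Omega> x"
  have c0: "c \<noteq> 0" using x(2) by (simp add: c_def)
  define w where "w \<theta> = (b * cnj c / (a * c)) * cis (- 2 * \<theta>)" for \<theta>
  have w_less: "cmod (w \<theta>) < 1" for \<theta>
  proof -
    have "cmod (w \<theta>) = cmod b * cmod c / (cmod a * cmod c)"
      by (simp only: w_def norm_mult norm_divide complex_mod_cnj norm_cis mult_1_right)
    then show ?thesis using ab_less a0 c0 by simp
  qed
  have w_Re: "Re (1 + w \<theta>) > 0" for \<theta>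
    using w_less[of \<theta>] abs_Re_le_cmod[of "w \<theta>"] by (simp only: plus_complex.sel one_complex.sel abs_le_iff) linarith
  then have w_slit: "1 + w \<theta> \<notin> \<real>\<^sub>\<le>\<^sub>0" for \<theta> by (auto simp: complex_nonpos_Reals_iff not_le)
  define f where "f \<theta> = Arg (a * c) + \<theta> + Arg (1 + w \<theta>)" for \<theta>
  have "continuous_on {0..pi} f"
  proof -
    have "continuous_on {0..pi} (\<lambda>\<theta>. 1 + w \<theta>)"
      unfolding w_def by (intro continuous_intros)
    then have "continuous_on {0..pi} (\<lambda>\<theta>. Arg (1 + w \<theta>))"
      using w_slit by (intro continuous_on_Arg') auto
    then show ?thesis
      unfolding f_def by (rule continuous_on_add[OF continuous_on_add[OF continuous_on_const continuous_on_id]])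
  qed
  moreover have "f pi = f 0 + pi"
  proof -
    have "cis (- 2 * pi) = cis (- 2 * 0)" by (simp add: complex_eq_iff)
    then have "w pi = w 0" by (simp only: w_def)
    then show ?thesis by (simp add: f_def)
  qed
  moreover have "has_phase n \<Psi> (generator_loop n x ?y \<theta>) (f \<theta>)" for \<theta>
  proof -
    define u where "u = x(0 := cos \<theta> *\<^sub>R x 0 + sin \<theta> *\<^sub>R J (x 0))"
    have "{..<n} = insert 0 {1..<n}" using n by auto
    then have "u ` {..<n} = insert (u 0) (u ` {1..<n})" by (metis image_insert)
    also have "u ` {1..<n} = x ` {1..<n}" by (auto simp: u_def)
    finally have loop: "generator_loop n x ?y \<theta> = span (u ` {..<n})"
      by (simp add: generator_loop_def u_def)
    have lin: "linear (\<lambda>v. \<Omega> (x(0 := v)))"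
      by (rule alternating_form_linear[OF U_forms_alternating[OF \<Omega>] n])
    have "\<Omega> u = of_real (cos \<theta>) * c + of_real (sin \<theta>) * (\<i> * c)"
      using type_n_0_D[OF type n, of x "x 0"]
      by (simp add: u_def linear_add[OF lin] linear_scale[OF lin] c_def scaleR_conv_of_real)
    also have "\<dots> = cis \<theta> * c" by (simp add: complex_eq_iff)
    finally have "\<Psi> u = a * c * cis \<theta> + b * cnj c * cis (- \<theta>)"
      by (simp add: \<Psi> ab(1) cis_cnj mult_ac)
    also have "cis (- \<theta>) = cis \<theta> * cis (- 2 * \<theta>)" by (simp add: cis_mult)
    also have "a * c * cis \<theta> + b * cnj c * (cis \<theta> * cis (- 2 * \<theta>)) = a * c * cis \<theta> * (1 + w \<theta>)"
      using a0 c0 by (simp add: w_def field_simps)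
    finally have \<Psi>u: "\<Psi> u = a * c * cis \<theta> * (1 + w \<theta>)" .
    have polar: "z = of_real (cmod z) * cis (Arg z)" for z
      using rcis_cmod_Arg[of z] by (simp add: rcis_def)
    have "\<Psi> u = (of_real (cmod (a * c)) * cis (Arg (a * c))) * cis \<theta> * (of_real (cmod (1 + w \<theta>)) * cis (Arg (1 + w \<theta>)))"
      unfolding \<Psi>u by (simp only: polar[of "a * c", symmetric] polar[of "1 + w \<theta>", symmetric])
    also have "\<dots> = of_real (cmod (a * c) * cmod (1 + w \<theta>)) * cis (f \<theta>)"
      by (simp add: f_def flip: cis_mult)
    finally have "\<Psi> u = of_real (cmod (a * c) * cmod (1 + w \<theta>)) * cis (f \<theta>)" .
    moreover have "\<Psi> u \<noteq> 0"
    proof -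
      have "1 + w \<theta> \<noteq> 0" using w_Re[of \<theta>] by (metis less_irrefl zero_complex.sel(1))
      then show ?thesis unfolding \<Psi>u using a0 c0 by simp
    qed
    ultimately show ?thesis
      unfolding loop by (intro has_phase_span[OF U_forms_alternating[OF U]])
  qed
  ultimately have "symplectic_basis n \<omega> x ?y \<and> continuous_on {0..pi} f \<and>
      (\<forall>\<theta>\<in>{0..pi}. has_phase n \<Psi> (generator_loop n x ?y \<theta>) (f \<theta>)) \<and> f pi = f 0 + pi"
    using basis by simp
  then have "\<exists>x y f. symplectic_basis n \<omega> x y \<and> continuous_on {0..pi} f \<and>
      (\<forall>\<theta>\<in>{0..pi}. has_phase n \<Psi> (generator_loop n x y \<theta>) (f \<theta>)) \<and> f pi = f 0 + pi"
    by (intro exI)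
  then show "\<Psi> \<in> U_plus n \<omega>" unfolding U_plus_def using U by simp
qed

section \<open>Dimension four\<close>

text \<open>
  The \<open>24\<close> permutations are enumerated; they coincide in groups of four.
\<close>

lemma wedge_2_2:
  fixes \<alpha> \<beta> :: "(nat \<Rightarrow> 'a::real_vector) \<Rightarrow> real"
  assumes \<alpha>: "alternating_form 2 \<alpha>" and \<omega>: "\<And>v w. \<omega> v w = - \<omega> w v"
  defines "a \<equiv> \<lambda>v w. \<alpha> (\<lambda>i. if i = 0 then v else w)"
  shows "wedge 2 2 \<alpha> (form_of_bilinear \<omega>) v =
    a (v 0) (v 1) * \<omega> (v 2) (v 3) - a (v 0) (v 2) * \<omega> (v 1) (v 3) + a (v 0) (v 3) * \<omega> (v 1) (v 2) +
    a (v 1) (v 2) * \<omega> (v 0) (v 3) - a (v 1) (v 3) * \<omega> (v 0) (v 2) + a (v 2) (v 3) * \<omega> (v 0) (v 1)"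
proof -
  have a_flip: "a x y = - a y x" for x y
  proof -
    have "\<alpha> ((\<lambda>i. if i = 0 then x else y) \<circ> Transposition.transpose 0 1) = - a x y"
      unfolding a_def by (rule alternating_form_transpose[OF \<alpha>]) auto
    moreover have "\<alpha> ((\<lambda>i. if i = 0 then x else y) \<circ> Transposition.transpose 0 1) = a y x"
      unfolding a_def by (rule alternating_form_cong[OF \<alpha>]) (auto simp: Transposition.transpose_def)
    ultimately show ?thesis by simp
  qed
  have \<alpha>a: "\<alpha> u = a (u 0) (u 1)" for u
    unfolding a_def by (rule alternating_form_cong[OF \<alpha>]) (auto simp: less_2_cases_iff)
  let ?t = "\<lambda>\<sigma>. of_int (sign \<sigma>) * a (v (\<sigma> 0)) (v (\<sigma> 1)) * \<omega> (v (\<sigma> 2)) (v (\<sigma> 3))"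
  have w: "wedge 2 2 \<alpha> (form_of_bilinear \<omega>) v = (1 / 4) * (\<Sum>\<sigma> | \<sigma> permutes {..<4}. ?t \<sigma>)"
    by (simp add: wedge_def form_of_bilinear_def \<alpha>a eval_nat_numeral)
  have set4: "{..<4::nat} = insert 3 (insert 2 (insert 1 {0}))" by auto
  have sg: "sign (Transposition.transpose p q \<circ> s) = (if p = q then 1 else -1) * sign s" if "permutation s" for p q s
    using that by (simp add: sign_compose permutation_swap_id sign_swap_id)
  show ?thesis
    unfolding w set4
    apply (subst sum_over_permutations_insert, simp, simp)
    apply (subst sum_over_permutations_insert, simp, simp)
    apply (subst sum_over_permutations_insert, simp, simp)
    apply (simp add: permutes_sing sg permutation_compose permutation_swap_id permutation_id sign_swap_id
        Transposition.transpose_def cong: if_cong)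
    using a_flip[of "v 1" "v 0"] a_flip[of "v 2" "v 0"] a_flip[of "v 3" "v 0"] a_flip[of "v 2" "v 1"]
      a_flip[of "v 3" "v 1"] a_flip[of "v 3" "v 2"]
      \<omega>[of "v 1" "v 0"] \<omega>[of "v 2" "v 0"] \<omega>[of "v 3" "v 0"] \<omega>[of "v 2" "v 1"] \<omega>[of "v 3" "v 1"] \<omega>[of "v 3" "v 2"]
    by (simp add: algebra_simps)
qed


definition pair :: "'a \<Rightarrow> 'a \<Rightarrow> nat \<Rightarrow> 'a" where
  "pair v w i = (if i = 0 then v else w)"

lemma two_form_pair:
  assumes "alternating_form 2 \<alpha>"
  shows "\<alpha> u = \<alpha> (pair (u 0) (u 1))"
  by (rule alternating_form_cong[OF assms]) (auto simp: pair_def less_2_cases_iff)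

lemma two_form_bilinear:
  assumes \<alpha>: "alternating_form 2 \<alpha>"
  shows two_form_linear1: "linear (\<lambda>v. \<alpha> (pair v w))" and two_form_linear2: "linear (\<lambda>w. \<alpha> (pair v w))"
    and two_form_self: "\<alpha> (pair v v) = 0"
    and two_form_flip: "\<alpha> (pair v w) = - \<alpha> (pair w v)"
proof -
  have "(pair v w)(0 := x) = pair x w" for x v w :: 'a by (auto simp: pair_def)
  then show "linear (\<lambda>v. \<alpha> (pair v w))"
    using alternating_form_linear[OF \<alpha>, of 0 "pair 0 w"] by simp
  have "\<alpha> ((pair v 0)(1 := x)) = \<alpha> (pair v x)" for x
    by (rule alternating_form_cong[OF \<alpha>]) (auto simp: pair_def less_2_cases_iff)
  then show "linear (\<lambda>w. \<alpha> (pair v w))"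
    using alternating_form_linear[OF \<alpha>, of 1 "pair v 0"] by simp
  show "\<alpha> (pair v v) = 0"
    by (rule alternating_form_repeat[OF \<alpha>, of 0 1]) (auto simp: pair_def)
  have "\<alpha> (pair v w \<circ> Transposition.transpose 0 1) = - \<alpha> (pair v w)"
    by (rule alternating_form_transpose[OF \<alpha>]) auto
  moreover have "\<alpha> (pair v w \<circ> Transposition.transpose 0 1) = \<alpha> (pair w v)"
    by (rule alternating_form_cong[OF \<alpha>]) (auto simp: pair_def less_2_cases_iff Transposition.transpose_def)
  ultimately show "\<alpha> (pair v w) = - \<alpha> (pair w v)" by (metis minus_minus)
qed

text \<open>
  The operator that represents a two-form with respect to \<open>\<omega>\<close>.
\<close>

lemma form_operator_exists:
  fixes \<omega> :: "'a::euclidean_space \<Rightarrow> 'a \<Rightarrow> real"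
  assumes \<omega>: "symplectic_form \<omega>" and \<alpha>: "alternating_form 2 \<alpha>"
  obtains T where "linear T" "\<And>v w. \<omega> (T v) w = \<alpha> (pair v w)"
proof -
  have "\<exists>d. \<forall>w. \<omega> d w = \<alpha> (pair v w)" for v
  proof -
    have "linear (\<lambda>w. - \<alpha> (pair v w))" using linear_compose_neg[OF two_form_linear2[OF \<alpha>, of v]] .
    then obtain d where "\<And>w. \<omega> w d = - \<alpha> (pair v w)"
      by (rule symplectic_dual_vector[OF \<omega>]) blast
    then have "\<omega> d w = \<alpha> (pair v w)" for w using symplectic_flip[OF \<omega>, of d w] by simp
    then show ?thesis by blast
  qed
  then obtain T where T: "\<And>v w. \<omega> (T v) w = \<alpha> (pair v w)" by metis
  note lin = symplectic_linear(2)[OF \<omega>] and lin\<alpha> = two_form_linear1[OF \<alpha>]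
  have eq: "v = v'" if "\<And>w. \<omega> v w = \<omega> v' w" for v v'
    using symplectic_nondegenerate[OF \<omega>, of "v - v'"] that by (simp add: linear_diff[OF lin])
  have "linear T"
  proof (rule linearI)
    show "T (x + y) = T x + T y" for x y
      by (rule eq) (simp add: T linear_add[OF lin] linear_add[OF lin\<alpha>])
    show "T (r *\<^sub>R x) = r *\<^sub>R T x" for r x
      by (rule eq) (simp add: T linear_scale[OF lin] linear_scale[OF lin\<alpha>])
  qed
  then show thesis using T by (rule that)
qed

lemma symplectic_basis_spans:
  fixes \<omega> :: "'a::euclidean_space \<Rightarrow> 'a \<Rightarrow> real"
  assumes \<omega>: "symplectic_form \<omega>" and dim: "DIM('a) = 2 * n" and xy: "symplectic_basis n \<omega> x y"
  shows "span (x ` {..<n} \<union> y ` {..<n}) = UNIV"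
proof -
  define w where "w i = (if i < n then x i else y (i - n))" for i
  have "inj_on w {..<2 * n} \<and> independent (w ` {..<2 * n})"
  proof (rule triangular_independent)
    fix j assume j: "j < 2 * n"
    show "w j \<notin> span (w ` {..<j})"
    proof (cases "j < n")
      case True
      have 0: "\<omega> v (y j) = 0" if "v \<in> w ` {..<j}" for v
        using that True xy by (auto simp: w_def symplectic_basis_def)
      have "\<omega> (w j) (y j) = 1" using True xy by (auto simp: w_def symplectic_basis_def)
      then show ?thesis
        using linear_eq_0_on_span[OF symplectic_linear(2)[OF \<omega>] 0] by (metis zero_neq_one)
    next
      case False
      have 0: "\<omega> (x (j - n)) v = 0" if "v \<in> w ` {..<j}" for v
        using that False j xy by (auto simp: w_def symplectic_basis_def)
      have "\<omega> (x (j - n)) (w j) = 1" using False j xy by (auto simp: w_def symplectic_basis_def)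
      then show ?thesis
        using linear_eq_0_on_span[OF symplectic_linear(1)[OF \<omega>] 0] by (metis zero_neq_one)
    qed
  qed
  then have "card (w ` {..<2 * n}) = DIM('a)" "independent (w ` {..<2 * n})"
    using dim by (simp_all add: card_image)
  then have "span (w ` {..<2 * n}) = UNIV" by (metis dim_eq_card_independent dim_eq_full)
  moreover have "w ` {..<2 * n} \<subseteq> x ` {..<n} \<union> y ` {..<n}"
    by (auto simp: w_def)
  ultimately show ?thesis using span_mono by blast
qed

text \<open>
  Primitivity of the two-form means that its operator, which is self-adjoint for \<open>\<omega>\<close>, has trace
  zero.  The square is then scalar: the characteristic polynomial of such an operator is the square of
  \<open>t\<^sup>2 - p\<close>.  The proof computes the matrix in the symplectic basis.
\<close>

lemma primitive_operator_square:
  fixes \<omega> :: "'a::euclidean_space \<Rightarrow> 'a \<Rightarrow> real"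
  assumes \<omega>: "symplectic_form \<omega>" and dim: "DIM('a) = 4" and xy: "symplectic_basis 2 \<omega> x y"
    and T: "linear T" "\<And>v. \<omega> (T v) v = 0"
    and trace: "\<omega> (T (x 0)) (y 0) + \<omega> (T (x 1)) (y 1) = 0"
  obtains p where "\<And>v. T (T v) = p *\<^sub>R v"
proof -
  note lin1 = symplectic_linear(1)[OF \<omega>] and lin2 = symplectic_linear(2)[OF \<omega>]
  note om = linear_add[OF lin1] linear_add[OF lin2] linear_diff[OF lin1] linear_diff[OF lin2]
    linear_scale[OF lin1] linear_scale[OF lin2]
  have flip: "\<omega> v w = - \<omega> w v" for v w by (rule symplectic_flip[OF \<omega>])
  \<comment> \<open>Polarisation of the second property of \<open>T\<close>.\<close>
  have Tflip: "\<omega> (T v) w = - \<omega> (T w) v" for v w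
  proof -
    have "\<omega> (T (v + w)) (v + w) = \<omega> (T v) v + \<omega> (T v) w + (\<omega> (T w) v + \<omega> (T w) w)"
      by (simp add: linear_add[OF T(1)] om)
    then show ?thesis using T(2)[of "v + w"] T(2)[of v] T(2)[of w] by simp
  qed
  define x0 x1 y0 y1 where "x0 = x 0" and "x1 = x 1" and "y0 = y 0" and "y1 = y 1"
  note xy_def = x0_def x1_def y0_def y1_def
  have b: "\<omega> x0 x0 = 0" "\<omega> x0 x1 = 0" "\<omega> x1 x0 = 0" "\<omega> x1 x1 = 0"
    "\<omega> y0 y0 = 0" "\<omega> y0 y1 = 0" "\<omega> y1 y0 = 0" "\<omega> y1 y1 = 0"
    "\<omega> x0 y0 = 1" "\<omega> x0 y1 = 0" "\<omega> x1 y0 = 0" "\<omega> x1 y1 = 1"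
    using xy by (auto simp: symplectic_basis_def xy_def)
  have b': "\<omega> y0 x0 = -1" "\<omega> y1 x0 = 0" "\<omega> y0 x1 = 0" "\<omega> y1 x1 = -1"
    using b flip[of y0 x0] flip[of y1 x0] flip[of y0 x1] flip[of y1 x1] by auto
  have span: "span {x0, x1, y0, y1} = UNIV"
  proof -
    have "{..<2} = {0, 1::nat}" by auto
    then have "x ` {..<2} \<union> y ` {..<2} = {x0, x1, y0, y1}" by (auto simp: xy_def)
    then show ?thesis using symplectic_basis_spans[OF \<omega> _ xy] dim by simp
  qed
  have expand: "z = \<omega> z y0 *\<^sub>R x0 + \<omega> z y1 *\<^sub>R x1 + \<omega> x0 z *\<^sub>R y0 + \<omega> x1 z *\<^sub>R y1" for z
  proof -
    let ?d = "z - (\<omega> z y0 *\<^sub>R x0 + \<omega> z y1 *\<^sub>R x1 + \<omega> x0 z *\<^sub>R y0 + \<omega> x1 z *\<^sub>R y1)"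
    have "\<omega> ?d x0 = 0" using flip[of z x0] by (simp only: om b b') simp
    moreover have "\<omega> ?d x1 = 0" using flip[of z x1] by (simp only: om b b') simp
    moreover have "\<omega> ?d y0 = 0" by (simp only: om b b') simp
    moreover have "\<omega> ?d y1 = 0" by (simp only: om b b') simp
    ultimately have on_basis: "\<omega> ?d u = 0" if "u \<in> {x0, x1, y0, y1}" for u
      using that by blast
    have "\<omega> ?d w = 0" for w
    proof -
      have w: "w \<in> span {x0, x1, y0, y1}" by (simp add: span)
      show ?thesis by (rule linear_eq_0_on_span[OF lin1 on_basis w])
    qed
    then have "?d = 0" by (rule symplectic_nondegenerate[OF \<omega>])
    then show ?thesis by simp
  qed
  define s p1 p2 p3 p4 where "s = \<omega> (T x0) y0" and "p1 = \<omega> (T x0) x1" and "p2 = \<omega> (T y0) y1"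
    and "p3 = \<omega> (T x0) y1" and "p4 = \<omega> (T x1) y0"
  have s': "\<omega> (T x1) y1 = - s" using trace by (simp add: s_def xy_def)
  have c: "\<omega> x0 (T x0) = 0" "\<omega> x1 (T x0) = - p1" "\<omega> x0 (T x1) = p1" "\<omega> x1 (T x1) = 0"
    "\<omega> (T y0) y0 = 0" "\<omega> x0 (T y0) = s" "\<omega> x1 (T y0) = p4"
    "\<omega> (T y1) y0 = - p2" "\<omega> (T y1) y1 = 0" "\<omega> x0 (T y1) = p3" "\<omega> x1 (T y1) = - s"
    using flip[of x0 "T x0"] flip[of x1 "T x0"] flip[of x0 "T x1"] flip[of x1 "T x1"]
      flip[of x0 "T y0"] flip[of x1 "T y0"] flip[of x0 "T y1"] flip[of x1 "T y1"]
      T(2)[of x0] T(2)[of x1] T(2)[of y0] T(2)[of y1]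
      Tflip[of x1 x0] Tflip[of y0 x0] Tflip[of y0 x1] Tflip[of y1 y0] Tflip[of y1 x0] Tflip[of y1 x1] s'
    by (simp_all add: s_def p1_def p2_def p3_def p4_def)
  have Tx0: "T x0 = s *\<^sub>R x0 + p3 *\<^sub>R x1 - p1 *\<^sub>R y1"
    by (rule trans[OF expand[of "T x0"]]) (simp add: c flip: s_def p3_def)
  have Tx1: "T x1 = p4 *\<^sub>R x0 - s *\<^sub>R x1 + p1 *\<^sub>R y0"
    by (rule trans[OF expand[of "T x1"]]) (simp add: c s' flip: p4_def)
  have Ty0: "T y0 = p2 *\<^sub>R x1 + s *\<^sub>R y0 + p4 *\<^sub>R y1"
    by (rule trans[OF expand[of "T y0"]]) (simp add: c flip: p2_def)
  have Ty1: "T y1 = - p2 *\<^sub>R x0 + p3 *\<^sub>R y0 - s *\<^sub>R y1"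
    by (rule trans[OF expand[of "T y1"]]) (simp add: c)
  define p where "p = s * s + p3 * p4 + p1 * p2"
  note Tlin = linear_add[OF T(1)] linear_diff[OF T(1)] linear_scale[OF T(1)] linear_neg[OF T(1)]
  let ?D = "\<lambda>v. T (T v) - p *\<^sub>R v"
  have "linear ?D"
    by (rule linearI) (simp_all add: Tlin algebra_simps)
  moreover have "?D v = 0" if "v \<in> {x0, x1, y0, y1}" for v
  proof -
    have "T (T x0) = p *\<^sub>R x0" unfolding Tx0 Tlin unfolding Tx0 Tx1 Ty0 Ty1 p_def
      by (simp add: algebra_simps)
    moreover have "T (T x1) = p *\<^sub>R x1" unfolding Tx1 Tlin unfolding Tx0 Tx1 Ty0 Ty1 p_def
      by (simp add: algebra_simps)
    moreover have "T (T y0) = p *\<^sub>R y0" unfolding Ty0 Tlin unfolding Tx0 Tx1 Ty0 Ty1 p_def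
      by (simp add: algebra_simps)
    moreover have "T (T y1) = p *\<^sub>R y1" unfolding Ty1 Tlin unfolding Tx0 Tx1 Ty0 Ty1 p_def
      by (simp add: algebra_simps)
    ultimately show ?thesis using that by auto
  qed
  ultimately have "?D v = 0" for v
    using linear_eq_0_on_span[of ?D "{x0, x1, y0, y1}" v] span by auto
  then show thesis by (intro that[of p]) simp
qed


text \<open>
  Let \<open>S\<close> and \<open>T\<close> be the operators of the real and imaginary part \<open>\<alpha>\<close> and \<open>\<beta>\<close>.  Their squares and that of
  \<open>S + T\<close> are scalar, so \<open>S T + T S = 2 B\<close>, and \<open>C = S T - B\<close>, which is half of the commutator, has a
  scalar square \<open>- \<delta>\<close>.  That \<open>\<alpha>\<close> and \<open>\<beta>\<close> have no common zero on Lagrangians makes the quadratic form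
  \<open>\<omega> v (C v) = \<omega> (S v) (T v)\<close> non-zero for \<open>v \<noteq> 0\<close>, hence definite, and \<open>\<delta>\<close> positive.  So a multiple \<open>J\<close> of
  \<open>C\<close> is a compatible complex structure.  The form with real part \<open>\<alpha>\<close> and type \<open>(2, 0)\<close> has imaginary
  part given by the operator \<open>- S J\<close>, which is a combination of \<open>S\<close> and \<open>T\<close>.
\<close>

lemma U_forms_dim4_geometric:
  fixes \<omega> :: "'a::euclidean_space \<Rightarrow> 'a \<Rightarrow> real"
  assumes \<omega>: "symplectic_form \<omega>" and dim: "DIM('a) = 4" and xy: "symplectic_basis 2 \<omega> x y"
    and \<Omega>: "\<Omega> \<in> U_forms 2 \<omega>"
  shows "\<exists>A \<Omega>'. det A \<noteq> 0 \<and> \<Omega>' \<in> U_geom 2 \<omega> \<and> \<Omega> = (\<lambda>v. matrix_act A (\<Omega>' v))"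
proof -
  note lin1 = symplectic_linear(1)[OF \<omega>] and lin2 = symplectic_linear(2)[OF \<omega>]
  note om = linear_add[OF lin1] linear_add[OF lin2] linear_diff[OF lin1] linear_diff[OF lin2]
    linear_scale[OF lin1] linear_scale[OF lin2]
  have flip: "\<omega> v w = - \<omega> w v" for v w by (rule symplectic_flip[OF \<omega>])
  have self: "\<omega> v v = 0" for v by (rule symplectic_self[OF \<omega>])
  define \<alpha> \<beta> where "\<alpha> v = Re (\<Omega> v)" and "\<beta> v = Im (\<Omega> v)" for v
  have prim: "\<alpha> \<in> primitive_forms 2 \<omega>" "\<beta> \<in> primitive_forms 2 \<omega>"
    using \<Omega> by (auto simp: U_forms_def complex_primitive_forms_def \<alpha>_def[abs_def] \<beta>_def[abs_def])
  have alt: "alternating_form 2 \<alpha>" "alternating_form 2 \<beta>"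
    using prim by (auto simp: primitive_forms_def)
  obtain S where S: "linear S" "\<And>v w. \<omega> (S v) w = \<alpha> (pair v w)"
    by (rule form_operator_exists[OF \<omega> alt(1)]) (rule that)
  obtain T where T: "linear T" "\<And>v w. \<omega> (T v) w = \<beta> (pair v w)"
    by (rule form_operator_exists[OF \<omega> alt(2)]) (rule that)
  have adj: "\<omega> (S v) w = \<omega> v (S w)" "\<omega> (T v) w = \<omega> v (T w)" for v w
    using two_form_flip[OF alt(1), of v w] two_form_flip[OF alt(2), of v w]
      flip[of v "S w"] flip[of v "T w"] by (simp_all add: S(2) T(2))
  have S0: "\<omega> (S v) v = 0" and T0: "\<omega> (T v) v = 0" for v
    by (simp_all add: S(2) T(2) two_form_self[OF alt(1)] two_form_self[OF alt(2)])
  have trace: "\<gamma> (pair (x 0) (y 0)) + \<gamma> (pair (x 1) (y 1)) = 0" if \<gamma>: "\<gamma> \<in> primitive_forms 2 \<omega>" for \<gamma>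
  proof -
    have alt: "alternating_form 2 \<gamma>" using \<gamma> by (simp add: primitive_forms_def)
    define u :: "nat \<Rightarrow> 'a" where "u i = (if i = 0 then x 0 else if i = 1 then y 0 else if i = 2 then x 1 else y 1)" for i
    have u: "u 0 = x 0" "u 1 = y 0" "u 2 = x 1" "u 3 = y 1" by (simp_all add: u_def)
    have "wedge 2 2 \<gamma> (form_of_bilinear \<omega>) u = 0" using \<gamma> by (simp add: primitive_forms_def)
    then have "\<gamma> (pair (x 0) (y 0)) * \<omega> (x 1) (y 1) - \<gamma> (pair (x 0) (x 1)) * \<omega> (y 0) (y 1) +
        \<gamma> (pair (x 0) (y 1)) * \<omega> (y 0) (x 1) + \<gamma> (pair (y 0) (x 1)) * \<omega> (x 0) (y 1) -
        \<gamma> (pair (y 0) (y 1)) * \<omega> (x 0) (x 1) + \<gamma> (pair (x 1) (y 1)) * \<omega> (x 0) (y 0) = 0"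
      by (simp only: wedge_2_2[OF alt flip] u pair_def[abs_def])
    moreover have "\<omega> (x 1) (y 1) = 1" "\<omega> (y 0) (y 1) = 0" "\<omega> (y 0) (x 1) = 0" "\<omega> (x 0) (y 1) = 0"
      "\<omega> (x 0) (x 1) = 0" "\<omega> (x 0) (y 0) = 1"
      using xy flip[of "y 0" "x 1"] by (auto simp: symplectic_basis_def)
    ultimately show ?thesis by simp
  qed
  have trST: "\<omega> (S (x 0)) (y 0) + \<omega> (S (x 1)) (y 1) = 0" "\<omega> (T (x 0)) (y 0) + \<omega> (T (x 1)) (y 1) = 0"
    unfolding S(2) T(2) by (rule trace[OF prim(1)], rule trace[OF prim(2)])
  obtain p where p: "\<And>v. S (S v) = p *\<^sub>R v"
    by (rule primitive_operator_square[OF \<omega> dim xy S(1) S0 trST(1)]) (rule that)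
  obtain r where r: "\<And>v. T (T v) = r *\<^sub>R v"
    by (rule primitive_operator_square[OF \<omega> dim xy T(1) T0 trST(2)]) (rule that)
  have lin_sum: "linear (\<lambda>v. S v + T v)" by (rule linear_compose_add[OF S(1) T(1)])
  have sum0: "\<omega> (S v + T v) v = 0" for v by (simp add: om S0 T0)
  have sum_trace: "\<omega> (S (x 0) + T (x 0)) (y 0) + \<omega> (S (x 1) + T (x 1)) (y 1) = 0"
    using trST by (simp add: om)
  obtain q where q: "\<And>v. S (S v + T v) + T (S v + T v) = q *\<^sub>R v"
    by (rule primitive_operator_square[OF \<omega> dim xy lin_sum sum0 sum_trace]) (rule that)
  define B where "B = (q - p - r) / 2"
  have anti: "T (S v) = (2 * B) *\<^sub>R v - S (T v)" for v
  proof -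
    have "p *\<^sub>R v + S (T v) + (T (S v) + r *\<^sub>R v) = q *\<^sub>R v"
      using q[of v] by (simp add: linear_add[OF S(1)] linear_add[OF T(1)] p r)
    then have "T (S v) = q *\<^sub>R v - p *\<^sub>R v - r *\<^sub>R v - S (T v)" by (simp add: algebra_simps)
    also have "q *\<^sub>R v - p *\<^sub>R v - r *\<^sub>R v = (2 * B) *\<^sub>R v"
      by (simp add: B_def flip: scaleR_diff_left)
    finally show ?thesis .
  qed
  note Sl = linear_add[OF S(1)] linear_diff[OF S(1)] linear_scale[OF S(1)]
    and Tl = linear_add[OF T(1)] linear_diff[OF T(1)] linear_scale[OF T(1)]
  define C where "C v = S (T v) - B *\<^sub>R v" for v
  have linC: "linear C" by (rule linearI) (simp_all add: C_def Sl Tl algebra_simps)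
  define \<delta> where "\<delta> = p * r - B * B"
  have CC: "C (C v) = - \<delta> *\<^sub>R v" for v
  proof -
    have "T (S (T v)) = (2 * B) *\<^sub>R T v - r *\<^sub>R S v"
      using anti[of "T v"] by (simp add: r Sl)
    then have e1: "S (T (S (T v))) = (2 * B) *\<^sub>R S (T v) - (r * p) *\<^sub>R v"
      by (simp add: Sl p)
    have e2: "C (C v) = S (T (S (T v))) - (B *\<^sub>R S (T v) + B *\<^sub>R S (T v)) + (B * B) *\<^sub>R v"
      by (simp add: C_def Sl Tl algebra_simps)
    have e3: "B *\<^sub>R S (T v) + B *\<^sub>R S (T v) = (2 * B) *\<^sub>R S (T v)" by (simp flip: scaleR_add_left)
    show ?thesis unfolding e2 e3 e1 by (simp add: \<delta>_def algebra_simps)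
  qed
  have C_adj: "\<omega> v (C w) = - \<omega> (C v) w" for v w
  proof -
    have "\<omega> v (S (T w)) = \<omega> (T (S v)) w" by (simp add: adj)
    then show ?thesis by (simp add: C_def anti om)
  qed
  have qC: "\<omega> v (C v) = \<omega> (S v) (T v)" for v
    by (simp add: C_def om self adj(1))
  have nonzero: "\<alpha> (pair v w) \<noteq> 0 \<or> \<beta> (pair v w) \<noteq> 0" if "v \<noteq> 0" "w \<notin> span {v}" "\<omega> v w = 0" for v w
  proof -
    have "lagrangian_subspace \<omega> (span (pair v w ` {..<2}))"
    proof (rule isotropic_span_lagrangian[OF \<omega>])
      show "DIM('a) = 2 * 2" using dim by simp
      show "isotropic \<omega> (pair v w) 2"
        using that(3) flip[of w v] by (auto simp: isotropic_def pair_def less_2_cases_iff self)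
      show "pair v w j \<notin> span (pair v w ` {..<j})" if "j < 2" for j
        using \<open>v \<noteq> 0\<close> \<open>w \<notin> span {v}\<close> that by (auto simp: pair_def less_2_cases_iff lessThan_Suc)
    qed
    then have "\<Omega> (pair v w) \<noteq> 0" by (rule U_forms_nonzero_on_frame[OF \<Omega>])
    then show ?thesis by (simp add: \<alpha>_def \<beta>_def complex_eq_iff)
  qed
  \<comment> \<open>If the product were zero, \<open>v\<close>, \<open>S v\<close> and \<open>T v\<close> would be pairwise \<open>\<omega>\<close>-orthogonal.  Then \<open>v\<close> and one of
    the others, or any \<open>w\<close> orthogonal to \<open>v\<close> if all are proportional, span a Lagrangian on
    which \<open>\<alpha>\<close> and \<open>\<beta>\<close> vanish.\<close>
  have q_nz: "\<omega> (S v) (T v) \<noteq> 0" if v: "v \<noteq> 0" for v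
  proof
    assume 0: "\<omega> (S v) (T v) = 0"
    show False
    proof (cases "S v \<in> span {v} \<and> T v \<in> span {v}")
      case False
      then consider "S v \<notin> span {v}" | "T v \<notin> span {v}" by blast
      then show False
      proof cases
        case 1
        then show False
          using nonzero[OF v 1] S0[of v] flip[of v "S v"] self[of "S v"] 0 flip[of "T v" "S v"]
          by (simp flip: S(2) T(2))
      next
        case 2
        then show False
          using nonzero[OF v 2] T0[of v] flip[of v "T v"] self[of "T v"] 0
          by (simp flip: S(2) T(2))
      qed
    next
      case True
      then obtain s t where st: "S v = s *\<^sub>R v" "T v = t *\<^sub>R v" by (auto simp: span_singleton)
      obtain z where z: "\<omega> v z \<noteq> 0" using v symplectic_nondegenerate[OF \<omega>] by blast
      have "\<exists>w. w \<notin> span {v} \<and> \<omega> v w = 0"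
      proof (rule ccontr)
        assume neg: "\<not> ?thesis"
        have "u \<in> span {v, z}" for u
        proof -
          let ?u = "u - (\<omega> v u / \<omega> v z) *\<^sub>R z"
          have "\<omega> v ?u = 0" using z by (simp add: om)
          then have "?u \<in> span {v}" using neg by blast
          then have "?u \<in> span {v, z}" using span_mono[of "{v}" "{v, z}"] by blast
          moreover have "(\<omega> v u / \<omega> v z) *\<^sub>R z \<in> span {v, z}" by (intro span_scale span_base) simp
          ultimately have "?u + (\<omega> v u / \<omega> v z) *\<^sub>R z \<in> span {v, z}" by (rule span_add)
          then show ?thesis by simp
        qed
        then have "span {v, z} = UNIV" by blast
        then have "dim (UNIV :: 'a set) \<le> card {v, z}" by (metis dim_le_card dim_span finite.emptyI finite_insert order_refl)
        also have "\<dots> \<le> 2" by (simp add: card_insert_if)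
        finally show False using dim by simp
      qed
      then obtain w where w: "w \<notin> span {v}" "\<omega> v w = 0" by blast
      then show False using nonzero[OF v w] st by (simp add: om flip: S(2) T(2))
    qed
  qed
  obtain v0 :: 'a where v0: "v0 \<noteq> 0"
    using nonempty_Basis nonzero_Basis by (metis ex_in_conv)
  have "\<delta> > 0"
  proof (rule ccontr)
    assume "\<not> \<delta> > 0"
    define k where "k = sqrt (- \<delta>)"
    have kk: "k * k = - \<delta>" using \<open>\<not> \<delta> > 0\<close> by (simp add: k_def)
    have no_eigen: False if "u \<noteq> 0" "C u = m *\<^sub>R u" for u m
      using q_nz[OF that(1)] that(2) by (simp add: om self flip: qC)
    \<comment> \<open>If \<open>C\<^sup>2 = k\<^sup>2\<close>, then \<open>C\<close> has an eigenvector, \<open>v0\<close> or \<open>u\<close>, on which the quadratic form vanishes.\<close>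
    define u where "u = C v0 - k *\<^sub>R v0"
    have "C u = - k *\<^sub>R u"
    proof -
      have "C u = (k * k) *\<^sub>R v0 - k *\<^sub>R C v0"
        by (simp add: u_def linear_diff[OF linC] linear_scale[OF linC] CC kk)
      then show ?thesis by (simp add: u_def algebra_simps)
    qed
    show False
    proof (cases "u = 0")
      case True
      then show False using no_eigen[OF v0, of k] by (simp add: u_def)
    next
      case False
      then show False using no_eigen \<open>C u = - k *\<^sub>R u\<close> by blast
    qed
  qed
  have bil: "bilinear \<omega>" using \<omega> by (simp add: symplectic_form_def)
  have contC: "continuous_on A C" for A
    using linC by (intro linear_continuous_on) (simp add: linear_conv_bounded_linear)
  have cont: "continuous_on A (\<lambda>v. \<omega> v (C v))" for A
    by (rule bilinear_continuous_on_compose[OF continuous_on_id contC bil])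
  \<comment> \<open>The complement of the origin is connected, so the quadratic form has a constant sign \<open>\<epsilon>\<close>.\<close>
  obtain \<epsilon> :: real where \<epsilon>: "\<epsilon> * \<epsilon> = 1" "\<And>v. v \<noteq> 0 \<Longrightarrow> \<epsilon> * \<omega> v (C v) > 0"
  proof -
    have "connected ((\<lambda>v. \<omega> v (C v)) ` (- {0}))"
      using dim by (intro connected_continuous_image cont connected_punctured_universe) simp
    then have conn: "is_interval ((\<lambda>v. \<omega> v (C v)) ` (- {0}))" by (simp add: is_interval_connected_1)
    have nz: "\<omega> v (C v) \<noteq> 0" if "v \<noteq> 0" for v using q_nz[OF that] by (simp add: qC)
    have no: False if "v \<noteq> 0" "w \<noteq> 0" "\<omega> v (C v) < 0" "\<omega> w (C w) > 0" for v w
    proof -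
      have "0 \<in> (\<lambda>v. \<omega> v (C v)) ` (- {0})"
        by (rule mem_is_interval_1_I[OF conn, of "\<omega> v (C v)" "\<omega> w (C w)"]) (use that in auto)
      then obtain u where "u \<in> - {0}" "0 = \<omega> u (C u)" unfolding image_iff by (rule bexE)
      then show False using nz[of u] by simp
    qed
    show thesis
    proof (cases "\<omega> v0 (C v0) > 0")
      case True
      have "1 * \<omega> v (C v) > 0" if "v \<noteq> 0" for v
        using no[OF that v0 _ True] nz[OF that] by (cases "\<omega> v (C v) < 0") auto
      then show thesis by (intro that[of 1]) auto
    next
      case False
      then have neg: "\<omega> v0 (C v0) < 0" using nz[OF v0] by simp
      have "(-1) * \<omega> v (C v) > 0" if "v \<noteq> 0" for v
        using no[OF v0 that neg] nz[OF that] by (cases "\<omega> v (C v) > 0") auto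
      then show thesis by (intro that[of "-1"]) auto
    qed
  qed
  have p0: "p \<noteq> 0"
  proof
    assume "p = 0"
    define u where "u = (if S v0 = 0 then v0 else S v0)"
    have "u \<noteq> 0" "S u = 0" using v0 p[of v0] \<open>p = 0\<close> by (auto simp: u_def)
    then show False using q_nz[of u] linear_0[OF lin2] by simp
  qed
  define k where "k = \<epsilon> / sqrt \<delta>"
  have k0: "k \<noteq> 0" using \<open>\<delta> > 0\<close> \<epsilon>(1) by (auto simp: k_def)
  have kk: "k * k * \<delta> = 1" using \<open>\<delta> > 0\<close> \<epsilon>(1) by (simp add: k_def)
  define J where "J v = k *\<^sub>R C v" for v
  have JJ: "J (J v) = - v" for v
  proof -
    have "J (J v) = (- (k * k * \<delta>)) *\<^sub>R v" by (simp add: J_def linear_scale[OF linC] CC)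
    then show ?thesis by (simp add: kk)
  qed
  have J: "compatible_complex_structure \<omega> J"
    unfolding compatible_complex_structure_def
  proof (intro conjI allI impI)
    show "linear J" unfolding J_def by (rule linear_compose_scale_right[OF linC])
    show "J (J v) = - v" for v by (rule JJ)
    show "\<omega> (J v) (J w) = \<omega> v w" for v w
    proof -
      have "\<omega> (C v) (C w) = - \<omega> v (C (C w))" using C_adj[of v "C w"] by simp
      also have "\<dots> = \<delta> * \<omega> v w" by (simp only: CC om) simp
      finally have "\<omega> (J v) (J w) = (k * k * \<delta>) * \<omega> v w" by (simp add: J_def om)
      then show ?thesis by (simp add: kk)
    qed
    show "\<omega> v (J v) > 0" if "v \<noteq> 0" for v
    proof -
      have "\<omega> v (J v) = (\<epsilon> * \<omega> v (C v)) / sqrt \<delta>" by (simp add: J_def om k_def)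
      then show ?thesis using \<epsilon>(2)[OF that] \<open>\<delta> > 0\<close> by simp
    qed
  qed
  \<comment> \<open>The matrix \<open>A'\<close> turns \<open>\<alpha> + \<i> \<beta>\<close> into \<open>\<alpha> + \<i> (k B \<alpha> - k p \<beta>)\<close>, the form with operators \<open>S\<close> and \<open>- S J\<close>;
    the matrix \<open>A\<close> is its inverse.\<close>
  define A' :: "real^2^2" where "A' = (\<chi> i j. if i = 1 then (if j = 1 then 1 else 0) else (if j = 1 then k * B else - (k * p)))"
  define A :: "real^2^2" where "A = (\<chi> i j. if i = 1 then (if j = 1 then 1 else 0) else (if j = 1 then B / p else - (1 / (k * p))))"
  have A'_act: "matrix_act A' z = Complex (Re z) (k * B * Re z - k * p * Im z)" for z
    by (simp add: matrix_act_def A'_def)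
  have A_act: "matrix_act A z = Complex (Re z) (B / p * Re z - 1 / (k * p) * Im z)" for z
    by (simp add: matrix_act_def A_def)
  have detA': "det A' \<noteq> 0" using k0 p0 by (simp add: det_2 A'_def)
  have detA: "det A \<noteq> 0" using k0 p0 by (simp add: det_2 A_def)
  define \<Omega>' where "\<Omega>' v = matrix_act A' (\<Omega> v)" for v
  have \<Omega>': "\<Omega>' \<in> U_forms 2 \<omega>" unfolding \<Omega>'_def[abs_def] by (rule matrix_act_U_forms[OF \<Omega> detA'])
  have \<Omega>_eq: "\<Omega> v = matrix_act A (\<Omega>' v)" for v
    using k0 p0 by (simp add: \<Omega>'_def A'_act A_act complex_eq_iff field_simps)
  have pair': "\<Omega>' (pair v w) = Complex (\<omega> (S v) w) (- \<omega> (S (J v)) w)" for v w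
  proof -
    have "S (J v) = k *\<^sub>R (p *\<^sub>R T v - B *\<^sub>R S v)" by (simp add: J_def C_def Sl p)
    then have "\<omega> (S (J v)) w = k * (p * \<omega> (T v) w - B * \<omega> (S v) w)" by (simp only: om real_scaleR_def)
    then show ?thesis
      unfolding \<Omega>'_def A'_act S(2)[of v] T(2)[of v] by (simp add: \<alpha>_def \<beta>_def algebra_simps)
  qed
  have J1: "\<Omega>' (pair (J v) w) = \<i> * \<Omega>' (pair v w)" for v w
    unfolding pair' JJ by (simp add: complex_eq_iff linear_neg[OF S(1)] linear_neg[OF lin2])
  have alt': "alternating_form 2 \<Omega>'" by (rule U_forms_alternating[OF \<Omega>'])
  have "type_n_0 2 J \<Omega>'"
    unfolding type_n_0_def
  proof (intro allI impI)
    fix v x and i :: nat assume "i < 2"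
    then consider "i = 0" | "i = 1" by linarith
    then have "\<Omega>' (v(i := J x)) = \<i> * \<Omega>' (v(i := x))"
    proof cases
      case 1
      then show ?thesis
        using two_form_pair[OF alt', of "v(i := J x)"] two_form_pair[OF alt', of "v(i := x)"] J1 by simp
    next
      case 2
      have e: "\<Omega>' (v(i := z)) = - \<Omega>' (pair z (v 0))" for z
        using two_form_pair[OF alt', of "v(i := z)"] two_form_flip[OF alt', of "v 0" z] 2 by simp
      show ?thesis unfolding e J1 by simp
    qed
    then show "\<Omega>' (v(i := x)) + \<i> * \<Omega>' (v(i := J x)) = 0" by (simp flip: mult.assoc)
  qed
  then have "\<Omega>' \<in> U_geom 2 \<omega>" using \<Omega>' J by (auto simp: U_geom_def)
  then show ?thesis using detA \<Omega>_eq by (intro exI[of _ A] exI[of _ \<Omega>']) auto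
qed

section \<open>The systolic bound\<close>

text \<open>
  Negative determinants are included for even \<open>n\<close>, which dimension four requires.
\<close>

lemma systolic_bound_geometric_orbit:
  fixes \<omega> :: "'a::euclidean_space \<Rightarrow> 'a \<Rightarrow> real"
  assumes torus: "rational_symplectic_torus \<omega> \<Lambda>" and dim: "DIM('a) = 2 * CARD('n::finite)"
  shows "\<exists>C>0. \<forall>A. \<forall>\<Omega>\<in>U_geom CARD('n) \<omega>. det A > 0 \<or> det A \<noteq> 0 \<and> even CARD('n) \<longrightarrow>
    (Sys TYPE('n) \<omega> \<Lambda> (\<lambda>v. matrix_act A (\<Omega> v)))\<^sup>2 \<le> ereal (C * Vol CARD('n) \<omega> \<Lambda> (\<lambda>v. matrix_act A (\<Omega> v)))"
proof -
  have \<omega>: "symplectic_form \<omega>" using torus by (simp add: rational_symplectic_torus_def)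
  obtain m where m: "CARD('n) = Suc m" using zero_less_card_finite[where 'a = 'n] gr0_conv_Suc by blast
  obtain M where M: "M > 0" "\<And>e i. primitive_frame \<Lambda> e DIM('a) \<Longrightarrow> i < DIM('a) \<Longrightarrow>
      \<exists>f\<in>\<Lambda>. \<forall>j<DIM('a). \<omega> (e j) f = (if j = i then M else 0)"
    by (rule symplectic_dual_lattice_vectors[OF torus]) (rule that)
  obtain c where c: "c > 0" "\<And>J \<Omega> x A. compatible_complex_structure \<omega> J \<Longrightarrow> alternating_form CARD('n) \<Omega> \<Longrightarrow>
      type_n_0 CARD('n) J \<Omega> \<Longrightarrow> unitary_frame \<omega> J CARD('n) x \<Longrightarrow> det A > 0 \<or> even CARD('n) \<Longrightarrow>
      c * (\<bar>det A\<bar> * (cmod (\<Omega> x))\<^sup>2) \<le> Vol CARD('n) \<omega> \<Lambda> (\<lambda>v. matrix_act A (\<Omega> v))"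
    using Vol_lower_bound[OF torus dim zero_less_card_finite] by blast
  define K where "K = 2 * M * ((4/3) ^ m * (2 * M)) ^ m"
  have K: "K > 0" using M(1) by (simp add: K_def)
  have "(Sys TYPE('n) \<omega> \<Lambda> (\<lambda>v. matrix_act A (\<Omega> v)))\<^sup>2 \<le>
      ereal (K / c * Vol CARD('n) \<omega> \<Lambda> (\<lambda>v. matrix_act A (\<Omega> v)))"
    if geom: "\<Omega> \<in> U_geom CARD('n) \<omega>" and A: "det A > 0 \<or> det A \<noteq> 0 \<and> even CARD('n)" for A \<Omega>
  proof -
    have \<Omega>: "\<Omega> \<in> U_forms CARD('n) \<omega>" using geom by (simp add: U_geom_def)
    obtain J where J: "compatible_complex_structure \<omega> J" and type: "type_n_0 CARD('n) J \<Omega>"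
      using geom unfolding U_geom_def by blast
    interpret compatible_structure \<omega> J by unfold_locales (rule \<omega> J)+
    have A0: "det A \<noteq> 0" using A by auto
    obtain e x where e: "primitive_frame \<Lambda> e CARD('n)" "isotropic \<omega> e CARD('n)"
      and x: "unitary_frame \<omega> J CARD('n) x"
      and bound: "(cmod (matrix_act A (\<Omega> e)))\<^sup>2 \<le> K * \<bar>det A\<bar> * (cmod (\<Omega> x))\<^sup>2"
      using short_lagrangian_frame_bound[OF _ torus M _ _ A0, of m \<Omega>] dim \<Omega> type
      unfolding K_def m by blast
    have alt: "alternating_form CARD('n) \<Omega>" by (rule U_forms_alternating[OF \<Omega>])
    have "lagrangian_subspace \<omega> (span (e ` {..<CARD('n)}))"
      using e(1) by (intro isotropic_span_lagrangian[OF \<omega> dim _ e(2)]) (simp add: primitive_frame_def)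
    then have "\<Omega> e \<noteq> 0" by (rule U_forms_nonzero_on_frame[OF \<Omega>])
    then have nz: "matrix_act A (\<Omega> e) \<noteq> 0" by (simp add: matrix_act_eq_0_iff[OF A0])
    have "(Sys TYPE('n) \<omega> \<Lambda> (\<lambda>v. matrix_act A (\<Omega> v)))\<^sup>2 \<le> ereal ((cmod (matrix_act A (\<Omega> e)))\<^sup>2)"
      by (rule Sys_squared_le[OF torus dim e alternating_form_matrix_act[OF alt] nz])
    also have "\<dots> \<le> ereal (K / c * Vol CARD('n) \<omega> \<Lambda> (\<lambda>v. matrix_act A (\<Omega> v)))"
    proof -
      have "K * \<bar>det A\<bar> * (cmod (\<Omega> x))\<^sup>2 = K / c * (c * (\<bar>det A\<bar> * (cmod (\<Omega> x))\<^sup>2))"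
        using c(1) by simp
      also have "\<dots> \<le> K / c * Vol CARD('n) \<omega> \<Lambda> (\<lambda>v. matrix_act A (\<Omega> v))"
        using A K c(1) by (intro mult_left_mono c(2)[OF J alt type x]) auto
      finally show ?thesis using bound by simp
    qed
    finally show ?thesis .
  qed
  moreover have "K / c > 0" using K c(1) by simp
  ultimately show ?thesis by blast
qed

theorem theorem1p2:
  fixes \<omega> :: "'a::euclidean_space \<Rightarrow> 'a \<Rightarrow> real" and \<Lambda> :: "'a set"
  assumes dim: "DIM('a) = 2 * CARD('n::finite)"
    and torus: "rational_symplectic_torus \<omega> \<Lambda>"
  shows "U_ag CARD('n) \<omega> \<subseteq> U_plus CARD('n) \<omega> \<and>
    (\<exists>C>0. \<forall>\<Omega> \<in> U_ag CARD('n) \<omega>.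
       (Sys TYPE('n) \<omega> \<Lambda> \<Omega>)\<^sup>2 \<le> ereal (C * Vol CARD('n) \<omega> \<Lambda> \<Omega>)) \<and>
    (DIM('a) = 4 \<longrightarrow>
      (\<exists>C>0. \<forall>\<Omega> \<in> U_plus CARD('n) \<omega>.
         (Sys TYPE('n) \<omega> \<Lambda> \<Omega>)\<^sup>2 \<le> ereal (C * Vol CARD('n) \<omega> \<Lambda> \<Omega>)))"
proof -
  obtain C where C: "C > 0" and bound: "\<And>A \<Omega>. \<Omega> \<in> U_geom CARD('n) \<omega> \<Longrightarrow>
      det A > 0 \<or> det A \<noteq> 0 \<and> even CARD('n) \<Longrightarrow>
      (Sys TYPE('n) \<omega> \<Lambda> (\<lambda>v. matrix_act A (\<Omega> v)))\<^sup>2 \<le> ereal (C * Vol CARD('n) \<omega> \<Lambda> (\<lambda>v. matrix_act A (\<Omega> v)))"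
    using systolic_bound_geometric_orbit[OF torus dim] by blast
  have ag: "(Sys TYPE('n) \<omega> \<Lambda> \<Omega>)\<^sup>2 \<le> ereal (C * Vol CARD('n) \<omega> \<Lambda> \<Omega>)"
    if "\<Omega> \<in> U_ag CARD('n) \<omega>" for \<Omega>
    using that bound unfolding U_ag_def by blast
  have plus: "(Sys TYPE('n) \<omega> \<Lambda> \<Omega>)\<^sup>2 \<le> ereal (C * Vol CARD('n) \<omega> \<Lambda> \<Omega>)"
    if dim4: "DIM('a) = 4" and \<Omega>: "\<Omega> \<in> U_plus CARD('n) \<omega>" for \<Omega>
  proof -
    have \<omega>: "symplectic_form \<omega>" using torus by (simp add: rational_symplectic_torus_def)
    have card: "CARD('n) = 2" using dim dim4 by simp
    obtain x y where xy: "symplectic_basis 2 \<omega> x y" and U: "\<Omega> \<in> U_forms 2 \<omega>"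
      using \<Omega> unfolding U_plus_def card by blast
    obtain A \<Omega>' where A: "det A \<noteq> 0" "\<Omega>' \<in> U_geom 2 \<omega>" and eq: "\<Omega> = (\<lambda>v. matrix_act A (\<Omega>' v))"
      using U_forms_dim4_geometric[OF \<omega> dim4 xy U] by blast
    have "even CARD('n)" by (simp add: card)
    then show ?thesis unfolding eq using A by (intro bound) (simp_all add: card)
  qed
  have "U_ag CARD('n) \<omega> \<subseteq> U_plus CARD('n) \<omega>"
    by (rule U_ag_subset_U_plus[OF torus dim zero_less_card_finite])
  then show ?thesis using C ag plus by blast
qed

end
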